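(* Let $m\geq n$ be positive integers, consider the generic $m\times n$ matrix of indeterminates $(x_{ij})$, and let $I$ denote the ideal in the polynomial ring $S=\mathbb{C}[x_{ij} : 1\le i\le m,\ 1\le j\le n]$ generated by the $n\times n$ minors of $(x_{ij})$. The $b$-function (Bernstein--Sato polynomial) of $I$ is given by \[b_I(s)=\prod_{i=m-n+1}^m (s+i).\]
   Context: Definition of the $b$-function of an ideal. Let $S=\mathbb{C}[x_1,\dots,x_N]$ be a polynomial ring and $\mathcal{D}=\mathcal{D}_X=S[\partial_1,\dots,\partial_N]$, $\partial_i=\partial/\partial x_i$, the Weyl algebra of differential operators on $X=\mathbb{A}^N$ (here the $x_i$ are the indeterminate entries of the matrix). Let $f=(f_1,\dots,f_r)$ be a tuple of non-zero polynomials in $S$, and let $\underline{s}=(s_1,\dots,s_r)$ be independent commuting variables, one for each $f_i$. Let \[B^f_{\underline s}=S_{f_1\cdots f_r}[s_1,\dots,s_r]\cdot f^{\underline s},\] where $S_{f_1\cdots f_r}$ is the localization of $S$ at the product $f_1\cdots f_r$ and $f^{\underline s}$ stands for the formal product $f_1^{s_1}\cdots f_r^{s_r}$. It is a free rank one $S_{f_1\cdots f_r}[s_1,\dots,s_r]$-module with generator $f^{\underline s}$, and a $\mathcal{D}_X[s_1,\dots,s_r]$-module via the Leibniz rule and $\partial_i\cdot f^{\underline s}=\sum_{j=1}^r \frac{s_j\,(\partial f_j/\partial x_i)}{f_j}\cdot f^{\underline s}$. For $\hat c=(c_1,\dots,c_r)\in\mathbb{Z}^r$ write $|\hat c|=c_1+\cdots+c_r$,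 write $\prod_i f_i^{s_i+c_i}$ for the element $f_1^{c_1}\cdots f_r^{c_r}\cdot f^{\underline s}$, and put \[\hat c_{\underline s}=\prod_{i:\,c_i<0} s_i(s_i-1)\cdots(s_i+c_i+1).\] Put $s=s_1+\cdots+s_r$. The $b$-function $b_f(s)$ is the monic polynomial in $s$ (with complex coefficients) of lowest degree for which there exist a finite set of tuples $\hat c\in\mathbb{Z}^r$ with $|\hat c|=1$ and operators $P_{\hat c}\in\mathcal{D}_X[s_1,\dots,s_r]$ such that \[\sum_{\hat c}P_{\hat c}\cdot\hat c_{\underline s}\cdot\prod_{i=1}^r f_i^{s_i+c_i}=b_f(s)\cdot f^{\underline s}.\] It is known that $b_f(s)$ exists and depends only on the ideal $I$ generated by $f_1,\dots,f_r$; it is denoted $b_I(s)$. *)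

theory Defs
  imports
    "HOL-Library.Poly_Mapping"
    "HOL-Library.Product_Lexorder"
    "HOL-Computational_Algebra.Polynomial"
    "HOL-Computational_Algebra.Fraction_Field"
    "HOL-Computational_Algebra.Polynomial_Factorial"
    "Jordan_Normal_Form.Determinant"
    "Jordan_Normal_Form.DL_Submatrix"
begin

section \<open>Polynomial rings and ideals\<close>

text \<open>
  The variables are indexed by pairs \<open>(i, j)\<close>, counted from 0. As the type \<open>spoly\<close> has infinitely
  many variables, the ring $S$ with finite variable set \<open>V\<close> is its subset \<open>polys V\<close>.
  The linear order on the index type is only needed by the library to make \<open>spoly\<close> an
  integral domain.
\<close>

type_synonym var = "nat \<times> nat"
type_synonym spoly = "(var \<Rightarrow>\<^sub>0 nat) \<Rightarrow>\<^sub>0 complex"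

definition Var :: "var \<Rightarrow> spoly" where
  "Var v = Poly_Mapping.single (Poly_Mapping.single v 1) 1"

definition polys :: "var set \<Rightarrow> spoly set" where
  "polys V = {p. \<forall>a \<in> Poly_Mapping.keys p. Poly_Mapping.keys a \<subseteq> V}"

definition ideal_gen :: "var set \<Rightarrow> spoly set \<Rightarrow> spoly set" where
  "ideal_gen V A = {\<Sum>a\<in>F. q a * a | F q. finite F \<and> F \<subseteq> A \<and> (\<forall>a\<in>F. q a \<in> polys V)}"


section \<open>Partial derivatives\<close>

definition pd :: "var \<Rightarrow> spoly \<Rightarrow> spoly" where
  "pd v p = (\<Sum>a\<in>Poly_Mapping.keys p.
     Poly_Mapping.single (a - Poly_Mapping.single v 1)
       (of_nat (Poly_Mapping.lookup a v) * Poly_Mapping.lookup p a))"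

lemma pd_superset:
  assumes "finite K" "Poly_Mapping.keys p \<subseteq> K"
  shows "pd v p = (\<Sum>a\<in>K. Poly_Mapping.single (a - Poly_Mapping.single v 1)
     (of_nat (Poly_Mapping.lookup a v) * Poly_Mapping.lookup p a))"
  unfolding pd_def using assms
  by (intro sum.mono_neutral_left) (auto simp: in_keys_iff)

lemma pd_add: "pd v (p + q) = pd v p + pd v q"
proof -
  let ?K = "Poly_Mapping.keys p \<union> Poly_Mapping.keys q"
  have "pd v (p + q) = (\<Sum>a\<in>?K. Poly_Mapping.single (a - Poly_Mapping.single v 1)
     (of_nat (Poly_Mapping.lookup a v) * Poly_Mapping.lookup (p + q) a))"
    by (rule pd_superset) (auto simp: Poly_Mapping.keys_add)
  also have "\<dots> = pd v p + pd v q"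
    by (subst (1 2) pd_superset[where K = ?K])
       (auto simp: lookup_add single_add algebra_simps sum.distrib)
  finally show ?thesis .
qed

lemma pd_zero: "pd v 0 = 0"
  by (simp add: pd_def)

lemma pd_single:
  "pd v (Poly_Mapping.single a c) =
     Poly_Mapping.single (a - Poly_Mapping.single v 1) (of_nat (Poly_Mapping.lookup a v) * c)"
  by (cases "c = 0") (simp_all add: pd_def)

lemma diff_single_add:
  fixes a b :: "var \<Rightarrow>\<^sub>0 nat"
  assumes "Poly_Mapping.lookup a v \<noteq> 0"
  shows "a + b - Poly_Mapping.single v 1 = (a - Poly_Mapping.single v 1) + b"
proof (rule poly_mapping_eqI)
  fix k
  show "Poly_Mapping.lookup (a + b - Poly_Mapping.single v 1) k =
      Poly_Mapping.lookup (a - Poly_Mapping.single v 1 + b) k"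
    using assms by (cases "k = v") (simp_all add: lookup_add lookup_minus lookup_single)
qed

lemma pd_mult_single:
  "pd v (Poly_Mapping.single a c * Poly_Mapping.single b d) =
     pd v (Poly_Mapping.single a c) * Poly_Mapping.single b d +
     Poly_Mapping.single a c * pd v (Poly_Mapping.single b d)"
proof -
  let ?e = "Poly_Mapping.single v (1::nat)"
  have A: "Poly_Mapping.single (a + b - ?e) (of_nat (Poly_Mapping.lookup a v) * (c * d))
     = pd v (Poly_Mapping.single a c) * Poly_Mapping.single b d"
    using diff_single_add[of a v b]
    by (cases "Poly_Mapping.lookup a v = 0") (auto simp: pd_single mult_single mult_ac add_ac)
  have B: "Poly_Mapping.single (a + b - ?e) (of_nat (Poly_Mapping.lookup b v) * (c * d))
     = Poly_Mapping.single a c * pd v (Poly_Mapping.single b d)"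
    using diff_single_add[of b v a]
    by (cases "Poly_Mapping.lookup b v = 0") (auto simp: pd_single mult_single mult_ac add_ac)
  show ?thesis
    unfolding A[symmetric] B[symmetric]
    by (simp add: mult_single pd_single lookup_add algebra_simps flip: single_add)
qed

lemma poly_mapping_add_induct:
  assumes "P 0" "\<And>a c. P (Poly_Mapping.single a c)" "\<And>p q. P p \<Longrightarrow> P q \<Longrightarrow> P (p + q)"
  shows "P (p :: spoly)"
proof -
  have "P (\<Sum>a\<in>K. Poly_Mapping.single a (Poly_Mapping.lookup p a))" if "finite K" for K
    using that by induction (use assms in auto)
  moreover have "(\<Sum>a\<in>Poly_Mapping.keys p. Poly_Mapping.single a (Poly_Mapping.lookup p a)) = p"
    by (rule poly_mapping_eqI)
       (auto simp: lookup_sum lookup_single when_def in_keys_iff sum.delta)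
  ultimately show ?thesis
    by (metis finite_keys)
qed

lemma pd_mult: "pd v (p * q) = pd v p * q + p * pd v q"
proof (induction p rule: poly_mapping_add_induct)
  case (2 a c)
  show ?case
    by (induction q rule: poly_mapping_add_induct)
       (simp_all add: pd_zero pd_mult_single pd_add algebra_simps)
qed (simp_all add: pd_zero pd_add algebra_simps)

lemma pd_fract_well_defined:
  assumes nz: "b \<noteq> 0" "d \<noteq> 0" and "Fract a b = Fract c d"
  shows "Fract (pd v a * b - a * pd v b) (b * b) = Fract (pd v c * d - c * pd v d) (d * d)"
proof -
  from assms have eq: "a * d = c * b"
    by (simp add: eq_fract)
  have "pd v a * d + a * pd v d = pd v c * b + c * pd v b"
    using arg_cong[OF eq, of "pd v"] by (simp add: pd_mult)
  moreover have "(pd v a * b - a * pd v b) * (d * d) - (pd v c * d - c * pd v d) * (b * b) =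
      b * d * ((pd v a * d + a * pd v d) - (pd v c * b + c * pd v b)) +
      (d * pd v b + b * pd v d) * (c * b - a * d)"
    by (simp add: algebra_simps)
  ultimately have "(pd v a * b - a * pd v b) * (d * d) = (pd v c * d - c * pd v d) * (b * b)"
    using eq by simp
  then show ?thesis
    using nz by (simp add: eq_fract)
qed

definition pd_fract :: "var \<Rightarrow> spoly fract \<Rightarrow> spoly fract" where
  "pd_fract v q = (THE d. \<forall>a b. b \<noteq> 0 \<longrightarrow> q = Fract a b \<longrightarrow>
     d = Fract (pd v a * b - a * pd v b) (b * b))"

lemma pd_fract_Fract:
  assumes "b \<noteq> 0"
  shows "pd_fract v (Fract a b) = Fract (pd v a * b - a * pd v b) (b * b)"
  unfolding pd_fract_def
proof (rule the_equality)
  show "\<forall>a' b'. b' \<noteq> 0 \<longrightarrow> Fract a b = Fract a' b' \<longrightarrow>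
      Fract (pd v a * b - a * pd v b) (b * b) = Fract (pd v a' * b' - a' * pd v b') (b' * b')"
    using pd_fract_well_defined[OF assms] by blast
qed (use assms in blast)


section \<open>The module of $f^s$\<close>

text \<open>
  A tuple $f = (f_1,\dots,f_r)$ is a list \<open>fs\<close>, indexed from 0. An element $u \cdot f^s$ of
  $B^f_s = S_{f_1\cdots f_r}[s_1,\dots,s_r] \cdot f^s$ is represented by its coefficient \<open>u\<close>, a
  polynomial in the $s_j$ over the fraction field of $S$, which contains the localization; in
  particular $f^s$ itself is represented by 1. The operators below map $B^f_s$ to itself, and they
  are only ever applied to elements of $B^f_s$.
\<close>

type_synonym bmod = "(nat \<Rightarrow>\<^sub>0 nat) \<Rightarrow>\<^sub>0 spoly fract"

definition fconst :: "spoly fract \<Rightarrow> bmod" where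
  "fconst g = Poly_Mapping.single 0 g"

definition cconst :: "complex \<Rightarrow> bmod" where
  "cconst c = fconst (to_fract (Poly_Mapping.single 0 c))"

definition s_var :: "nat \<Rightarrow> bmod" where
  "s_var j = Poly_Mapping.single (Poly_Mapping.single j 1) 1"

definition s_sum :: "nat \<Rightarrow> bmod" where
  "s_sum r = (\<Sum>j<r. s_var j)"

text \<open>The action of $\partial_v$: the coefficientwise derivative of \<open>u\<close>, plus \<open>u\<close> times
  the logarithmic derivative of $f^s$.\<close>

definition pd_act :: "spoly list \<Rightarrow> var \<Rightarrow> bmod \<Rightarrow> bmod" where
  "pd_act fs v u = Poly_Mapping.map (pd_fract v) u +
     u * (\<Sum>j<length fs. s_var j * fconst (to_fract (pd v (fs ! j)) / to_fract (fs ! j)))"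

text \<open>The operators by which the elements of $\mathcal{D}_X[s_1,\dots,s_r]$ act: the
  algebra generated over the complex numbers by the $x_v$, the $\partial_v$ and the $s_j$.\<close>

inductive_set diff_ops :: "var set \<Rightarrow> spoly list \<Rightarrow> (bmod \<Rightarrow> bmod) set"
  for V :: "var set" and fs :: "spoly list" where
  scalar: "(\<lambda>u. cconst c * u) \<in> diff_ops V fs"
| mult_x: "v \<in> V \<Longrightarrow> (\<lambda>u. fconst (to_fract (Var v)) * u) \<in> diff_ops V fs"
| mult_s: "j < length fs \<Longrightarrow> (\<lambda>u. s_var j * u) \<in> diff_ops V fs"
| deriv: "v \<in> V \<Longrightarrow> pd_act fs v \<in> diff_ops V fs"
| add: "P \<in> diff_ops V fs \<Longrightarrow> Q \<in> diff_ops V fs \<Longrightarrow> (\<lambda>u. P u + Q u) \<in> diff_ops V fs"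
| comp: "P \<in> diff_ops V fs \<Longrightarrow> Q \<in> diff_ops V fs \<Longrightarrow> (\<lambda>u. P (Q u)) \<in> diff_ops V fs"


section \<open>The b-function\<close>

definition shifted_power :: "spoly list \<Rightarrow> int list \<Rightarrow> bmod" where
  "shifted_power fs c = fconst (\<Prod>j<length fs. to_fract (fs ! j) powi (c ! j))"

definition falling_s :: "int list \<Rightarrow> bmod" where
  "falling_s c = (\<Prod>j | j < length c \<and> c ! j < 0. \<Prod>k<nat (- (c ! j)). s_var j - of_nat k)"

definition bernstein_relation :: "var set \<Rightarrow> spoly list \<Rightarrow> complex poly \<Rightarrow> bool" where
  "bernstein_relation V fs b \<longleftrightarrow>
     (\<exists>C P. finite C \<and>
        (\<forall>c\<in>C. length c = length fs \<and> sum_list c = 1 \<and> P c \<in> diff_ops V fs) \<and>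
        (\<Sum>c\<in>C. P c (falling_s c * shifted_power fs c)) =
          poly (map_poly cconst b) (s_sum (length fs)))"

definition is_b_function :: "var set \<Rightarrow> spoly list \<Rightarrow> complex poly \<Rightarrow> bool" where
  "is_b_function V fs b \<longleftrightarrow>
     lead_coeff b = 1 \<and> bernstein_relation V fs b \<and>
     (\<forall>b'. lead_coeff b' = 1 \<and> bernstein_relation V fs b' \<longrightarrow> degree b \<le> degree b')"

text \<open>
  The b-function of an ideal is that of any tuple of nonzero generators. Independence of
  the choice is a theorem, so it appears here as a universal quantifier; the first conjunct
  excludes vacuity.
\<close>

definition generating_tuple :: "var set \<Rightarrow> spoly set \<Rightarrow> spoly list \<Rightarrow> bool" where
  "generating_tuple V I fs \<longleftrightarrow>
     set fs \<subseteq> polys V \<and> 0 \<notin> set fs \<and> ideal_gen V (set fs) = I"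

definition is_b_function_of_ideal :: "var set \<Rightarrow> spoly set \<Rightarrow> complex poly \<Rightarrow> bool" where
  "is_b_function_of_ideal V I b \<longleftrightarrow>
     (\<exists>fs. generating_tuple V I fs) \<and>
     (\<forall>fs. generating_tuple V I fs \<longrightarrow> is_b_function V fs b)"


section \<open>Maximal minors of the generic matrix\<close>

definition generic_vars :: "nat \<Rightarrow> nat \<Rightarrow> var set" where
  "generic_vars m n = {..<m} \<times> {..<n}"

definition generic_matrix :: "nat \<Rightarrow> nat \<Rightarrow> spoly mat" where
  "generic_matrix m n = mat m n Var"

definition maximal_minors :: "nat \<Rightarrow> nat \<Rightarrow> spoly set" where
  "maximal_minors m n =
     {det (submatrix (generic_matrix m n) R {..<n}) | R. R \<subseteq> {..<m} \<and> card R = n}"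

end

theory Submission
  imports Defs "HOL-Computational_Algebra.Formal_Power_Series"
begin

text \<open>
  Let $g = \sum_j y_j f_j$ with new variables $y_j$. Sending $e^g$ to $f^s$ and $y_j \partial_{y_j}$
  to $s_j$ embeds $S[y]\,e^g$ into the module of $f^s$, such that $y^p f^q e^g$ corresponds to
  $\hat c_s \prod_i f_i^{s_i + c_i}$ if \<open>p\<close> and \<open>q\<close> are the negative and the positive part of \<open>c\<close>.
  Put $E = \sum_j y_j \partial_{y_j}$ and let $V^k$ be the span of all $y^p P(x, \partial_x) f^q e^g$
  with $|q| = |p| + k$. Then a polynomial \<open>b\<close> satisfies a Bernstein relation iff
  $b(E) e^g \in V^1$ (\<open>filt_of_bernstein\<close>, \<open>bernstein_of_filt\<close>). In this form a change of
  generators is a substitution that is linear in the $y_j$ (\<open>change_generators\<close>), so a single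
  generating tuple of the ideal suffices. The one used is the tuple of the determinants \<open>minor ks\<close>
  of the rows \<open>ks\<close>, for all lists \<open>ks\<close> of \<open>n\<close> row numbers, repeated entries included.

  Existence. The function $e^g$ is an eigenvector of the polarization operators
  $\sum_k x_{ki} \partial_{kj}$, with value zero for $i \neq j$ and \<open>E\<close> for $i = j$. For such a
  function \<open>h\<close> a Capelli identity holds (\<open>capelli_Suc\<close>): the sum of
  $\partial_{k_1 1} \cdots \partial_{k_n n} \det(x_{k_a b})\, h$ over all lists of rows equals
  $(E + m - n + 1) \cdots (E + m)\, h$. The left hand side is in $V^1$.

  Minimality. Introduce dual variables $\xi_{ki}$ and substitute for the $y_j$ monomials in $\xi$
  such that \<open>g\<close> becomes the Gram determinant $D = \det(x^T \xi)$. Let \<open>L\<close> be the Fischer functional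
  $x^\alpha \xi^\beta \mapsto \alpha!\, \delta_{\alpha\beta}$, for which $\partial_x$ is adjoint to
  multiplication by $\xi$. The part of degree \<open>N\<close> in \<open>y\<close> of $b(E) e^g$ is sent to
  $b(N)\, c_N / N!$ with $c_N = L(D^N)$, and the Capelli identity gives
  $c_{N+1} / c_N = \prod_{i=m-n+1}^m (N + i)$. An element of $V^1$ is sent to values
  $L(q F D^{N-d})$, up to factorials, with \<open>F\<close> a product of $d + 1$ minors and \<open>q\<close> independent
  of \<open>N\<close>. If the part of \<open>q\<close> in the variables \<open>x\<close> is a highest weight vector of weight $\mu$ for
  the polarization operators, the Capelli identity evaluates this as a product of factors
  $t + \mu_j + m - j$ with $j < n$, which as a function of \<open>N\<close> is $c_{N+1}$ times a polynomial. The
  general case reduces to this one, because all polynomials arise from highest weight vectors by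
  polarizations (\<open>highest_weight_induct\<close>), and under \<open>L\<close> a polarization of \<open>x\<close> can be moved to one
  of $\xi$ (\<open>L_polar_move\<close>). Hence $b(N) c_N = c_{N+1}\, \rho(N)$ for all large \<open>N\<close>, with a
  polynomial $\rho$, so $\prod_{i=m-n+1}^m (s + i)$ divides \<open>b\<close>.
\<close>

section \<open>Evaluation homomorphisms and derivations\<close>

abbreviation (input) "lookup \<equiv> Poly_Mapping.lookup"
abbreviation (input) "single \<equiv> Poly_Mapping.single"
abbreviation (input) "keys \<equiv> Poly_Mapping.keys"

lemma sum_singles:
  "(\<Sum>a\<in>keys p. single a (lookup p a)) = p"
  by (rule poly_mapping_eqI)
     (auto simp: lookup_sum lookup_single when_def in_keys_iff sum.delta)

lemma pm_add_induct [case_names single add]: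
  assumes "\<And>a c. P (single a c)" "\<And>p q. P p \<Longrightarrow> P q \<Longrightarrow> P (p + q)"
  shows "P (p :: 'a \<Rightarrow>\<^sub>0 'b::comm_monoid_add)"
proof -
  have z: "P 0"
    using assms(1)[of undefined 0] by simp
  have "P (\<Sum>a\<in>K. single a (lookup p a))" if "finite K" for K
    using that by induction (use assms z in auto)
  moreover note sum_singles[of p]
  ultimately show ?thesis
    by (metis finite_keys)
qed

text \<open>
  The additive extension of a map on monomials. Evaluation homomorphisms, Euler operators, falling
  factorials, the functional \<open>L\<close> and the Fischer inner product are of this form, so that identities
  between them can be checked on monomials.
\<close>

definition lin_ext :: "('a \<Rightarrow> 'b::zero \<Rightarrow> 'c::comm_monoid_add) \<Rightarrow> ('a \<Rightarrow>\<^sub>0 'b) \<Rightarrow> 'c" where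
  "lin_ext h p = (\<Sum>a\<in>keys p. h a (lookup p a))"

definition coeff_additive :: "('a \<Rightarrow> 'b::monoid_add \<Rightarrow> 'c::monoid_add) \<Rightarrow> bool" where
  "coeff_additive h \<longleftrightarrow> (\<forall>a. h a 0 = 0) \<and> (\<forall>a x y. h a (x + y) = h a x + h a y)"

lemma lin_ext_superset:
  assumes "coeff_additive h" "finite K" "keys p \<subseteq> K"
  shows "lin_ext h p = (\<Sum>a\<in>K. h a (lookup p a))"
  unfolding lin_ext_def using assms
  by (intro sum.mono_neutral_left) (auto simp: in_keys_iff coeff_additive_def)

lemma lin_ext_add:
  assumes "coeff_additive h"
  shows "lin_ext h (p + q) = lin_ext h p + lin_ext h q"
proof -
  let ?K = "keys p \<union> keys q"
  have "lin_ext h (p + q) = (\<Sum>a\<in>?K. h a (lookup (p + q) a))"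
    by (rule lin_ext_superset) (auto simp: Poly_Mapping.keys_add assms)
  also have "\<dots> = lin_ext h p + lin_ext h q"
    using assms
    by (subst (1 2) lin_ext_superset[where K = ?K])
       (auto simp: lookup_add coeff_additive_def sum.distrib)
  finally show ?thesis .
qed

lemma lin_ext_single: "coeff_additive h \<Longrightarrow> lin_ext h (single a c) = h a c"
  by (cases "c = 0") (auto simp: lin_ext_def coeff_additive_def)

lemma lin_ext_zero [simp]: "lin_ext h 0 = 0"
  by (simp add: lin_ext_def)

lemma lin_ext_sum: "coeff_additive h \<Longrightarrow> lin_ext h (sum f A) = (\<Sum>x\<in>A. lin_ext h (f x))"
  by (induction A rule: infinite_finite_induct) (auto simp: lin_ext_add)

definition eval_mon :: "('v \<Rightarrow> 'r::comm_monoid_mult) \<Rightarrow> ('v \<Rightarrow>\<^sub>0 nat) \<Rightarrow> 'r" where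
  "eval_mon \<psi> a = (\<Prod>v\<in>keys a. \<psi> v ^ lookup a v)"

lemma eval_mon_superset:
  assumes "finite K" "keys a \<subseteq> K"
  shows "eval_mon \<psi> a = (\<Prod>v\<in>K. \<psi> v ^ lookup a v)"
  unfolding eval_mon_def using assms by (intro prod.mono_neutral_left) (auto simp: in_keys_iff)

lemma eval_mon_add: "eval_mon \<psi> (a + b) = eval_mon \<psi> a * eval_mon \<psi> b"
proof -
  let ?K = "keys a \<union> keys b"
  have "eval_mon \<psi> (a + b) = (\<Prod>v\<in>?K. \<psi> v ^ lookup (a + b) v)"
    by (rule eval_mon_superset) (auto simp: Poly_Mapping.keys_add)
  also have "\<dots> = eval_mon \<psi> a * eval_mon \<psi> b"
    by (subst (1 2) eval_mon_superset[where K = ?K])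
       (auto simp: lookup_add power_add prod.distrib)
  finally show ?thesis .
qed

lemma eval_mon_zero [simp]: "eval_mon \<psi> 0 = 1"
  by (simp add: eval_mon_def)

lemma eval_mon_single [simp]: "eval_mon \<psi> (single v k) = \<psi> v ^ k"
  by (cases "k = 0") (auto simp: eval_mon_def)

definition ring_map :: "('a::comm_ring_1 \<Rightarrow> 'b::comm_ring_1) \<Rightarrow> bool" where
  "ring_map \<phi> \<longleftrightarrow> \<phi> 1 = 1 \<and> (\<forall>x y. \<phi> (x + y) = \<phi> x + \<phi> y) \<and> (\<forall>x y. \<phi> (x * y) = \<phi> x * \<phi> y)"

lemma
  assumes "ring_map \<phi>"
  shows ring_map_1: "\<phi> 1 = 1" and ring_map_add: "\<phi> (x + y) = \<phi> x + \<phi> y"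
    and ring_map_mult: "\<phi> (x * y) = \<phi> x * \<phi> y" and ring_map_0: "\<phi> 0 = 0"
proof -
  show "\<phi> 1 = 1" "\<phi> (x * y) = \<phi> x * \<phi> y" and *: "\<phi> (x + y) = \<phi> x + \<phi> y" for x y
    using assms by (auto simp: ring_map_def)
  show "\<phi> 0 = 0"
    using *[of 0 0] by simp
qed

lemma ring_map_uminus: "ring_map \<phi> \<Longrightarrow> \<phi> (- x) = - \<phi> x"
  using ring_map_add[of \<phi> x "- x"] by (simp add: ring_map_0 eq_neg_iff_add_eq_0 add.commute)

lemma ring_map_diff: "ring_map \<phi> \<Longrightarrow> \<phi> (x - y) = \<phi> x - \<phi> y"
  using ring_map_add[of \<phi> x "- y"] by (simp add: ring_map_uminus)

lemma ring_map_sum: "ring_map \<phi> \<Longrightarrow> \<phi> (sum f A) = (\<Sum>x\<in>A. \<phi> (f x))"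
  by (induction A rule: infinite_finite_induct) (auto simp: ring_map_add ring_map_0)

lemma ring_map_prod: "ring_map \<phi> \<Longrightarrow> \<phi> (prod f A) = (\<Prod>x\<in>A. \<phi> (f x))"
  by (induction A rule: infinite_finite_induct) (auto simp: ring_map_mult ring_map_1)

lemma ring_map_power: "ring_map \<phi> \<Longrightarrow> \<phi> (x ^ k) = \<phi> x ^ k"
  by (induction k) (auto simp: ring_map_mult ring_map_1)

lemma ring_map_prod_list: "ring_map \<phi> \<Longrightarrow> \<phi> (prod_list xs) = prod_list (map \<phi> xs)"
  by (induction xs) (auto simp: ring_map_mult ring_map_1)

lemma ring_map_of_nat: "ring_map \<phi> \<Longrightarrow> \<phi> (of_nat k) = of_nat k"
  by (induction k) (auto simp: ring_map_add ring_map_1 ring_map_0)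

lemma ring_map_comp: "ring_map \<phi> \<Longrightarrow> ring_map \<psi> \<Longrightarrow> ring_map (\<lambda>x. \<phi> (\<psi> x))"
  by (simp add: ring_map_def)

lemma ring_map_id: "ring_map (\<lambda>x. x)"
  by (simp add: ring_map_def)

definition eval_hom :: "('b::comm_ring_1 \<Rightarrow> 'r::comm_ring_1) \<Rightarrow> ('v \<Rightarrow> 'r) \<Rightarrow> (('v \<Rightarrow>\<^sub>0 nat) \<Rightarrow>\<^sub>0 'b) \<Rightarrow> 'r" where
  "eval_hom \<phi> \<psi> = lin_ext (\<lambda>a c. \<phi> c * eval_mon \<psi> a)"

lemma coeff_additive_eval_hom: "ring_map \<phi> \<Longrightarrow> coeff_additive (\<lambda>a c. \<phi> c * eval_mon \<psi> a)"
  by (auto simp: coeff_additive_def ring_map_0 ring_map_add algebra_simps)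

lemma eval_hom_single: "ring_map \<phi> \<Longrightarrow> eval_hom \<phi> \<psi> (single a c) = \<phi> c * eval_mon \<psi> a"
  unfolding eval_hom_def by (simp add: lin_ext_single coeff_additive_eval_hom)

lemma eval_hom_add: "ring_map \<phi> \<Longrightarrow> eval_hom \<phi> \<psi> (p + q) = eval_hom \<phi> \<psi> p + eval_hom \<phi> \<psi> q"
  unfolding eval_hom_def by (simp add: lin_ext_add coeff_additive_eval_hom)

lemma eval_hom_mult:
  assumes "ring_map \<phi>"
  shows "eval_hom \<phi> \<psi> (p * q) = eval_hom \<phi> \<psi> p * eval_hom \<phi> \<psi> q"
proof (induction p rule: pm_add_induct)
  case (single a c)
  show ?case
    by (induction q rule: pm_add_induct)
       (simp_all add: assms eval_hom_add eval_hom_single mult_single eval_mon_add ring_map_mult algebra_simps)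
qed (simp add: assms eval_hom_add algebra_simps)

lemma ring_map_eval_hom: "ring_map \<phi> \<Longrightarrow> ring_map (eval_hom \<phi> \<psi>)"
  unfolding ring_map_def[of "eval_hom \<phi> \<psi>"]
  by (simp add: eval_hom_add eval_hom_mult) (simp add: eval_hom_single ring_map_1 flip: single_one)

subsection \<open>Constants, variables and induction\<close>

definition Cst :: "complex \<Rightarrow> spoly" where
  "Cst c = single 0 c"

lemma ring_map_Cst: "ring_map Cst"
  by (simp add: ring_map_def Cst_def single_add mult_single)

lemmas Cst_simps = ring_map_1[OF ring_map_Cst] ring_map_0[OF ring_map_Cst]
  ring_map_add[OF ring_map_Cst] ring_map_mult[OF ring_map_Cst] ring_map_diff[OF ring_map_Cst]
  ring_map_uminus[OF ring_map_Cst]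

lemma Cst_of_nat: "Cst (of_nat k) = of_nat k"
  by (simp add: ring_map_of_nat[OF ring_map_Cst])

lemma eval_hom_Cst: "ring_map \<phi> \<Longrightarrow> eval_hom \<phi> \<psi> (Cst c) = \<phi> c"
  by (simp add: Cst_def eval_hom_single)

lemma eval_hom_Var: "ring_map \<phi> \<Longrightarrow> eval_hom \<phi> \<psi> (Var v) = \<psi> v"
  by (simp add: Var_def eval_hom_single ring_map_1)

lemma polys_Cst [simp]: "Cst c \<in> polys V"
  by (auto simp: polys_def Cst_def)

lemma polys_0 [simp]: "0 \<in> polys V" and polys_1 [simp]: "1 \<in> polys V"
  and polys_of_nat [simp]: "of_nat k \<in> polys V"
  using polys_Cst[of 0 V] polys_Cst[of 1 V] polys_Cst[of "of_nat k" V]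
  by (auto simp: Cst_simps Cst_of_nat simp del: polys_Cst)

lemma polys_Var [simp]: "Var v \<in> polys V \<longleftrightarrow> v \<in> V"
  by (auto simp: polys_def Var_def)

lemma polys_add [intro]: "p \<in> polys V \<Longrightarrow> q \<in> polys V \<Longrightarrow> p + q \<in> polys V"
  using Poly_Mapping.keys_add[of p q] by (auto simp: polys_def)

lemma polys_mult [intro]: "p \<in> polys V \<Longrightarrow> q \<in> polys V \<Longrightarrow> p * q \<in> polys V"
  using keys_mult[of p q] by (auto simp: polys_def dest!: subsetD[OF Poly_Mapping.keys_add] subsetD)

lemma polys_uminus [intro]: "p \<in> polys V \<Longrightarrow> - p \<in> polys V"
  by (auto simp: polys_def)

lemma polys_diff [intro]: "p \<in> polys V \<Longrightarrow> q \<in> polys V \<Longrightarrow> p - q \<in> polys V"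
  using polys_add[of p V "- q"] polys_uminus[of q V] by simp

lemma polys_sum [intro]: "(\<And>x. x \<in> A \<Longrightarrow> f x \<in> polys V) \<Longrightarrow> sum f A \<in> polys V"
  by (induction A rule: infinite_finite_induct) auto

lemma polys_prod [intro]: "(\<And>x. x \<in> A \<Longrightarrow> f x \<in> polys V) \<Longrightarrow> prod f A \<in> polys V"
  by (induction A rule: infinite_finite_induct) auto

lemma polys_prod_list [intro]: "(\<And>x. x \<in> set xs \<Longrightarrow> x \<in> polys V) \<Longrightarrow> prod_list xs \<in> polys V"
  by (induction xs) auto

lemma polys_mono: "V \<subseteq> W \<Longrightarrow> p \<in> polys V \<Longrightarrow> p \<in> polys W"
  by (auto simp: polys_def)

lemma monomial_split:
  assumes "v \<in> keys a"
  shows "single a c = Var v * single (a - single v 1) c"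
proof -
  have "single v 1 + (a - single v 1) = a"
    using assms by (intro poly_mapping_eqI) (auto simp: lookup_add lookup_minus lookup_single when_def in_keys_iff)
  then show ?thesis
    by (simp add: Var_def mult_single)
qed

lemma monomial_induct:
  fixes a :: "var \<Rightarrow>\<^sub>0 nat"
  assumes "keys a \<subseteq> V"
    and cst: "\<And>c. P (Cst c)"
    and mul: "\<And>v b c. v \<in> V \<Longrightarrow> keys b \<subseteq> V \<Longrightarrow> P (single b c) \<Longrightarrow>
       P (Var v * single b c)"
  shows "P (single a c)"
  using assms(1)
proof (induction "\<Sum>v\<in>keys a. lookup a v" arbitrary: a rule: less_induct)
  case less
  show ?case
  proof (cases "keys a = {}")
    case True
    then show ?thesis
      using cst[of c] by (simp add: Cst_def)
  next
    case False
    then obtain v where v: "v \<in> keys a"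
      by blast
    define b where "b = a - single v 1"
    have keys: "keys b \<subseteq> keys a"
      by (auto simp: b_def in_keys_iff lookup_minus)
    have "(\<Sum>w\<in>keys b. lookup b w) =
       (\<Sum>w\<in>keys a. lookup b w)"
      using keys by (intro sum.mono_neutral_left) (auto simp: in_keys_iff)
    also have "\<dots> < (\<Sum>w\<in>keys a. lookup a w)"
    proof (rule sum_strict_mono_ex1)
      show "\<exists>w\<in>keys a. lookup b w < lookup a w"
        using v by (intro bexI[of _ v]) (auto simp: b_def lookup_minus lookup_single in_keys_iff)
    qed (auto simp: b_def lookup_minus)
    finally have "P (single b c)"
      using less keys by blast
    moreover have "keys b \<subseteq> V" "v \<in> V"
      using less.prems keys v by auto
    ultimately show ?thesis
      using mul[of v b c] monomial_split[OF v, of c] by (simp add: b_def)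
  qed
qed

lemma polys_single_induct:
  fixes P :: "spoly \<Rightarrow> bool"
  assumes "p \<in> polys V"
    and single: "\<And>a c. keys a \<subseteq> V \<Longrightarrow> P (single a c)"
    and add: "\<And>p q. p \<in> polys V \<Longrightarrow> q \<in> polys V \<Longrightarrow> P p \<Longrightarrow> P q \<Longrightarrow> P (p + q)"
  shows "P p"
proof -
  have "P (\<Sum>a\<in>K. single a (lookup p a)) \<and>
      (\<Sum>a\<in>K. single a (lookup p a)) \<in> polys V"
    if "finite K" "K \<subseteq> keys p" for K
    using that
  proof induction
    case empty
    then show ?case using single[of 0 0] by simp
  next
    case (insert a K)
    then have k: "keys a \<subseteq> V"
      using assms(1) by (auto simp: polys_def)
    then have "single a (lookup p a) \<in> polys V"
      by (auto simp: polys_def)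
    then show ?case
      using insert k by (auto intro!: add single)
  qed
  moreover note sum_singles[of p]
  ultimately show ?thesis
    by (metis finite_keys order_refl)
qed

text \<open>
  Removing one variable at a time from a monomial is the form of induction that fits derivations and
  homomorphisms: it needs the product rule only for a product with a variable.
\<close>

lemma polys_induct [consumes 1, case_names const var add]:
  assumes "p \<in> polys V"
    and cst: "\<And>c. P (Cst c)"
    and mul: "\<And>v p. v \<in> V \<Longrightarrow> p \<in> polys V \<Longrightarrow> P p \<Longrightarrow> P (Var v * p)"
    and add: "\<And>p q. p \<in> polys V \<Longrightarrow> q \<in> polys V \<Longrightarrow> P p \<Longrightarrow> P q \<Longrightarrow> P (p + q)"
  shows "P p"
  using assms(1)
proof (rule polys_single_induct)
  fix a :: "var \<Rightarrow>\<^sub>0 nat" and c assume "keys a \<subseteq> V"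
  then show "P (single a c)"
    by (rule monomial_induct) (auto intro!: cst mul simp: polys_def)
qed (rule add)

lemma polys_UNIV: "p \<in> polys UNIV"
  by (simp add: polys_def)

subsection \<open>Derivations and the chain rule\<close>

definition derivation :: "('a::comm_ring_1 \<Rightarrow> 'a) \<Rightarrow> bool" where
  "derivation d \<longleftrightarrow> (\<forall>x y. d (x + y) = d x + d y) \<and> (\<forall>x y. d (x * y) = d x * y + x * d y)"

lemma
  assumes "derivation d"
  shows derivation_add: "d (x + y) = d x + d y" and derivation_mult: "d (x * y) = d x * y + x * d y"
    and derivation_0: "d 0 = 0" and derivation_1: "d 1 = 0"
proof -
  show *: "d (x + y) = d x + d y" and **: "d (x * y) = d x * y + x * d y" for x y
    using assms by (auto simp: derivation_def)
  show "d 0 = 0" "d 1 = 0"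
    using *[of 0 0] **[of 1 1] by auto
qed

lemma derivation_uminus: "derivation d \<Longrightarrow> d (- x) = - d x"
  using derivation_add[of d x "- x"] by (simp add: derivation_0 eq_neg_iff_add_eq_0 add.commute)

lemma derivation_sum: "derivation d \<Longrightarrow> d (sum f A) = (\<Sum>x\<in>A. d (f x))"
  by (induction A rule: infinite_finite_induct) (auto simp: derivation_add derivation_0)

lemma derivation_prod_zero:
  "derivation d \<Longrightarrow> (\<And>x. x \<in> A \<Longrightarrow> d (f x) = 0) \<Longrightarrow> d (prod f A) = 0"
  by (induction A rule: infinite_finite_induct) (auto simp: derivation_mult derivation_1)

lemma derivation_prod_list_zero:
  "derivation d \<Longrightarrow> (\<And>x. x \<in> set xs \<Longrightarrow> d x = 0) \<Longrightarrow> d (prod_list xs) = 0"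
  by (induction xs) (auto simp: derivation_mult derivation_1)

lemma derivation_pd: "derivation (pd v)"
  by (simp add: derivation_def pd_add pd_mult)

lemmas pd_sum = derivation_sum[OF derivation_pd]
lemmas pd_uminus = derivation_uminus[OF derivation_pd]
lemmas pd_one = derivation_1[OF derivation_pd]

lemma pd_Cst [simp]: "pd v (Cst c) = 0"
  by (simp add: Cst_def pd_single)

lemma pd_of_nat [simp]: "pd v (of_nat k) = 0"
  using pd_Cst[of v "of_nat k"] by (simp add: Cst_of_nat del: pd_Cst)

lemma pd_Var: "pd v (Var w) = (if v = w then 1 else 0)"
  by (auto simp: Var_def pd_single lookup_single)

lemma pd_polys [intro]: "p \<in> polys V \<Longrightarrow> pd v p \<in> polys V"
  by (induction rule: polys_induct) (auto simp: pd_add pd_mult pd_Var intro!: polys_add polys_mult)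

lemma pd_notin: "p \<in> polys V \<Longrightarrow> v \<notin> V \<Longrightarrow> pd v p = 0"
  by (induction rule: polys_induct) (auto simp: pd_add pd_mult pd_Var)

lemma pd_commute: "pd v (pd w p) = pd w (pd v p)"
  using polys_UNIV[of p]
  by (induction rule: polys_induct) (auto simp: pd_add pd_mult pd_Var pd_zero pd_one algebra_simps)

lemma ring_map_polys_eqI:
  assumes "p \<in> polys U" "ring_map \<phi>" "ring_map \<psi>" "\<And>c. \<phi> (Cst c) = \<psi> (Cst c)"
    "\<And>u. u \<in> U \<Longrightarrow> \<phi> (Var u) = \<psi> (Var u)"
  shows "\<phi> p = \<psi> p"
  using assms(1) by (induction rule: polys_induct) (auto simp: assms ring_map_add ring_map_mult)

text \<open>
  Used for partial derivatives, for the derivative of power series and for derivations of the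
  module of $f^s$; hence the general target ring and the general derivation.
\<close>

lemma chain_rule:
  assumes "p \<in> polys U" "finite U" "ring_map \<phi>" "derivation d" "\<And>c. d (\<phi> c) = 0"
  shows "d (eval_hom \<phi> \<psi> p) = (\<Sum>u\<in>U. d (\<psi> u) * eval_hom \<phi> \<psi> (pd u p))"
  using assms(1)
proof (induction rule: polys_induct)
  case (const c)
  then show ?case
    by (simp add: assms eval_hom_Cst ring_map_0[OF ring_map_eval_hom])
next
  case (var v p)
  have "(\<Sum>u\<in>U. d (\<psi> u) * eval_hom \<phi> \<psi> (pd u (Var v * p))) =
     (\<Sum>u\<in>U. (if u = v then d (\<psi> u) * eval_hom \<phi> \<psi> p else 0) + \<psi> v * (d (\<psi> u) * eval_hom \<phi> \<psi> (pd u p)))"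
    by (intro sum.cong)
       (auto simp: pd_mult pd_Var eval_hom_add eval_hom_mult eval_hom_Var assms ring_map_0[OF ring_map_eval_hom]
          ring_map_1[OF ring_map_eval_hom] algebra_simps)
  also have "\<dots> = d (\<psi> v) * eval_hom \<phi> \<psi> p + \<psi> v * d (eval_hom \<phi> \<psi> p)"
    using var assms by (simp add: sum.distrib sum_distrib_left)
  finally show ?case
    by (simp add: eval_hom_mult eval_hom_Var assms derivation_mult)
next
  case (add p q)
  then show ?case
    by (simp add: assms derivation_add eval_hom_add pd_add algebra_simps sum.distrib)
qed

section \<open>The module $S[y]\,e^g$ and change of generators\<close>

text \<open>
  The derivative $\partial_v$ on $S[y]\,e^g$, where an element $u\,e^g$ is represented by \<open>u\<close>.
\<close>

definition nabla :: "spoly \<Rightarrow> var \<Rightarrow> spoly \<Rightarrow> spoly" where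
  "nabla g v u = pd v u + u * pd v g"

lemma nabla_add: "nabla g v (u + w) = nabla g v u + nabla g v w"
  by (simp add: nabla_def pd_add algebra_simps)

lemma nabla_mult: "nabla g v (p * u) = pd v p * u + p * nabla g v u"
  by (simp add: nabla_def pd_mult algebra_simps)

lemma nabla_zero [simp]: "nabla g v 0 = 0"
  by (simp add: nabla_def pd_zero)

lemma nabla_sum: "nabla g v (sum f A) = (\<Sum>x\<in>A. nabla g v (f x))"
  by (induction A rule: infinite_finite_induct) (auto simp: nabla_add)

lemma nabla_commute: "nabla g v (nabla g w u) = nabla g w (nabla g v u)"
  by (simp add: nabla_def pd_add pd_mult pd_commute[of v w] algebra_simps)

lemma nabla_polys [intro]: "u \<in> polys W \<Longrightarrow> g \<in> polys W \<Longrightarrow> nabla g v u \<in> polys W"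
  unfolding nabla_def by (intro polys_add polys_mult pd_polys)

text \<open>
  The value $b(E)\,u$. The definition by \<open>fold_coeffs\<close> is Horner's scheme, which matches induction
  over the coefficients.
\<close>

definition op_poly :: "(spoly \<Rightarrow> spoly) \<Rightarrow> complex poly \<Rightarrow> spoly \<Rightarrow> spoly" where
  "op_poly E b u = fold_coeffs (\<lambda>a w. Cst a * u + E w) b 0"

definition linear_op :: "(spoly \<Rightarrow> spoly) \<Rightarrow> bool" where
  "linear_op E \<longleftrightarrow> (\<forall>u w. E (u + w) = E u + E w) \<and> (\<forall>c u. E (Cst c * u) = Cst c * E u)"

lemma linear_op_0: "linear_op E \<Longrightarrow> E 0 = 0"
  unfolding linear_op_def by (metis add_cancel_right_left add.right_neutral)

lemma op_poly_0 [simp]: "op_poly E 0 u = 0"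
  by (simp add: op_poly_def)

lemma op_poly_pCons: "linear_op E \<Longrightarrow> op_poly E (pCons a b) u = Cst a * u + E (op_poly E b u)"
  by (cases "a = 0 \<and> b = 0") (auto simp: op_poly_def linear_op_0 Cst_simps)

lemma op_poly_add: "linear_op E \<Longrightarrow> op_poly E (p + q) u = op_poly E p u + op_poly E q u"
  by (induction p q rule: poly_induct2)
     (auto simp: op_poly_pCons Cst_simps linear_op_def algebra_simps)

lemma op_poly_smult: "linear_op E \<Longrightarrow> op_poly E (smult c p) u = Cst c * op_poly E p u"
  by (induction p) (auto simp: op_poly_pCons Cst_simps linear_op_def distrib_left mult.assoc)

lemma op_poly_linear_factor:
  "linear_op E \<Longrightarrow> op_poly E ([:c, 1:] * q) u = Cst c * op_poly E q u + E (op_poly E q u)"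
  by (simp add: op_poly_add op_poly_smult op_poly_pCons Cst_simps)

lemma op_poly_closed:
  assumes "u \<in> A" "0 \<in> A" "\<And>x y. x \<in> A \<Longrightarrow> y \<in> A \<Longrightarrow> x + y \<in> A" "\<And>c x. x \<in> A \<Longrightarrow> Cst c * x \<in> A"
    "\<And>x. x \<in> A \<Longrightarrow> E x \<in> A" "linear_op E"
  shows "op_poly E b u \<in> A"
  by (induction b) (auto simp: op_poly_pCons assms)

text \<open>
  Operators in the variables of \<open>V\<close> only. Keeping them as explicit words in multiplications and
  derivatives allows induction over the word, and a derivative in another variable commutes with
  a word up to changing the argument (\<open>xops_nabla\<close>).
\<close>

inductive_set xops :: "var set \<Rightarrow> spoly \<Rightarrow> (spoly \<Rightarrow> spoly) set"
  for V :: "var set" and g :: spoly where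
  ident: "(\<lambda>u. u) \<in> xops V g"
| mul: "p \<in> polys V \<Longrightarrow> T \<in> xops V g \<Longrightarrow> (\<lambda>u. p * T u) \<in> xops V g"
| nab: "v \<in> V \<Longrightarrow> T \<in> xops V g \<Longrightarrow> (\<lambda>u. nabla g v (T u)) \<in> xops V g"

lemma xops_polys: "T \<in> xops V g \<Longrightarrow> V \<subseteq> W \<Longrightarrow> g \<in> polys W \<Longrightarrow> u \<in> polys W \<Longrightarrow> T u \<in> polys W"
  by (induction rule: xops.induct) (auto intro: polys_mono)

lemma xops_nabla: "T \<in> xops V g \<Longrightarrow> w \<notin> V \<Longrightarrow> nabla g w (T u) = T (nabla g w u)"
proof (induction rule: xops.induct)
  case (nab v T)
  then show ?case using nabla_commute[of g w v] by simp
qed (auto simp: nabla_mult pd_notin)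

locale twisted =
  fixes V :: "var set" and y :: "nat \<Rightarrow> var"
  assumes finite_V: "finite V" and inj_y: "inj y" and y_notin: "y j \<notin> V"
begin

definition VY :: "nat \<Rightarrow> var set" where "VY r = V \<union> y ` {..<r}"

text \<open>
  The exponent \<open>g\<close> of the introduction; a tuple \<open>fs\<close> enters the module $S[y]\,e^g$ only through it.
\<close>

definition gen :: "spoly list \<Rightarrow> spoly" where
  "gen fs = (\<Sum>j<length fs. Var (y j) * fs ! j)"

definition euler :: "spoly list \<Rightarrow> spoly \<Rightarrow> spoly" where
  "euler fs u = (\<Sum>j<length fs. Var (y j) * nabla (gen fs) (y j) u)"

text \<open>
  The module $V^k$ of the introduction. In the algebra of differential operators in \<open>x\<close> and \<open>y\<close>
  these are the elements obtained from $e^g$ by operators which lower the degree in \<open>y\<close> by \<open>k\<close>,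
  since $\partial_{y_j}$ acts on $e^g$ as $f_j$.
\<close>

inductive_set filt :: "spoly list \<Rightarrow> nat \<Rightarrow> spoly set"
  for fs :: "spoly list" and k :: nat where
  zero: "0 \<in> filt fs k"
| base: "T \<in> xops V (gen fs) \<Longrightarrow> set js \<subseteq> {..<length fs} \<Longrightarrow> set is \<subseteq> {..<length fs} \<Longrightarrow>
    length is = length js + k \<Longrightarrow>
    (\<Prod>j\<leftarrow>js. Var (y j)) * T (\<Prod>i\<leftarrow>is. fs ! i) \<in> filt fs k"
| add: "u \<in> filt fs k \<Longrightarrow> w \<in> filt fs k \<Longrightarrow> u + w \<in> filt fs k"

lemma y_eq [simp]: "y i = y j \<longleftrightarrow> i = j"
  using inj_y by (auto simp: inj_def)

lemma y_ne: "v \<in> V \<Longrightarrow> v \<noteq> y j" "v \<in> V \<Longrightarrow> y j \<noteq> v"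
  using y_notin by auto

lemma finite_VY: "finite (VY r)"
  by (simp add: VY_def finite_V)

lemma sum_VY: "(\<Sum>w\<in>VY r. h w) = (\<Sum>w\<in>V. h w) + (\<Sum>i<r. h (y i))" for h :: "var \<Rightarrow> 'a::comm_monoid_add"
proof -
  have "(\<Sum>w\<in>VY r. h w) = (\<Sum>w\<in>V. h w) + (\<Sum>w\<in>y ` {..<r}. h w)"
    unfolding VY_def using y_notin by (intro sum.union_disjoint) (auto simp: finite_V)
  also have "(\<Sum>w\<in>y ` {..<r}. h w) = (\<Sum>i<r. h (y i))"
    by (subst sum.reindex) (auto intro: inj_onI)
  finally show ?thesis .
qed

lemma V_VY: "V \<subseteq> VY r"
  by (auto simp: VY_def)

lemma y_VY: "j < r \<Longrightarrow> y j \<in> VY r"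
  by (auto simp: VY_def)

lemma polys_V_VY: "p \<in> polys V \<Longrightarrow> p \<in> polys (VY r)"
  using V_VY polys_mono by blast

lemma nth_polys: "set fs \<subseteq> polys V \<Longrightarrow> i < length fs \<Longrightarrow> fs ! i \<in> polys V"
  by auto

lemma gen_polys: "set fs \<subseteq> polys V \<Longrightarrow> gen fs \<in> polys (VY (length fs))"
  unfolding gen_def by (intro polys_sum polys_mult) (auto simp: y_VY intro!: polys_V_VY)

lemma pd_y_V: "p \<in> polys V \<Longrightarrow> pd (y j) p = 0"
  using pd_notin y_notin by blast

lemma pd_y_gen:
  assumes "set fs \<subseteq> polys V" "i < length fs"
  shows "pd (y i) (gen fs) = fs ! i"
proof -
  have "pd (y i) (gen fs) = (\<Sum>j<length fs. if i = j then fs ! i else 0)"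
    unfolding gen_def pd_sum using assms
    by (intro sum.cong) (auto simp: pd_mult pd_Var pd_y_V nth_polys)
  then show ?thesis using assms by simp
qed

lemma nabla_y_V:
  assumes "set fs \<subseteq> polys V" "i < length fs" "p \<in> polys V"
  shows "nabla (gen fs) (y i) p = fs ! i * p"
  by (simp add: nabla_def pd_y_gen pd_y_V assms)

lemma prod_fs_polys: "set fs \<subseteq> polys V \<Longrightarrow> set is \<subseteq> {..<length fs} \<Longrightarrow> (\<Prod>i\<leftarrow>is. fs ! i) \<in> polys V"
  by (intro polys_prod_list) (auto simp: nth_polys subset_iff)

lemma euler_linear: "linear_op (euler fs)"
  unfolding linear_op_def euler_def
  by (auto simp: nabla_add nabla_mult distrib_left mult.left_commute sum.distrib sum_distrib_left)

lemma euler_polys: "set fs \<subseteq> polys V \<Longrightarrow> u \<in> polys (VY (length fs)) \<Longrightarrow> euler fs u \<in> polys (VY (length fs))"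
  unfolding euler_def using gen_polys by (intro polys_sum polys_mult nabla_polys) (auto simp: y_VY)

lemma euler_mult: "p \<in> polys V \<Longrightarrow> euler fs (p * u) = p * euler fs u"
  unfolding euler_def by (simp add: nabla_mult pd_y_V sum_distrib_left mult.left_commute)

lemma euler_nabla: "v \<in> V \<Longrightarrow> euler fs (nabla (gen fs) v u) = nabla (gen fs) v (euler fs u)"
  unfolding euler_def
  by (simp add: nabla_sum nabla_mult pd_Var y_ne nabla_commute[of _ v])

lemma op_poly_euler_polys:
  "set fs \<subseteq> polys V \<Longrightarrow> u \<in> polys (VY (length fs)) \<Longrightarrow>
     op_poly (euler fs) b u \<in> polys (VY (length fs))"
  by (rule op_poly_closed) (auto intro: euler_polys simp: euler_linear)

subsection \<open>Closure properties\<close>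

lemma filt_mult: "u \<in> filt fs k \<Longrightarrow> p \<in> polys V \<Longrightarrow> p * u \<in> filt fs k"
proof (induction rule: filt.induct)
  case (base T js "is")
  have "(\<Prod>j\<leftarrow>js. Var (y j)) * (p * T (\<Prod>i\<leftarrow>is. fs ! i)) \<in> filt fs k"
    using base by (intro filt.base[of "\<lambda>u. p * T u"]) (auto intro: xops.mul)
  then show ?case by (simp add: algebra_simps)
qed (auto intro: filt.intros simp: algebra_simps)

lemma pd_y_prod: "v \<in> V \<Longrightarrow> pd v (\<Prod>j\<leftarrow>js. Var (y j)) = 0"
  by (rule derivation_prod_list_zero[OF derivation_pd]) (auto simp: pd_Var y_ne)

lemma filt_nabla: "u \<in> filt fs k \<Longrightarrow> v \<in> V \<Longrightarrow> nabla (gen fs) v u \<in> filt fs k"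
proof (induction rule: filt.induct)
  case (base T js "is")
  have "(\<Prod>j\<leftarrow>js. Var (y j)) * (nabla (gen fs) v (T (\<Prod>i\<leftarrow>is. fs ! i))) \<in> filt fs k"
    using base by (intro filt.base[of "\<lambda>u. nabla (gen fs) v (T u)"]) (auto intro: xops.nab)
  then show ?case using base by (simp add: nabla_mult pd_y_prod)
qed (auto intro: filt.intros simp: nabla_add)

lemma filt_y: "u \<in> filt fs (Suc k) \<Longrightarrow> j < length fs \<Longrightarrow> Var (y j) * u \<in> filt fs k"
proof (induction rule: filt.induct)
  case (base T js "is")
  have "(\<Prod>j\<leftarrow>j # js. Var (y j)) * T (\<Prod>i\<leftarrow>is. fs ! i) \<in> filt fs k"
    using base by (intro filt.base) auto
  then show ?case by (simp add: algebra_simps)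
qed (auto intro: filt.intros simp: algebra_simps)

lemma filt_sum: "(\<And>x. x \<in> A \<Longrightarrow> f x \<in> filt fs k) \<Longrightarrow> sum f A \<in> filt fs k"
  by (induction A rule: infinite_finite_induct) (auto intro: filt.intros)

lemma filt_diff: "u \<in> filt fs k \<Longrightarrow> w \<in> filt fs k \<Longrightarrow> u - w \<in> filt fs k"
  using filt.add[of u fs k "- 1 * w"] filt_mult[of w fs k "- 1"] polys_uminus[OF polys_1, of V] by simp

lemma theta_y_prod:
  "Var (y j) * pd (y j) (\<Prod>j\<leftarrow>js. Var (y j)) = of_nat (count_list js j) * (\<Prod>j\<leftarrow>js. Var (y j))"
  by (induction js) (auto simp: pd_one pd_mult pd_Var algebra_simps)

text \<open>
  The operator $y_j \partial_{y_j}$ has degree zero in \<open>y\<close>: applied to $y^a$ it gives a multiple, and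
  applied to $T(f^b)\,e^g$ it adds one factor $y_j$ and one factor $f_j$.
\<close>

lemma filt_theta:
  assumes "u \<in> filt fs k" "set fs \<subseteq> polys V" "j < length fs"
  shows "Var (y j) * nabla (gen fs) (y j) u \<in> filt fs k"
  using assms(1)
proof (induction rule: filt.induct)
  case (base T js "is")
  let ?Y = "\<Prod>j\<leftarrow>js. Var (y j)" and ?F = "\<Prod>i\<leftarrow>is. fs ! i"
  have "nabla (gen fs) (y j) (T ?F) = T (\<Prod>i\<leftarrow>j # is. fs ! i)"
    using base assms by (simp add: xops_nabla y_notin nabla_y_V prod_fs_polys)
  then have TF: "nabla (gen fs) (y j) (?Y * T ?F) =
      pd (y j) ?Y * T ?F + ?Y * T (\<Prod>i\<leftarrow>j # is. fs ! i)"
    by (simp only: nabla_mult)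
  have "Var (y j) * nabla (gen fs) (y j) (?Y * T ?F) =
      (Var (y j) * pd (y j) ?Y) * T ?F + (Var (y j) * ?Y) * T (\<Prod>i\<leftarrow>j # is. fs ! i)"
    unfolding TF by (simp only: distrib_left mult.assoc)
  also have "\<dots> = of_nat (count_list js j) * (?Y * T ?F) +
      (\<Prod>j\<leftarrow>j # js. Var (y j)) * T (\<Prod>i\<leftarrow>j # is. fs ! i)"
    unfolding theta_y_prod by (simp add: mult.assoc)
  finally have "Var (y j) * nabla (gen fs) (y j) (?Y * T ?F) = of_nat (count_list js j) * (?Y * T ?F) +
      (\<Prod>j\<leftarrow>j # js. Var (y j)) * T (\<Prod>i\<leftarrow>j # is. fs ! i)" .
  moreover have "?Y * T ?F \<in> filt fs k"
    by (rule filt.base) fact+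
  moreover have "(\<Prod>j\<leftarrow>j # js. Var (y j)) * T (\<Prod>i\<leftarrow>j # is. fs ! i) \<in> filt fs k"
    using base assms by (intro filt.base) auto
  ultimately show ?case
    by (metis filt.add filt_mult polys_of_nat)
qed (auto intro: filt.intros simp: nabla_add algebra_simps)

subsection \<open>Change of generators\<close>

text \<open>
  Products of generators are re-expanded one factor at a time; the second list collects the new
  factors.
\<close>

lemma prod_change:
  assumes fs: "set fs \<subseteq> polys V" "set fs' \<subseteq> polys V"
    and B: "\<And>i. i < length fs \<Longrightarrow> fs ! i = (\<Sum>j<length fs'. B i j * fs' ! j)"
    and B': "\<And>i j. B i j \<in> polys V"
  shows "p \<in> polys V \<Longrightarrow> set is \<subseteq> {..<length fs} \<Longrightarrow> set js \<subseteq> {..<length fs'} \<Longrightarrow>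
    p * (\<Prod>i\<leftarrow>is. fs ! i) * (\<Prod>j\<leftarrow>js. fs' ! j) \<in> filt fs' (length is + length js)"
proof (induction "is" arbitrary: p js)
  case Nil
  have "(\<Prod>j\<leftarrow>[]. Var (y j)) * (p * (\<Prod>j\<leftarrow>js. fs' ! j)) \<in> filt fs' (length js)"
    using Nil by (intro filt.base[of "\<lambda>u. p * u"]) (auto intro: xops.intros)
  then show ?case by simp
next
  case (Cons i "is")
  have "p * (\<Prod>i\<leftarrow>i # is. fs ! i) * (\<Prod>j\<leftarrow>js. fs' ! j) =
     (\<Sum>j<length fs'. (p * B i j) * (\<Prod>i\<leftarrow>is. fs ! i) * (\<Prod>j\<leftarrow>j # js. fs' ! j))"
    using Cons.prems by (simp add: B sum_distrib_left sum_distrib_right algebra_simps)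
  moreover have "(p * B i j) * (\<Prod>i\<leftarrow>is. fs ! i) * (\<Prod>j\<leftarrow>j # js. fs' ! j) \<in> filt fs' (length is + length (j # js))"
    if "j < length fs'" for j
    using that Cons.prems B' by (intro Cons.IH) auto
  ultimately show ?case
    by (auto intro!: filt_sum)
qed

text \<open>
  With $f'_j = \sum_i A_{ji} f_i$, the substitution $y_i \mapsto \sum_j A_{ji} y_j$ sends the exponent
  of the tuple \<open>fs\<close> to that of \<open>fs'\<close> and commutes with \<open>E\<close>, because it is linear in \<open>y\<close>. It does
  not commute with $\partial_x$, as the $A_{ji}$ depend on \<open>x\<close>; but the correction terms
  $(\partial_x A_{ji})\, y_j \partial_{y_i}$ have degree zero in \<open>y\<close>, so $V^1$ is preserved.
\<close>

lemma change_generators: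
  assumes fs: "set fs \<subseteq> polys V" "set fs' \<subseteq> polys V"
    and A: "\<And>j. j < length fs' \<Longrightarrow> fs' ! j = (\<Sum>i<length fs. A j i * fs ! i)"
    and A': "\<And>i j. A j i \<in> polys V"
    and B: "\<And>i. i < length fs \<Longrightarrow> fs ! i = (\<Sum>j<length fs'. B i j * fs' ! j)"
    and B': "\<And>i j. B i j \<in> polys V"
    and rel: "op_poly (euler fs) b 1 \<in> filt fs 1"
  shows "op_poly (euler fs') b 1 \<in> filt fs' 1"
proof -
  define r where "r = length fs"
  define r' where "r' = length fs'"
  define \<psi> where "\<psi> w = (if w \<in> y ` {..<r} then \<Sum>j<r'. A (j::nat) (inv_into UNIV y w) * Var (y j) else Var w)" for w
  define \<sigma> where "\<sigma> = eval_hom Cst \<psi>"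
  have \<sigma>: "ring_map \<sigma>"
    unfolding \<sigma>_def by (rule ring_map_eval_hom[OF ring_map_Cst])
  have \<psi>_y: "\<psi> (y i) = (\<Sum>j<r'. A j i * Var (y j))" if "i < r" for i
    using that by (auto simp: \<psi>_def inv_f_f inj_y)
  have \<psi>_V: "\<psi> v = Var v" if "v \<in> V" for v
    using that y_notin by (auto simp: \<psi>_def)
  have \<sigma>_V: "\<sigma> p = p" if "p \<in> polys V" for p
    by (rule ring_map_polys_eqI[OF that \<sigma> ring_map_id])
       (auto simp: \<sigma>_def eval_hom_Cst eval_hom_Var ring_map_Cst \<psi>_V)
  have \<sigma>_y: "\<sigma> (Var (y i)) = \<psi> (y i)" for i
    by (simp add: \<sigma>_def eval_hom_Var ring_map_Cst)
  have \<sigma>_gen: "\<sigma> (gen fs) = gen fs'"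
  proof -
    have "\<sigma> (gen fs) = (\<Sum>i<r. \<Sum>j<r'. Var (y j) * (A j i * fs ! i))"
      using fs unfolding gen_def ring_map_sum[OF \<sigma>] r_def[symmetric]
      by (intro sum.cong refl)
         (simp add: ring_map_mult[OF \<sigma>] \<sigma>_y \<psi>_y \<sigma>_V nth_polys r_def
          sum_distrib_left sum_distrib_right algebra_simps)
    also have "\<dots> = (\<Sum>j<r'. Var (y j) * (\<Sum>i<r. A j i * fs ! i))"
      by (subst sum.swap) (simp add: sum_distrib_left)
    also have "\<dots> = gen fs'"
      unfolding gen_def by (intro sum.cong) (auto simp: A r_def r'_def)
    finally show ?thesis .
  qed
  have chain: "pd v (\<sigma> u) = (\<Sum>w\<in>VY r. pd v (\<psi> w) * \<sigma> (pd w u))" if "u \<in> polys (VY r)" for u v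
    unfolding \<sigma>_def by (rule chain_rule[OF that finite_VY ring_map_Cst derivation_pd]) simp
  have gp: "gen fs \<in> polys (VY r)"
    using gen_polys fs by (simp add: r_def)
  have chain': "nabla (gen fs') v (\<sigma> u) = (\<Sum>w\<in>VY r. pd v (\<psi> w) * \<sigma> (nabla (gen fs) w u))"
    if "u \<in> polys (VY r)" for u v
    by (simp add: nabla_def \<sigma>_gen[symmetric] chain that gp ring_map_add[OF \<sigma>] ring_map_mult[OF \<sigma>]
        sum.distrib sum_distrib_left algebra_simps)
  \<comment> \<open>The failure of the substitution to commute with a derivative in \<open>V\<close>.\<close>
  have nab_V: "nabla (gen fs') v (\<sigma> u) = \<sigma> (nabla (gen fs) v u) +
      (\<Sum>i<r. (\<Sum>j<r'. pd v (A j i) * Var (y j)) * \<sigma> (nabla (gen fs) (y i) u))"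
    if "u \<in> polys (VY r)" "v \<in> V" for u v
  proof -
    have "(\<Sum>w\<in>V. pd v (\<psi> w) * \<sigma> (nabla (gen fs) w u)) =
       (\<Sum>w\<in>V. if v = w then \<sigma> (nabla (gen fs) v u) else 0)"
      by (intro sum.cong) (auto simp: \<psi>_V pd_Var)
    also have "\<dots> = \<sigma> (nabla (gen fs) v u)"
      using that finite_V by simp
    finally show ?thesis
      unfolding chain'[OF that(1)] sum_VY using that
      by (auto simp: \<psi>_y pd_sum pd_mult pd_Var y_ne intro!: sum.cong)
  qed
  have euler_\<sigma>: "euler fs' (\<sigma> u) = \<sigma> (euler fs u)" if "u \<in> polys (VY r)" for u
  proof -
    have 1: "nabla (gen fs') (y j) (\<sigma> u) = (\<Sum>i<r. A j i * \<sigma> (nabla (gen fs) (y i) u))" if "j < r'" for j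
    proof -
      have "pd (y j) (\<psi> (y i)) = A j i" if "i < r" for i
      proof -
        have "pd (y j) (\<psi> (y i)) = (\<Sum>j'<r'. if j = j' then A j i else 0)"
          unfolding \<psi>_y[OF that] pd_sum
          by (intro sum.cong) (auto simp: pd_mult pd_Var pd_y_V A')
        then show ?thesis using \<open>j < r'\<close> by simp
      qed
      moreover have "pd (y j) (\<psi> v) = 0" if "v \<in> V" for v
        using that by (simp add: \<psi>_V pd_Var y_ne)
      ultimately show ?thesis
        unfolding chain'[OF \<open>u \<in> polys (VY r)\<close>] sum_VY by simp
    qed
    have "euler fs' (\<sigma> u) = (\<Sum>j<r'. \<Sum>i<r. A j i * Var (y j) * \<sigma> (nabla (gen fs) (y i) u))"
      unfolding euler_def r'_def[symmetric]
      by (intro sum.cong) (auto simp: 1 sum_distrib_left algebra_simps)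
    also have "\<dots> = (\<Sum>i<r. (\<Sum>j<r'. A j i * Var (y j)) * \<sigma> (nabla (gen fs) (y i) u))"
      by (subst sum.swap) (simp add: sum_distrib_right)
    also have "\<dots> = \<sigma> (euler fs u)"
      unfolding euler_def ring_map_sum[OF \<sigma>] r_def[symmetric]
      by (intro sum.cong) (auto simp: ring_map_mult[OF \<sigma>] \<sigma>_y \<psi>_y)
    finally show ?thesis .
  qed
  have op_\<sigma>: "\<sigma> (op_poly (euler fs) b 1) = op_poly (euler fs') b 1" for b
  proof (induction b)
    case (pCons a b)
    have "op_poly (euler fs) b 1 \<in> polys (VY r)"
      unfolding r_def by (rule op_poly_euler_polys) (use fs in auto)
    then have "\<sigma> (euler fs (op_poly (euler fs) b 1)) = euler fs' (op_poly (euler fs') b 1)"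
      using euler_\<sigma> pCons.IH by metis
    then show ?case
      by (simp add: op_poly_pCons euler_linear ring_map_add[OF \<sigma>] \<sigma>_V)
  qed (simp add: ring_map_0[OF \<sigma>])
  have T: "\<sigma> (T (\<Prod>i\<leftarrow>is. fs ! i)) \<in> filt fs' (length is)"
    if "T \<in> xops V (gen fs)" "set is \<subseteq> {..<r}" for T "is"
    using that
  proof (induction arbitrary: "is" rule: xops.induct)
    case ident
    then show ?case
      using prod_change[OF fs B B', of 1 "is" "[]"] fs
      by (simp add: r_def \<sigma>_V prod_fs_polys)
  next
    case (mul p T)
    then show ?case by (auto simp: ring_map_mult[OF \<sigma>] \<sigma>_V intro!: filt_mult)
  next
    case (nab v T)
    let ?F = "\<Prod>i\<leftarrow>is. fs ! i"
    have F: "?F \<in> polys V"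
      using fs nab.prems by (auto simp: r_def intro: prod_fs_polys)
    have TF: "T ?F \<in> polys (VY r)"
      using nab.hyps gp V_VY polys_V_VY[OF F] by (rule_tac xops_polys)
    have "\<sigma> (nabla (gen fs) v (T ?F)) = nabla (gen fs') v (\<sigma> (T ?F)) -
      (\<Sum>i<r. (\<Sum>j<r'. pd v (A j i) * Var (y j)) * \<sigma> (nabla (gen fs) (y i) (T ?F)))"
      using nab_V[OF TF nab.hyps(1)] by simp
    also have "\<dots> = nabla (gen fs') v (\<sigma> (T ?F)) -
      (\<Sum>i<r. \<Sum>j<r'. pd v (A j i) * (Var (y j) * \<sigma> (T (\<Prod>i\<leftarrow>i # is. fs ! i))))"
      using nab.hyps F fs
      by (simp add: xops_nabla y_notin nabla_y_V r_def sum_distrib_right mult.assoc)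
    also have "\<dots> \<in> filt fs' (length is)"
    proof (intro filt_diff filt_sum)
      show "nabla (gen fs') v (\<sigma> (T ?F)) \<in> filt fs' (length is)"
        using nab by (intro filt_nabla) auto
      fix i j assume "i \<in> {..<r}" "j \<in> {..<r'}"
      then have "\<sigma> (T (\<Prod>i\<leftarrow>i # is. fs ! i)) \<in> filt fs' (Suc (length is))"
        using nab.IH[of "i # is"] nab.prems by auto
      then show "pd v (A j i) * (Var (y j) * \<sigma> (T (\<Prod>i\<leftarrow>i # is. fs ! i))) \<in> filt fs' (length is)"
        using \<open>j \<in> {..<r'}\<close> A' by (intro filt_mult[OF filt_y] pd_polys) (auto simp: r'_def)
    qed
    finally show ?case .
  qed
  have yprod: "(\<Prod>j\<leftarrow>js. \<psi> (y j)) * u \<in> filt fs' k"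
    if "set js \<subseteq> {..<r}" "u \<in> filt fs' (length js + k)" for js u k
    using that
  proof (induction js arbitrary: k)
    case (Cons i js)
    then have u: "(\<Prod>j\<leftarrow>js. \<psi> (y j)) * u \<in> filt fs' (Suc k)"
      by simp
    have "(\<Prod>j\<leftarrow>i # js. \<psi> (y j)) * u = (\<Sum>j<r'. A j i * (Var (y j) * ((\<Prod>j\<leftarrow>js. \<psi> (y j)) * u)))"
      using Cons.prems by (simp add: \<psi>_y sum_distrib_left sum_distrib_right algebra_simps)
    also have "\<dots> \<in> filt fs' k"
      using u A' by (intro filt_sum filt_mult[OF filt_y]) (auto simp: r'_def)
    finally show ?case .
  qed simp
  have "\<sigma> u \<in> filt fs' 1" if "u \<in> filt fs 1" for u
    using that
  proof (induction rule: filt.induct)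
    case (base T js "is")
    have "\<sigma> (T (\<Prod>i\<leftarrow>is. fs ! i)) \<in> filt fs' (length js + 1)"
      using T[of T "is"] base by (simp add: r_def)
    then have "(\<Prod>j\<leftarrow>js. \<psi> (y j)) * \<sigma> (T (\<Prod>i\<leftarrow>is. fs ! i)) \<in> filt fs' 1"
      using base by (intro yprod) (auto simp: r_def)
    moreover have "\<sigma> (\<Prod>j\<leftarrow>js. Var (y j)) = (\<Prod>j\<leftarrow>js. \<psi> (y j))"
      by (simp add: ring_map_prod_list[OF \<sigma>] \<sigma>_y o_def)
    ultimately show ?case
      by (simp add: ring_map_mult[OF \<sigma>])
  qed (auto simp: ring_map_0[OF \<sigma>] ring_map_add[OF \<sigma>] intro: filt.intros)
  then show ?thesis
    using rel op_\<sigma> by metis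
qed

end

section \<open>Minors and the Capelli identity\<close>

lemma det_polys:
  assumes "A \<in> carrier_mat k k" "\<And>a b. a < k \<Longrightarrow> b < k \<Longrightarrow> A $$ (a, b) \<in> polys W"
  shows "det A \<in> polys W"
proof -
  have s: "signof p \<in> polys W" for p :: "nat \<Rightarrow> nat"
    by (auto simp: sign_def intro: polys_uminus)
  show ?thesis
    unfolding det_def'[OF assms(1)]
    by (intro polys_sum polys_mult polys_prod s assms(2)) (auto simp: permutes_in_image)
qed

lemma derivation_det_zero:
  fixes A :: "'a::comm_ring_1 mat"
  assumes "derivation d" "A \<in> carrier_mat k k" "\<And>a b. a < k \<Longrightarrow> b < k \<Longrightarrow> d (A $$ (a, b)) = 0"
  shows "d (det A) = 0"
proof -
  have s: "d (signof p) = 0" for p :: "nat \<Rightarrow> nat"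
    by (auto simp: sign_def derivation_1 derivation_uminus assms)
  have "d (\<Prod>i = 0..<k. A $$ (i, p i)) = 0" if "p permutes {0..<k}" for p
  proof (rule derivation_prod_zero[OF assms(1)])
    fix i assume "i \<in> {0..<k}"
    then show "d (A $$ (i, p i)) = 0"
      using permutes_in_image[OF that, of i] by (intro assms(3)) auto
  qed
  then show ?thesis
    unfolding det_def'[OF assms(2)] derivation_sum[OF assms(1)]
    by (intro sum.neutral) (auto simp: derivation_mult assms(1) s)
qed

lemma derivation_cofactor_zero:
  fixes A :: "'a::comm_ring_1 mat"
  assumes d: "derivation d" and A: "A \<in> carrier_mat k k" and "j < k" "i < k"
    and z: "\<And>a b. a < k \<Longrightarrow> b < k \<Longrightarrow> b \<noteq> j \<Longrightarrow> d (A $$ (a, b)) = 0"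
  shows "d (cofactor A i j) = 0"
proof -
  have "d (det (mat_delete A i j)) = 0"
  proof (rule derivation_det_zero[OF d, of _ "k - 1"])
    fix a b assume "a < k - 1" "b < k - 1"
    then show "d (mat_delete A i j $$ (a, b)) = 0"
      using A \<open>j < k\<close> \<open>i < k\<close> by (auto simp: mat_delete_def intro!: z)
  qed (use mat_delete_carrier[OF A] in auto)
  moreover have "d ((- 1) ^ e) = 0" for e
    by (induction e) (auto simp: derivation_1 derivation_mult derivation_uminus d)
  ultimately show ?thesis
    by (simp add: cofactor_def derivation_mult d)
qed

lemma cofactor_cong:
  assumes "A \<in> carrier_mat k k" "B \<in> carrier_mat k k" "j < k" "i < k"
    "\<And>a b. a < k \<Longrightarrow> b < k \<Longrightarrow> a \<noteq> i \<Longrightarrow> b \<noteq> j \<Longrightarrow> A $$ (a, b) = B $$ (a, b)"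
  shows "cofactor A i j = cofactor B i j"
proof -
  have "mat_delete A i j = mat_delete B i j"
    using assms by (intro eq_matI) (auto simp: mat_delete_def)
  then show ?thesis by (simp add: cofactor_def)
qed

lemma derivation_det_column:
  fixes A :: "'a::comm_ring_1 mat"
  assumes d: "derivation d" and A: "A \<in> carrier_mat k k" and ij: "i < k" "j < k"
    and z: "\<And>a b. a < k \<Longrightarrow> b < k \<Longrightarrow> b \<noteq> j \<Longrightarrow> d (A $$ (a, b)) = 0"
    and c: "\<And>a. a < k \<Longrightarrow> d (A $$ (a, j)) = A $$ (a, i)"
  shows "d (det A) = (if i = j then det A else 0)"
proof -
  define B where "B = mat k k (\<lambda>(a, b). if b = j then A $$ (a, i) else A $$ (a, b))"
  have B: "B \<in> carrier_mat k k"
    by (simp add: B_def)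
  have "d (det A) = (\<Sum>a<k. A $$ (a, i) * cofactor A a j)"
    unfolding laplace_expansion_column[OF A ij(2)] derivation_sum[OF d]
    by (intro sum.cong)
       (auto simp: derivation_mult[OF d] c derivation_cofactor_zero[OF d A ij(2) _ z])
  also have "\<dots> = (\<Sum>a<k. B $$ (a, j) * cofactor B a j)"
    using ij by (intro sum.cong arg_cong2[of _ _ _ _ "(*)"] cofactor_cong[OF A B]) (auto simp: B_def)
  also have "\<dots> = det B"
    using laplace_expansion_column[OF B ij(2)] by simp
  also have "det B = (if i = j then det A else 0)"
  proof (cases "i = j")
    case True
    then have "B = A"
      using A by (intro eq_matI) (auto simp: B_def)
    then show ?thesis using True by simp
  next
    case False
    have "col B i = col B j"
      using ij False by (intro eq_vecI) (auto simp: B_def)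
    then show ?thesis
      using det_identical_columns[OF B False ij] False by simp
  qed
  finally show ?thesis .
qed

definition vmat :: "nat list \<Rightarrow> spoly mat" where
  "vmat ks = mat (length ks) (length ks) (\<lambda>(a, b). Var (ks ! a, b))"

definition minor :: "nat list \<Rightarrow> spoly" where
  "minor ks = det (vmat ks)"

lemma vmat_carrier [simp]: "vmat ks \<in> carrier_mat (length ks) (length ks)"
  by (simp add: vmat_def)

lemma minor_Nil [simp]: "minor [] = 1"
  by (simp add: minor_def vmat_def)

lemma nth_row: "set ks \<subseteq> {..<m} \<Longrightarrow> a < length ks \<Longrightarrow> ks ! a < m"
  using nth_mem by blast

lemma minor_polys:
  assumes "set ks \<subseteq> {..<m}" "length ks \<le> n"
  shows "minor ks \<in> polys ({..<m} \<times> {..<n})"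
  unfolding minor_def
proof (rule det_polys[OF vmat_carrier])
  fix a b assume "a < length ks" "b < length ks"
  then show "vmat ks $$ (a, b) \<in> polys ({..<m} \<times> {..<n})"
    using assms by (auto simp: vmat_def nth_row)
qed

definition polar :: "nat \<Rightarrow> (var \<Rightarrow> spoly \<Rightarrow> spoly) \<Rightarrow> nat \<Rightarrow> nat \<Rightarrow> spoly \<Rightarrow> spoly" where
  "polar m \<delta> i j w = (\<Sum>k<m. Var (k, i) * \<delta> (k, j) w)"

lemma derivation_polar: "derivation (polar m pd i j)"
  by (auto simp: derivation_def polar_def pd_add pd_mult algebra_simps sum.distrib sum_distrib_left)

lemma polar_Var: "k < m \<Longrightarrow> polar m pd i j (Var (k, b)) = (if b = j then Var (k, i) else 0)"
proof -
  assume "k < m"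
  have "polar m pd i j (Var (k, b)) = (\<Sum>k'<m. if k' = k then (if b = j then Var (k, i) else 0) else 0)"
    unfolding polar_def by (intro sum.cong) (auto simp: pd_Var)
  then show ?thesis using \<open>k < m\<close> by simp
qed

lemma polar_minor:
  assumes "set ks \<subseteq> {..<m}" "i < length ks" "j < length ks"
  shows "polar m pd i j (minor ks) = (if i = j then minor ks else 0)"
  unfolding minor_def
proof (rule derivation_det_column[OF derivation_polar vmat_carrier assms(2,3)])
  show "polar m pd i j (vmat ks $$ (a, b)) = 0" if "a < length ks" "b < length ks" "b \<noteq> j" for a b
    using that assms by (auto simp: vmat_def polar_Var nth_row)
  show "polar m pd i j (vmat ks $$ (a, j)) = vmat ks $$ (a, i)" if "a < length ks" for a
    using that assms by (auto simp: vmat_def polar_Var nth_row)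
qed

lemma vmat_snoc_index:
  "a \<le> length ks \<Longrightarrow> b \<le> length ks \<Longrightarrow>
     vmat (ks @ [k]) $$ (a, b) = Var (if a < length ks then ks ! a else k, b)"
  by (auto simp: vmat_def nth_append)

lemma cofactor_vmat_snoc: "cofactor (vmat (ks @ [k])) (length ks) (length ks) = minor ks"
proof -
  have "mat_delete (vmat (ks @ [k])) (length ks) (length ks) = vmat ks"
    by (intro eq_matI) (auto simp: mat_delete_def vmat_def nth_append)
  then show ?thesis
    by (simp add: cofactor_def minor_def)
qed

text \<open>
  The sum of the two cofactors is the determinant in which the last column is replaced by the sum of
  two unit vectors; that matrix has two equal rows.
\<close>

lemma cofactor_vmat_repeated:
  assumes "a < length ks"
  shows "cofactor (vmat (ks @ [ks ! a])) a (length ks) = - minor ks"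
proof -
  let ?A = "vmat (ks @ [ks ! a])" and ?j = "length ks"
  have A: "?A \<in> carrier_mat (Suc ?j) (Suc ?j)"
    using vmat_carrier[of "ks @ [ks ! a]"] by simp
  define B where "B = mat (Suc ?j) (Suc ?j)
    (\<lambda>(i, b). if b = ?j then (if i = a \<or> i = ?j then 1 else 0) else ?A $$ (i, b))"
  have B: "B \<in> carrier_mat (Suc ?j) (Suc ?j)"
    by (simp add: B_def)
  have row: "row B a = row B ?j"
    using assms by (intro eq_vecI) (auto simp: B_def vmat_snoc_index)
  have "0 = det B"
    using det_identical_rows[OF B _ _ _ row] assms by simp
  also have "\<dots> = (\<Sum>i<Suc ?j. B $$ (i, ?j) * cofactor B i ?j)"
    by (rule laplace_expansion_column[OF B]) simp
  also have "\<dots> = (\<Sum>i<Suc ?j. (if i = a then cofactor ?A a ?j else 0) + (if i = ?j then cofactor ?A ?j ?j else 0))"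
  proof (rule sum.cong)
    fix i assume i: "i \<in> {..<Suc ?j}"
    have "cofactor B i ?j = cofactor ?A i ?j"
      using i by (intro cofactor_cong[OF B A]) (auto simp: B_def)
    then show "B $$ (i, ?j) * cofactor B i ?j =
      (if i = a then cofactor ?A a ?j else 0) + (if i = ?j then cofactor ?A ?j ?j else 0)"
      using i assms by (auto simp: B_def)
  qed simp
  also have "\<dots> = cofactor ?A a ?j + minor ks"
    using assms by (simp add: sum.distrib cofactor_vmat_snoc)
  finally show ?thesis
    by (simp add: eq_neg_iff_add_eq_0)
qed

text \<open>
  Both $\partial_v$ on polynomials and its twisted version on $S[y]\,e^g$ are of this kind, so the
  Capelli identity can be proved for both at once.
\<close>

definition connection :: "(var \<Rightarrow> spoly \<Rightarrow> spoly) \<Rightarrow> bool" where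
  "connection \<delta> \<longleftrightarrow> (\<forall>v u w. \<delta> v (u + w) = \<delta> v u + \<delta> v w) \<and>
     (\<forall>v p u. \<delta> v (p * u) = pd v p * u + p * \<delta> v u)"

lemma connection_add: "connection \<delta> \<Longrightarrow> \<delta> v (u + w) = \<delta> v u + \<delta> v w"
  and connection_mult: "connection \<delta> \<Longrightarrow> \<delta> v (p * u) = pd v p * u + p * \<delta> v u"
  unfolding connection_def by blast+

lemma connection_0: "connection \<delta> \<Longrightarrow> \<delta> v 0 = 0"
  using connection_add[of \<delta> v 0 0] by simp

text \<open>
  By the product rule there are two contributions. Where the derivative hits \<open>h\<close>, expansion along the
  last row produces polarizations of \<open>h\<close>, of which only the diagonal one survives. Where it hits the
  determinant, the last row contributes \<open>m\<close> times the smaller minor, and each of the other rows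
  contributes minus one times it, through the case in which the last row repeats that row.
\<close>

lemma capelli_last_row:
  assumes \<delta>: "connection \<delta>" and ks: "set ks \<subseteq> {..<m}"
    and h: "\<And>b. b < length ks \<Longrightarrow> polar m \<delta> b (length ks) h = 0"
  shows "(\<Sum>k<m. \<delta> (k, length ks) (minor (ks @ [k]) * h)) =
     minor ks * (polar m \<delta> (length ks) (length ks) h + (of_nat m - of_nat (length ks)) * h)"
proof -
  let ?j = "length ks"
  let ?A = "\<lambda>k. vmat (ks @ [k])"
  have A: "?A k \<in> carrier_mat (Suc ?j) (Suc ?j)" for k
    using vmat_carrier[of "ks @ [k]"] by simp
  define C where "C b = cofactor (?A 0) ?j b" for b
  have C: "cofactor (?A k) ?j b = C b" if "b \<le> ?j" for k b
    unfolding C_def using that by (intro cofactor_cong[OF A A]) (auto simp: vmat_snoc_index)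
  have Cj: "C ?j = minor ks"
    by (simp add: C_def cofactor_vmat_snoc)
  have row: "minor (ks @ [k]) = (\<Sum>b<Suc ?j. C b * Var (k, b))" for k
    unfolding minor_def
    by (subst laplace_expansion_row[OF A, of ?j]) (auto simp: C vmat_snoc_index intro!: sum.cong)
  have "(\<Sum>k<m. minor (ks @ [k]) * \<delta> (k, ?j) h) = (\<Sum>b<Suc ?j. C b * polar m \<delta> b ?j h)"
    unfolding row polar_def sum_distrib_right sum_distrib_left
    by (subst sum.swap) (simp add: mult.assoc)
  also have "\<dots> = minor ks * polar m \<delta> ?j ?j h"
    using h by (simp add: Cj)
  finally have 1: "(\<Sum>k<m. minor (ks @ [k]) * \<delta> (k, ?j) h) = minor ks * polar m \<delta> ?j ?j h" .
  have cofactor_const: "pd (k, ?j) (cofactor (?A k) a ?j) = 0" if "a < Suc ?j" for a k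
    by (rule derivation_cofactor_zero[OF derivation_pd A lessI that]) (auto simp: vmat_snoc_index pd_Var)
  have pdm: "pd (k, ?j) (minor (ks @ [k])) = minor ks - (\<Sum>a<?j. if ks ! a = k then minor ks else 0)" for k
  proof -
    have "pd (k, ?j) (minor (ks @ [k])) =
       (\<Sum>a<Suc ?j. pd (k, ?j) (?A k $$ (a, ?j)) * cofactor (?A k) a ?j)"
      unfolding minor_def laplace_expansion_column[OF A lessI] pd_sum
      by (intro sum.cong) (auto simp: pd_mult cofactor_const)
    also have "\<dots> = minor ks + (\<Sum>a<?j. pd (k, ?j) (?A k $$ (a, ?j)) * cofactor (?A k) a ?j)"
      by (simp add: vmat_snoc_index pd_Var cofactor_vmat_snoc)
    also have "(\<Sum>a<?j. pd (k, ?j) (?A k $$ (a, ?j)) * cofactor (?A k) a ?j) =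
       (\<Sum>a<?j. - (if ks ! a = k then minor ks else 0))"
      by (intro sum.cong) (auto simp: vmat_snoc_index pd_Var cofactor_vmat_repeated)
    finally show ?thesis
      by (simp add: sum_negf)
  qed
  have "(\<Sum>k<m. pd (k, ?j) (minor (ks @ [k]))) =
     of_nat m * minor ks - (\<Sum>a<?j. \<Sum>k<m. if ks ! a = k then minor ks else 0)"
    unfolding pdm sum_subtractf by (subst sum.swap) simp
  also have "(\<Sum>a<?j. \<Sum>k<m. if ks ! a = k then minor ks else 0) = of_nat ?j * minor ks"
    using ks by (simp add: nth_row)
  finally have 2: "(\<Sum>k<m. pd (k, ?j) (minor (ks @ [k]))) = (of_nat m - of_nat ?j) * minor ks"
    by (simp add: algebra_simps)
  have ring: "c * M * h + M * P = M * (P + c * h)" for c M P :: spoly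
    by (simp add: algebra_simps)
  have "(\<Sum>k<m. \<delta> (k, ?j) (minor (ks @ [k]) * h)) =
     (\<Sum>k<m. pd (k, ?j) (minor (ks @ [k]))) * h + (\<Sum>k<m. minor (ks @ [k]) * \<delta> (k, ?j) h)"
    by (simp only: connection_mult[OF \<delta>] sum.distrib sum_distrib_right)
  also have "\<dots> = minor ks * (polar m \<delta> ?j ?j h + (of_nat m - of_nat ?j) * h)"
    unfolding 1 2 by (rule ring)
  finally show ?thesis .
qed

definition diag_op :: "(var \<Rightarrow> spoly \<Rightarrow> spoly) \<Rightarrow> nat list \<Rightarrow> spoly \<Rightarrow> spoly" where
  "diag_op \<delta> ks w = foldr (\<lambda>a. \<delta> (ks ! a, a)) [0..<length ks] w"

lemma diag_op_Nil [simp]: "diag_op \<delta> [] w = w"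
  by (simp add: diag_op_def)

lemma diag_op_snoc: "diag_op \<delta> (ks @ [k]) w = diag_op \<delta> ks (\<delta> (k, length ks) w)"
proof -
  have "foldr (\<lambda>a. \<delta> ((ks @ [k]) ! a, a)) [0..<length ks] u = foldr (\<lambda>a. \<delta> (ks ! a, a)) [0..<length ks] u" for u
    by (rule foldr_cong) (auto simp: nth_append)
  then show ?thesis
    by (simp add: diag_op_def)
qed

definition rows :: "nat \<Rightarrow> nat \<Rightarrow> nat list set" where
  "rows m j = {ks. length ks = j \<and> set ks \<subseteq> {..<m}}"

lemma sum_rows_Suc:
  fixes f :: "nat list \<Rightarrow> 'a::comm_monoid_add"
  shows "sum f (rows m (Suc j)) = (\<Sum>ks\<in>rows m j. \<Sum>k<m. f (ks @ [k]))"
  unfolding sum.cartesian_product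
proof (rule sum.reindex_bij_witness[where i = "\<lambda>(ks, k). ks @ [k]" and j = "\<lambda>ks. (butlast ks, last ks)"])
  fix ks assume "ks \<in> rows m (Suc j)"
  then have "ks \<noteq> []" "length ks = Suc j" "set ks \<subseteq> {..<m}"
    by (auto simp: rows_def)
  then show "(case (butlast ks, last ks) of (ks, k) \<Rightarrow> ks @ [k]) = ks"
    "(butlast ks, last ks) \<in> rows m j \<times> {..<m}"
    "(case (butlast ks, last ks) of (ks, k) \<Rightarrow> f (ks @ [k])) = f ks"
    using subsetD[OF \<open>set ks \<subseteq> {..<m}\<close> last_in_set[of ks]] by (auto simp: rows_def dest: in_set_butlastD)
qed (auto simp: rows_def)

lemma diag_op_add: "connection \<delta> \<Longrightarrow> diag_op \<delta> ks (u + w) = diag_op \<delta> ks u + diag_op \<delta> ks w"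
  by (induction ks arbitrary: u w rule: rev_induct) (simp_all add: diag_op_snoc connection_add)

lemma diag_op_sum:
  assumes "connection \<delta>"
  shows "diag_op \<delta> ks (sum f A) = (\<Sum>x\<in>A. diag_op \<delta> ks (f x))"
proof -
  have "diag_op \<delta> ks 0 = 0"
    by (induction ks rule: rev_induct) (auto simp: diag_op_snoc connection_0[OF assms])
  then show ?thesis
    by (induction A rule: infinite_finite_induct) (auto simp: diag_op_add[OF assms])
qed

definition capelli :: "nat \<Rightarrow> (var \<Rightarrow> spoly \<Rightarrow> spoly) \<Rightarrow> nat \<Rightarrow> spoly \<Rightarrow> spoly" where
  "capelli m \<delta> j h = (\<Sum>ks\<in>rows m j. diag_op \<delta> ks (minor ks * h))"

lemma capelli_0: "capelli m \<delta> 0 h = h"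
proof -
  have "rows m 0 = {[]}" by (auto simp: rows_def)
  then show ?thesis by (simp add: capelli_def)
qed

text \<open>
  One step of the Capelli identity. The eigenvalue \<open>K\<close> is an operator rather than a number, because
  for $h = e^g$ it is the Euler operator in the variables \<open>y\<close>.
\<close>

lemma capelli_Suc:
  assumes \<delta>: "connection \<delta>" and j: "j < n"
    and h: "\<And>b. b < j \<Longrightarrow> polar m \<delta> b j h = 0" "polar m \<delta> j j h = K h"
    and K_add: "\<And>u w. K (u + w) = K u + K w"
    and K_mult: "\<And>p u. p \<in> polys ({..<m} \<times> {..<n}) \<Longrightarrow> K (p * u) = p * K u"
    and K_\<delta>: "\<And>v u. v \<in> {..<m} \<times> {..<n} \<Longrightarrow> K (\<delta> v u) = \<delta> v (K u)"
  shows "capelli m \<delta> (Suc j) h = K (capelli m \<delta> j h) + (of_nat m - of_nat j) * capelli m \<delta> j h"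
proof -
  define K' where "K' u = K u + (of_nat m - of_nat j) * u" for u
  have K'_add: "K' (u + w) = K' u + K' w" for u w
    by (simp add: K'_def K_add algebra_simps)
  have K'_mult: "K' (p * u) = p * K' u" if "p \<in> polys ({..<m} \<times> {..<n})" for p u
    by (simp add: K'_def K_mult that algebra_simps)
  have K'_0: "K' 0 = 0"
    using K'_mult[of 0 0] by simp
  have c: "\<delta> v ((of_nat m - of_nat j) * u) = (of_nat m - of_nat j) * \<delta> v u" for v u
  proof -
    have "pd v (of_nat m - of_nat j) = 0"
      using pd_add[of v "of_nat m" "- of_nat j"] by (simp add: pd_uminus)
    then show ?thesis
      by (simp add: connection_mult[OF \<delta>])
  qed
  have K'_\<delta>: "K' (\<delta> v u) = \<delta> v (K' u)" if "v \<in> {..<m} \<times> {..<n}" for v u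
    unfolding K'_def K_\<delta>[OF that] by (simp add: c connection_add[OF \<delta>])
  have K'_diag: "K' (diag_op \<delta> ks u) = diag_op \<delta> ks (K' u)" if "set ks \<subseteq> {..<m}" "length ks \<le> n" for ks u
    using that by (induction ks arbitrary: u rule: rev_induct) (auto simp: diag_op_snoc K'_\<delta>)
  have K'_sum: "K' (sum f A) = (\<Sum>x\<in>A. K' (f x))" for f and A :: "nat list set"
    by (induction A rule: infinite_finite_induct) (auto simp: K'_add K'_0)
  have "capelli m \<delta> (Suc j) h = (\<Sum>ks\<in>rows m j. diag_op \<delta> ks (\<Sum>k<m. \<delta> (k, j) (minor (ks @ [k]) * h)))"
    unfolding capelli_def sum_rows_Suc diag_op_snoc diag_op_sum[OF \<delta>]
    by (intro sum.cong) (auto simp: rows_def)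
  also have "\<dots> = (\<Sum>ks\<in>rows m j. diag_op \<delta> ks (minor ks * K' h))"
  proof (rule sum.cong)
    fix ks assume "ks \<in> rows m j"
    then have "set ks \<subseteq> {..<m}" "length ks = j"
      by (auto simp: rows_def)
    then show "diag_op \<delta> ks (\<Sum>k<m. \<delta> (k, j) (minor (ks @ [k]) * h)) = diag_op \<delta> ks (minor ks * K' h)"
      using capelli_last_row[OF \<delta>, of ks m h] h by (simp add: K'_def)
  qed simp
  also have "\<dots> = K' (capelli m \<delta> j h)"
    unfolding capelli_def K'_sum
  proof (rule sum.cong)
    fix ks assume "ks \<in> rows m j"
    then have "set ks \<subseteq> {..<m}" "length ks = j"
      by (auto simp: rows_def)
    then show "diag_op \<delta> ks (minor ks * K' h) = K' (diag_op \<delta> ks (minor ks * h))"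
      using j by (simp add: K'_diag K'_mult minor_polys)
  qed simp
  finally show ?thesis
    by (simp add: K'_def)
qed

section \<open>Comparison of $S[y]\,e^g$ with the module of $f^s$\<close>

subsection \<open>Derivations of the coefficients\<close>

lemma pd_fract_quot:
  assumes "b \<noteq> 0"
  shows "pd_fract v (to_fract a / to_fract b) =
    (to_fract (pd v a) * to_fract b - to_fract a * to_fract (pd v b)) / (to_fract b * to_fract b)"
  using pd_fract_Fract[OF assms, of v a] by (simp add: Fract_conv_to_fract)

lemma pd_fract_to_fract: "pd_fract v (to_fract a) = to_fract (pd v a)"
  using pd_fract_quot[of 1 v a] by (simp add: pd_one)

lemma fract_quot_cases:
  obtains a b where "q = to_fract a / to_fract b" "b \<noteq> 0"
  by (metis Fract_cases Fract_conv_to_fract)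

lemma quotient_rule_add:
  fixes a b c d :: "'a::field"
  assumes "b \<noteq> 0" "d \<noteq> 0"
  shows "((a' * d + a * d' + (c' * b + c * b')) * (b * d) - (a * d + c * b) * (b' * d + b * d')) / (b * d * (b * d)) =
    (a' * b - a * b') / (b * b) + (c' * d - c * d') / (d * d)"
  using assms by (simp add: divide_simps) (simp add: algebra_simps)

lemma quotient_rule_mult:
  fixes a b c d :: "'a::field"
  assumes "b \<noteq> 0" "d \<noteq> 0"
  shows "((a' * c + a * c') * (b * d) - (a * c) * (b' * d + b * d')) / (b * d * (b * d)) =
    (a' * b - a * b') / (b * b) * (c / d) + a / b * ((c' * d - c * d') / (d * d))"
  using assms by (simp add: divide_simps) (simp add: algebra_simps)

lemma derivation_pd_fract: "derivation (pd_fract v)"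
proof -
  have *: "pd_fract v (q + r) = pd_fract v q + pd_fract v r \<and>
      pd_fract v (q * r) = pd_fract v q * r + q * pd_fract v r" for q r
  proof -
    obtain a b where q: "q = to_fract a / to_fract b" "b \<noteq> 0"
      by (rule fract_quot_cases)
    obtain c d where r: "r = to_fract c / to_fract d" "d \<noteq> 0"
      by (rule fract_quot_cases)
    have sum: "q + r = to_fract (a * d + c * b) / to_fract (b * d)"
      using q(2) r(2) by (simp add: q(1) r(1) add_frac_eq)
    have prod: "q * r = to_fract (a * c) / to_fract (b * d)"
      using q r by simp
    have bd: "b * d \<noteq> 0"
      using q(2) r(2) by simp
    note quots = pd_fract_quot[OF bd] pd_fract_quot[OF q(2)] pd_fract_quot[OF r(2)]
    have "pd_fract v (q + r) = pd_fract v q + pd_fract v r"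
      unfolding sum unfolding q(1) r(1) unfolding quots unfolding pd_add pd_mult to_fract_add to_fract_mult
      using q(2) r(2) by (intro quotient_rule_add) simp_all
    moreover have "pd_fract v (q * r) = pd_fract v q * r + q * pd_fract v r"
      unfolding prod unfolding q(1) r(1) unfolding quots unfolding pd_add pd_mult to_fract_add to_fract_mult
      using q(2) r(2) by (intro quotient_rule_mult) simp_all
    ultimately show ?thesis by simp
  qed
  then show ?thesis by (simp add: derivation_def)
qed

lemma derivation_of_nat: "derivation d \<Longrightarrow> d (of_nat k) = 0"
  by (induction k) (auto simp: derivation_0 derivation_add derivation_1)

lemma of_nat_fract_eq_iff: "(of_nat k :: spoly fract) = of_nat l \<longleftrightarrow> k = l"
proof -
  have "(of_nat k :: spoly fract) = to_fract (of_nat k)" for k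
    by (induction k) auto
  then show ?thesis by simp
qed

lemma ring_map_to_fract: "ring_map to_fract"
  by (simp add: ring_map_def)

lemma ring_map_fconst: "ring_map fconst"
  by (simp add: ring_map_def fconst_def single_add mult_single)

lemma ring_map_cconst: "ring_map cconst"
  using ring_map_comp[OF ring_map_fconst ring_map_comp[OF ring_map_to_fract ring_map_Cst]]
  by (simp add: cconst_def[abs_def] Cst_def)

lemma cconst_Cst: "cconst c = fconst (to_fract (Cst c))"
  by (simp add: cconst_def Cst_def)

definition coeff_pd :: "var \<Rightarrow> bmod \<Rightarrow> bmod" where
  "coeff_pd v u = Poly_Mapping.map (pd_fract v) u"

lemma lookup_coeff_pd: "lookup (coeff_pd v u) a = pd_fract v (lookup u a)"
  unfolding coeff_pd_def using derivation_0[OF derivation_pd_fract, of v]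
  by (simp add: Poly_Mapping.map.rep_eq when_def)

lemma coeff_pd_single: "coeff_pd v (single a c) = single a (pd_fract v c)"
  unfolding coeff_pd_def by (simp add: derivation_0[OF derivation_pd_fract])

lemma coeff_pd_add: "coeff_pd v (u + w) = coeff_pd v u + coeff_pd v w"
  by (rule poly_mapping_eqI) (simp add: lookup_coeff_pd lookup_add derivation_add[OF derivation_pd_fract])

lemma derivation_coeff_pd: "derivation (coeff_pd v)"
proof -
  have "coeff_pd v (u * w) = coeff_pd v u * w + u * coeff_pd v w" for u w
  proof (induction u rule: pm_add_induct)
    case (single a c)
    show ?case
      by (induction w rule: pm_add_induct)
         (simp_all add: mult_single coeff_pd_single coeff_pd_add derivation_mult[OF derivation_pd_fract]
           single_add algebra_simps)
  qed (simp_all add: coeff_pd_add algebra_simps)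
  then show ?thesis
    by (simp add: derivation_def coeff_pd_add)
qed

lemma coeff_pd_fconst: "coeff_pd v (fconst g) = fconst (pd_fract v g)"
  by (simp add: fconst_def coeff_pd_single)

lemma coeff_pd_s_var: "coeff_pd v (s_var j) = 0"
  by (simp add: s_var_def coeff_pd_single derivation_1[OF derivation_pd_fract])

lemma coeff_pd_cconst: "coeff_pd v (cconst c) = 0"
  by (simp add: cconst_Cst coeff_pd_fconst pd_fract_to_fract ring_map_0[OF ring_map_fconst])

text \<open>
  The Euler operator in the \<open>j\<close>-th variable.
\<close>

definition degree_op :: "nat \<Rightarrow> bmod \<Rightarrow> bmod" where
  "degree_op j = lin_ext (\<lambda>a c. single a (of_nat (lookup a j) * c))"

lemma coeff_additive_degree_op:
  "coeff_additive (\<lambda>a c. single a (of_nat (lookup a j) * c :: spoly fract))"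
  by (auto simp: coeff_additive_def single_add algebra_simps)

lemma degree_op_single:
  "degree_op j (single a c) = single a (of_nat (lookup a j) * c)"
  unfolding degree_op_def by (simp add: lin_ext_single coeff_additive_degree_op)

lemma degree_op_add: "degree_op j (u + w) = degree_op j u + degree_op j w"
  unfolding degree_op_def by (simp add: lin_ext_add coeff_additive_degree_op)

lemma derivation_degree_op: "derivation (degree_op j)"
proof -
  have "degree_op j (u * w) = degree_op j u * w + u * degree_op j w" for u w
  proof (induction u rule: pm_add_induct)
    case (single a c)
    show ?case
      by (induction w rule: pm_add_induct)
         (simp_all add: mult_single degree_op_single degree_op_add lookup_add algebra_simps flip: single_add)
  qed (simp_all add: degree_op_add algebra_simps)
  then show ?thesis
    by (simp add: derivation_def degree_op_add)
qed

lemma degree_op_fconst: "degree_op j (fconst g) = 0"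
  by (simp add: fconst_def degree_op_single)

lemma degree_op_s_var: "degree_op j (s_var i) = (if i = j then s_var i else 0)"
  by (auto simp: s_var_def degree_op_single lookup_single)

subsection \<open>Falling factorials\<close>

definition falling_mon :: "(nat \<Rightarrow>\<^sub>0 nat) \<Rightarrow> bmod" where
  "falling_mon a = (\<Prod>j\<in>keys a. \<Prod>k<lookup a j. s_var j - of_nat k)"

lemma falling_mon_superset:
  assumes "finite K" "keys a \<subseteq> K"
  shows "falling_mon a = (\<Prod>j\<in>K. \<Prod>k<lookup a j. s_var j - of_nat k)"
  unfolding falling_mon_def using assms by (intro prod.mono_neutral_left) (auto simp: in_keys_iff)

lemma falling_mon_Suc:
  "falling_mon (single j 1 + a) = (s_var j - of_nat (lookup a j)) * falling_mon a"
proof -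
  let ?K = "insert j (keys a)"
  have "falling_mon (single j 1 + a) =
      (\<Prod>i\<in>?K. \<Prod>k<lookup (single j 1 + a) i. s_var i - of_nat k)"
    using Poly_Mapping.keys_add[of "single j (1::nat)" a]
    by (intro falling_mon_superset) auto
  also have "\<dots> = (\<Prod>i\<in>?K. (if i = j then s_var j - of_nat (lookup a j) else 1) *
      (\<Prod>k<lookup a i. s_var i - of_nat k))"
    by (intro prod.cong) (auto simp: lookup_add lookup_single)
  also have "\<dots> = (s_var j - of_nat (lookup a j)) * falling_mon a"
    by (subst prod.distrib) (simp add: falling_mon_superset[of ?K a] subset_insertI prod.delta)
  finally show ?thesis .
qed

text \<open>
  Sends a monomial with exponents $a_j$ to the product of the falling factorials
  $s_j (s_j - 1) \cdots (s_j - a_j + 1)$. Multiplication by $s_j$ then corresponds to the variable plus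
  the Euler operator (\<open>falling_s_var\<close>), which is how $y_j \partial_{y_j}$ acts on $S[y]\,e^g$ if the
  variable stands for $y_j f_j$.
\<close>

definition falling :: "bmod \<Rightarrow> bmod" where
  "falling = lin_ext (\<lambda>a c. fconst c * falling_mon a)"

lemma coeff_additive_falling: "coeff_additive (\<lambda>a c. fconst c * falling_mon a)"
  by (auto simp: coeff_additive_def ring_map_0[OF ring_map_fconst] ring_map_add[OF ring_map_fconst] algebra_simps)

lemma falling_single: "falling (single a c) = fconst c * falling_mon a"
  unfolding falling_def by (simp add: lin_ext_single coeff_additive_falling)

lemma falling_add: "falling (u + w) = falling u + falling w"
  unfolding falling_def by (simp add: lin_ext_add coeff_additive_falling)

lemma falling_0 [simp]: "falling 0 = 0"
  by (simp add: falling_def)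

lemma falling_1: "falling 1 = 1"
  using falling_single[of 0 1] by (simp add: falling_mon_def ring_map_1[OF ring_map_fconst])

lemma falling_sum: "falling (sum f A) = (\<Sum>x\<in>A. falling (f x))"
  unfolding falling_def by (simp add: lin_ext_sum coeff_additive_falling)

lemma falling_fconst_mult: "falling (fconst g * u) = fconst g * falling u"
proof (induction u rule: pm_add_induct)
  case (single a c)
  then show ?case
    by (simp add: falling_single fconst_def[of g] mult_single)
       (simp add: fconst_def mult_single flip: mult.assoc)
qed (simp add: falling_add algebra_simps)

lemma falling_s_var: "falling (s_var j * u + degree_op j u) = s_var j * falling u"
proof (induction u rule: pm_add_induct)
  case (single a c)
  have "falling (s_var j * single a c) =
      fconst c * ((s_var j - of_nat (lookup a j)) * falling_mon a)"
    by (simp add: s_var_def[of j] mult_single falling_single falling_mon_Suc[unfolded s_var_def] del: One_nat_def)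
  moreover have "fconst (of_nat k * c) = of_nat k * fconst c" for k
    by (simp add: ring_map_mult[OF ring_map_fconst] ring_map_of_nat[OF ring_map_fconst])
  ultimately show ?case
    by (simp add: falling_add degree_op_single falling_single algebra_simps)
next
  case (add u w)
  have "s_var j * (u + w) + degree_op j (u + w) = (s_var j * u + degree_op j u) + (s_var j * w + degree_op j w)"
    by (simp add: degree_op_add distrib_left add_ac)
  then show ?case
    using add falling_add[of "s_var j * u + degree_op j u" "s_var j * w + degree_op j w"]
    by (simp only: falling_add[of u w] distrib_left)
qed

lemma coeff_pd_falling: "coeff_pd v (falling u) = falling (coeff_pd v u)"
proof (induction u rule: pm_add_induct)
  case (single a c)
  have "coeff_pd v (falling_mon a) = 0"
    unfolding falling_mon_def
  proof (intro derivation_prod_zero[OF derivation_coeff_pd])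
    fix j k
    show "coeff_pd v (s_var j - of_nat k) = 0"
      using derivation_add[OF derivation_coeff_pd, of v "s_var j" "- of_nat k"]
      by (simp add: coeff_pd_s_var derivation_uminus[OF derivation_coeff_pd] derivation_of_nat[OF derivation_coeff_pd])
  qed
  then show ?case
    by (simp add: falling_single coeff_pd_single derivation_mult[OF derivation_coeff_pd] coeff_pd_fconst)
qed (simp add: falling_add coeff_pd_add)

text \<open>
  Evaluate the variables $s_j$ at an exponent \<open>b\<close> of minimal degree in the support: a falling
  factorial of another exponent vanishes there, since that exponent exceeds \<open>b\<close> somewhere.
\<close>

lemma falling_eq_0:
  assumes "falling u = 0"
  shows "u = 0"
proof (rule ccontr)
  assume "u \<noteq> 0"
  define K where "K = (\<Union>a\<in>keys u. keys a)"
  define deg where "deg a = (\<Sum>j\<in>K. lookup a j)" for a :: "nat \<Rightarrow>\<^sub>0 nat"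
  have K: "finite K"
    by (simp add: K_def)
  have "keys u \<noteq> {}"
    using \<open>u \<noteq> 0\<close> by simp
  then obtain b where b: "b \<in> keys u" and
    min: "\<And>a. a \<in> keys u \<Longrightarrow> deg b \<le> deg a"
    using ex_has_least_nat[of "\<lambda>a. a \<in> keys u" _ deg] by blast
  define ev where "ev = eval_hom (\<lambda>x. x) (\<lambda>j. of_nat (lookup b j) :: spoly fract)"
  have ev: "ring_map ev"
    unfolding ev_def by (rule ring_map_eval_hom[OF ring_map_id])
  have ev_s: "ev (s_var j) = of_nat (lookup b j)" for j
    by (simp add: ev_def s_var_def eval_hom_single[OF ring_map_id])
  have ev_c: "ev (fconst g) = g" for g
    by (simp add: ev_def fconst_def eval_hom_single[OF ring_map_id])
  have ev_mon: "ev (falling_mon a) =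
     (\<Prod>j\<in>keys a. \<Prod>k<lookup a j. of_nat (lookup b j) - of_nat k)" for a
    unfolding falling_mon_def
    by (simp add: ring_map_prod[OF ev] ring_map_diff[OF ev] ev_s ring_map_of_nat[OF ev])
  have zero: "ev (falling_mon a) = 0" if a: "a \<in> keys u" "a \<noteq> b" for a
  proof -
    have "\<exists>j. lookup b j < lookup a j"
    proof (rule ccontr)
      assume "\<not> ?thesis"
      then have le: "lookup a j \<le> lookup b j" for j
        by (simp add: not_less)
      obtain j where j: "lookup a j \<noteq> lookup b j"
        using a(2) by (meson poly_mapping_eqI)
      then have lt: "lookup a j < lookup b j"
        using le[of j] by simp
      then have "j \<in> K"
        using b by (auto simp: K_def in_keys_iff intro!: bexI[of _ b])
      then have "deg a < deg b"
        unfolding deg_def using K le lt by (intro sum_strict_mono_ex1) auto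
      then show False using min[OF a(1)] by simp
    qed
    then obtain j where j: "lookup b j < lookup a j" ..
    then have "(\<Prod>k<lookup a j. of_nat (lookup b j) - of_nat k) = (0 :: spoly fract)"
      by (intro prod_zero) auto
    moreover have "j \<in> keys a"
      using j by (auto simp: in_keys_iff)
    ultimately show ?thesis
      unfolding ev_mon by (intro prod_zero) auto
  qed
  have "ev (falling u) = (\<Sum>a\<in>keys u. lookup u a * ev (falling_mon a))"
    by (simp add: falling_def lin_ext_def ring_map_sum[OF ev] ring_map_mult[OF ev] ev_c)
  also have "\<dots> = (\<Sum>a\<in>keys u. if a = b then lookup u b * ev (falling_mon b) else 0)"
    by (intro sum.cong) (auto simp: zero)
  also have "\<dots> = lookup u b * ev (falling_mon b)"
    using b by simp
  finally have "lookup u b * ev (falling_mon b) = 0"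
    using assms by (simp add: ring_map_0[OF ev])
  moreover have "ev (falling_mon b) \<noteq> 0"
    unfolding ev_mon by (auto simp: of_nat_fract_eq_iff)
  ultimately show False
    using b by (simp add: in_keys_iff)
qed

subsection \<open>The comparison map\<close>

lemma prod_list_exponents:
  "\<exists>js. set js \<subseteq> {..<r} \<and> length js = (\<Sum>j<r. a j) \<and>
     (\<forall>h::nat \<Rightarrow> 'a::comm_monoid_mult. (\<Prod>j\<leftarrow>js. h j) = (\<Prod>j<r. h j ^ a j))"
proof (induction r)
  case (Suc r)
  then obtain js where js: "set js \<subseteq> {..<r}" "length js = (\<Sum>j<r. a j)"
    "\<forall>h::nat \<Rightarrow> 'a. (\<Prod>j\<leftarrow>js. h j) = (\<Prod>j<r. h j ^ a j)" by blast
  then show ?case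
    by (intro exI[of _ "js @ replicate (a r) r"]) (auto simp: prod_list_replicate)
qed simp

lemma prod_list_count:
  "set js \<subseteq> {..<r :: nat} \<Longrightarrow> (\<Prod>j\<leftarrow>js. h j) = (\<Prod>j<r. h j ^ count_list js j :: 'a::comm_monoid_mult)"
proof (induction js)
  case (Cons i js)
  have i: "finite {..<r}" "i \<in> {..<r}"
    using Cons.prems by auto
  have "(\<Prod>j<r. h j ^ count_list (i # js) j) =
      h i ^ count_list (i # js) i * (\<Prod>j\<in>{..<r} - {i}. h j ^ count_list (i # js) j)"
    by (rule prod.remove[OF i])
  also have "(\<Prod>j\<in>{..<r} - {i}. h j ^ count_list (i # js) j) = (\<Prod>j\<in>{..<r} - {i}. h j ^ count_list js j)"
    by (intro prod.cong) auto
  also have "h i ^ count_list (i # js) i * \<dots> = h i * (\<Prod>j<r. h j ^ count_list js j)"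
    unfolding prod.remove[OF i, of "\<lambda>j. h j ^ count_list js j"] by (simp add: mult.assoc)
  finally show ?case using Cons by simp
qed simp

lemma length_count: "set js \<subseteq> {..<r :: nat} \<Longrightarrow> length js = (\<Sum>j<r. count_list js j)"
  by (rule sum_count_set[symmetric]) auto

lemma diff_ops_0: "(\<lambda>u. 0) \<in> diff_ops V fs"
proof -
  have "(\<lambda>u. cconst 0 * u) = (\<lambda>u. 0)"
    by (simp add: fun_eq_iff ring_map_0[OF ring_map_cconst])
  then show ?thesis using diff_ops.scalar[of 0 V fs] by simp
qed

lemma diff_ops_id: "(\<lambda>u. u) \<in> diff_ops V fs"
proof -
  have "(\<lambda>u. cconst 1 * u) = (\<lambda>u. u)"
    by (simp add: fun_eq_iff ring_map_1[OF ring_map_cconst])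
  then show ?thesis using diff_ops.scalar[of 1 V fs] by simp
qed

lemma diff_ops_poly: "p \<in> polys V \<Longrightarrow> (\<lambda>u. fconst (to_fract p) * u) \<in> diff_ops V fs"
proof (induction rule: polys_induct)
  case (const c)
  then show ?case using diff_ops.scalar[of c V fs] by (simp add: cconst_Cst)
next
  case (var v p)
  then show ?case
    using diff_ops.comp[OF diff_ops.mult_x[OF var(1)] var(3)]
    by (simp add: ring_map_mult[OF ring_map_fconst] mult.assoc)
next
  case (add p q)
  then show ?case
    using diff_ops.add[OF add(3,4)] by (simp add: ring_map_add[OF ring_map_fconst] algebra_simps)
qed

lemma diff_ops_s_shift:
  assumes "j < length fs"
  shows "(\<lambda>u. (s_var j - of_nat k) * u) \<in> diff_ops V fs"
proof -
  have "cconst (- of_nat k) = - of_nat k"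
    by (simp add: ring_map_uminus[OF ring_map_cconst] ring_map_of_nat[OF ring_map_cconst])
  then show ?thesis
    using diff_ops.add[OF diff_ops.mult_s[OF assms] diff_ops.scalar[of "- of_nat k"], of V]
    by (simp add: algebra_simps)
qed

lemma diff_ops_prod:
  assumes "finite A" "\<And>x. x \<in> A \<Longrightarrow> (\<lambda>u. f x * u) \<in> diff_ops V fs"
  shows "(\<lambda>u. prod f A * u) \<in> diff_ops V fs"
  using assms
proof (induction A)
  case empty
  then show ?case using diff_ops_id by simp
next
  case (insert x A)
  then show ?case
    using diff_ops.comp[of "\<lambda>u. f x * u" V fs "\<lambda>u. prod f A * u"] by (simp add: mult.assoc)
qed

text \<open>
  The left hand sides of Bernstein relations. They are closed under addition, although a relation
  allows only one operator for each shift \<open>c\<close>.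
\<close>

definition realizable :: "var set \<Rightarrow> spoly list \<Rightarrow> bmod \<Rightarrow> bool" where
  "realizable V fs v \<longleftrightarrow> (\<exists>C P. finite C \<and>
        (\<forall>c\<in>C. length c = length fs \<and> sum_list c = 1 \<and> P c \<in> diff_ops V fs) \<and>
        (\<Sum>c\<in>C. P c (falling_s c * shifted_power fs c)) = v)"

lemma realizable_base:
  assumes "length c = length fs" "sum_list c = 1" "Q \<in> diff_ops V fs"
  shows "realizable V fs (Q (falling_s c * shifted_power fs c))"
  unfolding realizable_def using assms by (intro exI[of _ "{c}"] exI[of _ "\<lambda>_. Q"]) simp

lemma realizable_0: "realizable V fs 0"
  unfolding realizable_def by (intro exI[of _ "{}"]) simp

lemma realizable_add:
  assumes "realizable V fs u" "realizable V fs w"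
  shows "realizable V fs (u + w)"
proof -
  obtain C P where C: "finite C" "\<forall>c\<in>C. length c = length fs \<and> sum_list c = 1 \<and> P c \<in> diff_ops V fs"
    "(\<Sum>c\<in>C. P c (falling_s c * shifted_power fs c)) = u"
    using assms(1) unfolding realizable_def by blast
  obtain D Q where D: "finite D" "\<forall>c\<in>D. length c = length fs \<and> sum_list c = 1 \<and> Q c \<in> diff_ops V fs"
    "(\<Sum>c\<in>D. Q c (falling_s c * shifted_power fs c)) = w"
    using assms(2) unfolding realizable_def by blast
  define P' where "P' c = (if c \<in> C then P c else (\<lambda>_. 0))" for c
  define Q' where "Q' c = (if c \<in> D then Q c else (\<lambda>_. 0))" for c
  have "(\<lambda>x. P' c x + Q' c x) \<in> diff_ops V fs" for c
    using C(2) D(2) by (intro diff_ops.add) (auto simp: P'_def Q'_def diff_ops_0)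
  moreover have "(\<Sum>c\<in>C \<union> D. P' c (falling_s c * shifted_power fs c)) = u"
    unfolding C(3)[symmetric] using C(1) D(1) by (intro sum.mono_neutral_cong_right) (auto simp: P'_def)
  moreover have "(\<Sum>c\<in>C \<union> D. Q' c (falling_s c * shifted_power fs c)) = w"
    unfolding D(3)[symmetric] using C(1) D(1) by (intro sum.mono_neutral_cong_right) (auto simp: Q'_def)
  ultimately show ?thesis
    unfolding realizable_def using C(1,2) D(1,2)
    by (intro exI[of _ "C \<union> D"] exI[of _ "\<lambda>c x. P' c x + Q' c x"]) (auto simp: sum.distrib)
qed

context twisted
begin

text \<open>
  The variable $y_j$ goes to $t_j / f_j$, where the formal variable $t_j$ is written \<open>s_var j\<close>; the
  map \<open>falling\<close> afterwards replaces powers of $t_j$ by falling factorials of $s_j$. The composition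
  \<open>to_bmod\<close> is the identification of $u\,e^g$ with an element of the module of $f^s$:
  $y^a$ goes to $\prod_j s_j (s_j - 1) \cdots (s_j - a_j + 1)\, f_j^{-a_j}$.
\<close>

definition scaled_var :: "spoly list \<Rightarrow> var \<Rightarrow> bmod" where
  "scaled_var fs w = (if w \<in> V then fconst (to_fract (Var w))
     else s_var (inv_into UNIV y w) * fconst (1 / to_fract (fs ! inv_into UNIV y w)))"

definition scale :: "spoly list \<Rightarrow> spoly \<Rightarrow> bmod" where
  "scale fs = eval_hom cconst (scaled_var fs)"

definition to_bmod :: "spoly list \<Rightarrow> spoly \<Rightarrow> bmod" where
  "to_bmod fs u = falling (scale fs u)"

lemma ring_map_scale: "ring_map (scale fs)"
  unfolding scale_def by (rule ring_map_eval_hom[OF ring_map_cconst])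

lemma scaled_var_y: "scaled_var fs (y j) = s_var j * fconst (1 / to_fract (fs ! j))"
  using y_notin by (simp add: scaled_var_def inv_f_f inj_y)

lemma scale_y: "scale fs (Var (y j)) = s_var j * fconst (1 / to_fract (fs ! j))"
  by (simp add: scale_def eval_hom_Var ring_map_cconst scaled_var_y)

lemma scale_V: "p \<in> polys V \<Longrightarrow> scale fs p = fconst (to_fract p)"
  by (rule ring_map_polys_eqI[OF _ ring_map_scale ring_map_comp[OF ring_map_fconst ring_map_to_fract]])
     (auto simp: scale_def eval_hom_Cst eval_hom_Var ring_map_cconst cconst_Cst scaled_var_def)

lemma degree_op_scale:
  assumes "u \<in> polys (VY r)" "j < r"
  shows "degree_op j (scale fs u) = scale fs (Var (y j) * pd (y j) u)"
proof -
  have "degree_op j (scale fs u) = (\<Sum>w\<in>VY r. degree_op j (scaled_var fs w) * scale fs (pd w u))"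
    unfolding scale_def
    by (rule chain_rule[OF assms(1) finite_VY ring_map_cconst derivation_degree_op])
       (simp add: cconst_Cst degree_op_fconst)
  also have "\<dots> = (\<Sum>i<r. if i = j then scaled_var fs (y j) * scale fs (pd (y j) u) else 0)"
  proof -
    have "(\<Sum>w\<in>V. degree_op j (scaled_var fs w) * scale fs (pd w u)) = 0"
      by (intro sum.neutral) (auto simp: scaled_var_def degree_op_fconst)
    moreover have "(\<Sum>i<r. degree_op j (scaled_var fs (y i)) * scale fs (pd (y i) u)) =
        (\<Sum>i<r. if i = j then scaled_var fs (y j) * scale fs (pd (y j) u) else 0)"
      by (intro sum.cong) (auto simp: scaled_var_y derivation_mult[OF derivation_degree_op]
          degree_op_s_var degree_op_fconst)
    ultimately show ?thesis
      unfolding sum_VY by simp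
  qed
  also have "\<dots> = scale fs (Var (y j) * pd (y j) u)"
    using assms(2) by (simp add: ring_map_mult[OF ring_map_scale] scale_y scaled_var_y)
  finally show ?thesis .
qed

lemma coeff_pd_scale:
  assumes u: "u \<in> polys (VY (length fs))" and v: "v \<in> V" and nz: "0 \<notin> set fs"
  shows "coeff_pd v (scale fs u) = scale fs (pd v u) -
    (\<Sum>j<length fs. fconst (to_fract (pd v (fs ! j)) / to_fract (fs ! j)) * scale fs (Var (y j) * pd (y j) u))"
proof -
  let ?r = "length fs"
  have "coeff_pd v (scale fs u) = (\<Sum>w\<in>VY ?r. coeff_pd v (scaled_var fs w) * scale fs (pd w u))"
    unfolding scale_def
    by (rule chain_rule[OF u finite_VY ring_map_cconst derivation_coeff_pd]) (simp add: coeff_pd_cconst)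
  also have "\<dots> = (\<Sum>w\<in>V. coeff_pd v (scaled_var fs w) * scale fs (pd w u)) +
      (\<Sum>j<?r. coeff_pd v (scaled_var fs (y j)) * scale fs (pd (y j) u))"
    by (rule sum_VY)
  also have "(\<Sum>w\<in>V. coeff_pd v (scaled_var fs w) * scale fs (pd w u)) =
      (\<Sum>w\<in>V. if v = w then scale fs (pd v u) else 0)"
    by (intro sum.cong) (auto simp: scaled_var_def coeff_pd_fconst pd_fract_to_fract pd_Var
        ring_map_0[OF ring_map_fconst] ring_map_1[OF ring_map_fconst])
  also have "\<dots> = scale fs (pd v u)"
    using v finite_V by simp
  also have "(\<Sum>j<?r. coeff_pd v (scaled_var fs (y j)) * scale fs (pd (y j) u)) =
     (\<Sum>j<?r. - (fconst (to_fract (pd v (fs ! j)) / to_fract (fs ! j)) * scale fs (Var (y j) * pd (y j) u)))"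
  proof (rule sum.cong)
    fix j assume "j \<in> {..<?r}"
    then have nzj: "fs ! j \<noteq> 0"
      using nz nth_mem by fastforce
    have "pd_fract v (1 / to_fract (fs ! j)) =
      - (to_fract (pd v (fs ! j)) / to_fract (fs ! j) * (1 / to_fract (fs ! j)))"
      using pd_fract_quot[OF nzj, of v 1] by (simp add: pd_one)
    then show "coeff_pd v (scaled_var fs (y j)) * scale fs (pd (y j) u) =
      - (fconst (to_fract (pd v (fs ! j)) / to_fract (fs ! j)) * scale fs (Var (y j) * pd (y j) u))"
      by (simp only: scaled_var_y derivation_mult[OF derivation_coeff_pd] coeff_pd_s_var coeff_pd_fconst
          ring_map_mult[OF ring_map_scale] scale_y ring_map_uminus[OF ring_map_fconst] ring_map_mult[OF ring_map_fconst])
         (simp add: algebra_simps)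
  qed simp
  finally show ?thesis
    by (simp add: sum_negf)
qed

lemma to_bmod_add: "to_bmod fs (u + w) = to_bmod fs u + to_bmod fs w"
  by (simp add: to_bmod_def ring_map_add[OF ring_map_scale] falling_add)

lemma to_bmod_sum: "to_bmod fs (sum f A) = (\<Sum>x\<in>A. to_bmod fs (f x))"
  by (simp add: to_bmod_def ring_map_sum[OF ring_map_scale] falling_sum)

lemma to_bmod_0: "to_bmod fs 0 = 0"
  by (simp add: to_bmod_def ring_map_0[OF ring_map_scale])

lemma to_bmod_mult: "p \<in> polys V \<Longrightarrow> to_bmod fs (p * u) = fconst (to_fract p) * to_bmod fs u"
  by (simp add: to_bmod_def ring_map_mult[OF ring_map_scale] scale_V falling_fconst_mult)

lemma to_bmod_1: "to_bmod fs 1 = 1"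
  by (simp add: to_bmod_def ring_map_1[OF ring_map_scale] falling_1)

lemma to_bmod_theta:
  assumes fs: "set fs \<subseteq> polys V" "0 \<notin> set fs" and u: "u \<in> polys (VY (length fs))" and j: "j < length fs"
  shows "to_bmod fs (Var (y j) * nabla (gen fs) (y j) u) = s_var j * to_bmod fs u"
proof -
  have nz: "to_fract (fs ! j) \<noteq> 0"
    using fs(2) j nth_mem by fastforce
  have "scale fs (Var (y j) * nabla (gen fs) (y j) u) =
     scale fs (Var (y j) * pd (y j) u) + scale fs (Var (y j)) * fconst (to_fract (fs ! j)) * scale fs u"
    using fs j by (simp add: nabla_def pd_y_gen ring_map_add[OF ring_map_scale] ring_map_mult[OF ring_map_scale]
        scale_V nth_polys algebra_simps)
  also have "scale fs (Var (y j)) * fconst (to_fract (fs ! j)) = s_var j"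
    using nz by (simp add: scale_y mult.assoc ring_map_1[OF ring_map_fconst] flip: ring_map_mult[OF ring_map_fconst])
  finally show ?thesis
    using falling_s_var[of j "scale fs u"]
    by (simp only: to_bmod_def degree_op_scale[OF u j, symmetric] add.commute[of "degree_op j (scale fs u)"])
qed

text \<open>
  The logarithmic derivatives of the $f_j$ in the action on $f^s$ are matched by $y_j \partial f_j$
  in the twisted derivative: differentiating $t_j / f_j$ produces the Euler operators that turn
  $s_j$ into $t_j$.
\<close>

lemma to_bmod_nabla:
  assumes fs: "set fs \<subseteq> polys V" "0 \<notin> set fs" and u: "u \<in> polys (VY (length fs))" and v: "v \<in> V"
  shows "to_bmod fs (nabla (gen fs) v u) = pd_act fs v (to_bmod fs u)"
proof -
  let ?r = "length fs"
  define l where "l j = to_fract (pd v (fs ! j)) / to_fract (fs ! j)" for j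
  have "pd v (gen fs) = (\<Sum>j<?r. Var (y j) * pd v (fs ! j))"
    using v by (simp add: gen_def pd_sum pd_mult pd_Var y_ne)
  then have "scale fs (pd v (gen fs)) = (\<Sum>j<?r. fconst (l j) * s_var j)"
    using fs by (simp add: ring_map_sum[OF ring_map_scale] ring_map_mult[OF ring_map_scale] scale_y
        scale_V nth_polys pd_polys l_def mult.assoc algebra_simps flip: ring_map_mult[OF ring_map_fconst])
  then have "scale fs (nabla (gen fs) v u) = scale fs (pd v u) + (\<Sum>j<?r. fconst (l j) * (s_var j * scale fs u))"
    by (simp add: nabla_def ring_map_add[OF ring_map_scale] ring_map_mult[OF ring_map_scale]
        sum_distrib_left algebra_simps)
  also have "\<dots> = coeff_pd v (scale fs u) +
      (\<Sum>j<?r. fconst (l j) * (s_var j * scale fs u + degree_op j (scale fs u)))"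
    unfolding coeff_pd_scale[OF u v fs(2)] l_def[symmetric]
    by (simp add: degree_op_scale[OF u] distrib_left sum.distrib)
  finally have "to_bmod fs (nabla (gen fs) v u) = falling (coeff_pd v (scale fs u)) +
      (\<Sum>j<?r. fconst (l j) * (s_var j * to_bmod fs u))"
    by (simp only: to_bmod_def falling_add[of "coeff_pd v (scale fs u)"] falling_sum falling_fconst_mult falling_s_var)
  also have "\<dots> = pd_act fs v (to_bmod fs u)"
    by (simp add: pd_act_def to_bmod_def coeff_pd_falling l_def sum_distrib_left mult_ac flip: coeff_pd_def)
  finally show ?thesis .
qed

text \<open>
  Substituting $t_j \mapsto f_j y_j$ recovers \<open>u\<close> from its image before \<open>falling\<close> is applied.
\<close>

lemma to_bmod_eq_0:
  assumes fs: "0 \<notin> set fs" and u: "u \<in> polys (VY (length fs))" and "to_bmod fs u = 0"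
  shows "u = 0"
proof -
  define \<eta> where "\<eta> = eval_hom (\<lambda>x. x) (\<lambda>j. to_fract (fs ! j * Var (y j)))"
  have \<eta>: "ring_map \<eta>"
    unfolding \<eta>_def by (rule ring_map_eval_hom[OF ring_map_id])
  have \<eta>_c: "\<eta> (fconst g) = g" for g
    by (simp add: \<eta>_def fconst_def eval_hom_single[OF ring_map_id])
  have \<eta>_s: "\<eta> (s_var j) = to_fract (fs ! j * Var (y j))" for j
    by (simp add: \<eta>_def s_var_def eval_hom_single[OF ring_map_id])
  have "scale fs u = 0"
    using assms(3) unfolding to_bmod_def by (rule falling_eq_0)
  moreover have "\<eta> (scale fs u) = to_fract u"
  proof (rule ring_map_polys_eqI[OF u ring_map_comp[OF \<eta> ring_map_scale] ring_map_to_fract])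
    show "\<eta> (scale fs (Cst c)) = to_fract (Cst c)" for c
      by (simp add: scale_def eval_hom_Cst ring_map_cconst cconst_Cst \<eta>_c)
    fix w assume "w \<in> VY (length fs)"
    then consider "w \<in> V" | j where "w = y j" "j < length fs"
      by (auto simp: VY_def)
    then show "\<eta> (scale fs (Var w)) = to_fract (Var w)"
    proof cases
      case 1
      then show ?thesis by (simp add: scale_V \<eta>_c)
    next
      case 2
      have "fs ! j \<noteq> 0"
        using fs 2 nth_mem by fastforce
      then show ?thesis
        using 2 by (simp add: scale_y ring_map_mult[OF \<eta>] \<eta>_c \<eta>_s)
    qed
  qed
  ultimately show ?thesis
    by (simp add: ring_map_0[OF \<eta>])
qed

lemma to_bmod_op_poly:
  assumes fs: "set fs \<subseteq> polys V" "0 \<notin> set fs"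
  shows "to_bmod fs (op_poly (euler fs) b 1) = poly (map_poly cconst b) (s_sum (length fs))"
proof (induction b)
  case (pCons a b)
  let ?u = "op_poly (euler fs) b 1"
  have u: "?u \<in> polys (VY (length fs))"
    by (rule op_poly_euler_polys) (use fs in auto)
  have "to_bmod fs (euler fs ?u) = s_sum (length fs) * to_bmod fs ?u"
    unfolding euler_def[of fs ?u] to_bmod_sum s_sum_def sum_distrib_right
    by (intro sum.cong) (auto simp: to_bmod_theta fs u)
  moreover have "to_bmod fs (Cst a) = cconst a"
    using to_bmod_mult[of "Cst a" fs 1] by (simp add: to_bmod_1 cconst_Cst)
  ultimately show ?case
    using pCons by (simp add: op_poly_pCons euler_linear to_bmod_add map_poly_pCons ring_map_0[OF ring_map_cconst])
qed (simp add: to_bmod_0)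

lemma to_bmod_monomial:
  assumes fs: "set fs \<subseteq> polys V" and p: "p \<in> polys V"
  shows "to_bmod fs ((\<Prod>j<length fs. Var (y j) ^ a j) * p) =
    (\<Prod>j<length fs. \<Prod>k<a j. s_var j - of_nat k) *
      fconst (to_fract p * (\<Prod>j<length fs. (1 / to_fract (fs ! j)) ^ a j))"
proof -
  let ?r = "length fs"
  define b where "b = (\<Sum>j<?r. single j (a j))"
  have lb: "lookup b j = (if j < ?r then a j else 0)" for j
    by (auto simp: b_def lookup_sum lookup_single when_def)
  have sv: "s_var j ^ k = single (single j k) 1" for j k
    by (induction k) (auto simp: s_var_def mult_single simp flip: single_add)
  have "(\<Prod>j\<in>K. s_var j ^ a j) = single (\<Sum>j\<in>K. single j (a j)) 1" if "finite K" for K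
    using that by induction (auto simp: sv mult_single)
  then have eval_mon: "(\<Prod>j<?r. s_var j ^ a j) = single b 1"
    by (simp add: b_def)
  have "scale fs ((\<Prod>j<?r. Var (y j) ^ a j) * p) =
      (\<Prod>j<?r. s_var j ^ a j) * fconst ((\<Prod>j<?r. (1 / to_fract (fs ! j)) ^ a j) * to_fract p)"
    using p by (simp add: ring_map_mult[OF ring_map_scale] ring_map_prod[OF ring_map_scale]
        ring_map_power[OF ring_map_scale] scale_y scale_V power_mult_distrib prod.distrib
        ring_map_mult[OF ring_map_fconst] ring_map_prod[OF ring_map_fconst] ring_map_power[OF ring_map_fconst]
        mult.assoc)
  then have "to_bmod fs ((\<Prod>j<?r. Var (y j) ^ a j) * p) =
      fconst (to_fract p * (\<Prod>j<?r. (1 / to_fract (fs ! j)) ^ a j)) * falling_mon b"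
    unfolding to_bmod_def eval_mon by (simp add: fconst_def mult_single falling_single mult.commute)
  moreover have "falling_mon b = (\<Prod>j<?r. \<Prod>k<a j. s_var j - of_nat k)"
  proof -
    have "keys b \<subseteq> {..<?r}"
      by (auto simp: in_keys_iff lb split: if_splits)
    then show ?thesis
      by (simp add: falling_mon_superset[of "{..<?r}"] lb)
  qed
  ultimately show ?thesis
    by (simp add: mult.commute)
qed

lemma filt_polys:
  assumes "u \<in> filt fs k" "set fs \<subseteq> polys V"
  shows "u \<in> polys (VY (length fs))"
  using assms(1)
proof (induction rule: filt.induct)
  case (base T js "is")
  have "T (\<Prod>i\<leftarrow>is. fs ! i) \<in> polys (VY (length fs))"
    using base assms by (intro xops_polys[OF base(1) V_VY gen_polys] polys_V_VY prod_fs_polys)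
  moreover have "(\<Prod>j\<leftarrow>js. Var (y j)) \<in> polys (VY (length fs))"
    using base by (intro polys_prod_list) (auto simp: y_VY subset_iff)
  ultimately show ?case by (rule polys_mult[rotated])
qed auto

lemma powi_diff:
  fixes x :: "'a::field"
  assumes "x \<noteq> 0"
  shows "x powi (int b - int a) = x ^ b * (1 / x) ^ a"
  using assms by (simp add: power_int_diff power_one_over divide_inverse power_inverse)

lemma falling_s_eq:
  "length c = r \<Longrightarrow> falling_s c = (\<Prod>j<r. \<Prod>k<nat (- (c ! j)). s_var j - of_nat k)"
  unfolding falling_s_def
proof (intro prod.mono_neutral_left ballI)
  fix j assume "j \<in> {..<r} - {j. j < length c \<and> c ! j < 0}" "length c = r"
  then have "nat (- (c ! j)) = 0" by auto
  then show "(\<Prod>k<nat (- (c ! j)). s_var j - of_nat k) = 1"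
    by (simp only: lessThan_0 prod.empty)
qed auto

lemma filt_of_diff_ops:
  assumes fs: "set fs \<subseteq> polys V" "0 \<notin> set fs" and "P \<in> diff_ops V fs"
  shows "u \<in> filt fs k \<Longrightarrow> \<exists>w\<in>filt fs k. to_bmod fs w = P (to_bmod fs u)"
  using assms(3)
proof (induction arbitrary: u rule: diff_ops.induct)
  case (scalar c)
  then show ?case
    by (intro bexI[of _ "Cst c * u"]) (auto simp: to_bmod_mult cconst_Cst intro: filt_mult)
next
  case (mult_x v)
  then show ?case
    by (intro bexI[of _ "Var v * u"]) (auto simp: to_bmod_mult intro: filt_mult)
next
  case (mult_s j)
  then show ?case
    using fs by (intro bexI[of _ "Var (y j) * nabla (gen fs) (y j) u"])
       (auto simp: to_bmod_theta fs filt_polys intro: filt_theta[OF _ fs(1)])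
next
  case (deriv v)
  then show ?case
    by (intro bexI[of _ "nabla (gen fs) v u"]) (auto simp: to_bmod_nabla fs filt_polys intro: filt_nabla)
next
  case (add P Q)
  then show ?case
    by (metis to_bmod_add filt.add)
next
  case (comp P Q)
  then show ?case
    by metis
qed

lemma nz_nth: "0 \<notin> set fs \<Longrightarrow> j < length fs \<Longrightarrow> fs ! j \<noteq> 0"
  using nth_mem by fastforce

lemma shifted_power_eq:
  assumes nz: "0 \<notin> set fs" and c: "\<And>j. j < length fs \<Longrightarrow> c ! j = int (b j) - int (a j)"
    and F: "F = (\<Prod>j<length fs. fs ! j ^ b j)"
  shows "fconst (to_fract F * (\<Prod>j<length fs. (1 / to_fract (fs ! j)) ^ a j)) = shifted_power fs c"
proof -
  have "to_fract F * (\<Prod>j<length fs. (1 / to_fract (fs ! j)) ^ a j) =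
      (\<Prod>j<length fs. to_fract (fs ! j) ^ b j * (1 / to_fract (fs ! j)) ^ a j)"
    by (simp add: F ring_map_prod[OF ring_map_to_fract] ring_map_power[OF ring_map_to_fract] prod.distrib)
  also have "\<dots> = (\<Prod>j<length fs. to_fract (fs ! j) powi (c ! j))"
    by (intro prod.cong) (auto simp: c powi_diff nz_nth nz)
  finally show ?thesis
    by (simp add: shifted_power_def)
qed

text \<open>
  The element is $y^a f^b$ with \<open>a\<close> and \<open>b\<close> the negative and positive parts of \<open>c\<close>.
\<close>

lemma filt_of_shifted_power:
  assumes fs: "set fs \<subseteq> polys V" "0 \<notin> set fs" and c: "length c = length fs" "sum_list c = 1"
  shows "\<exists>w\<in>filt fs 1. to_bmod fs w = falling_s c * shifted_power fs c"
proof -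
  let ?r = "length fs"
  define a where "a j = nat (- (c ! j))" for j
  define b where "b j = nat (c ! j)" for j
  have cj: "c ! j = int (b j) - int (a j)" for j
    by (simp add: a_def b_def)
  obtain js where js: "set js \<subseteq> {..<?r}" "length js = (\<Sum>j<?r. a j)"
     "\<forall>h::nat \<Rightarrow> spoly. (\<Prod>j\<leftarrow>js. h j) = (\<Prod>j<?r. h j ^ a j)"
    using prod_list_exponents by blast
  obtain "is" where "is": "set is \<subseteq> {..<?r}" "length is = (\<Sum>j<?r. b j)"
     "\<forall>h::nat \<Rightarrow> spoly. (\<Prod>j\<leftarrow>is. h j) = (\<Prod>j<?r. h j ^ b j)"
    using prod_list_exponents by blast
  have "int (\<Sum>j<?r. b j) - int (\<Sum>j<?r. a j) = 1"
    using c by (simp add: sum_list_sum_nth atLeast0LessThan cj sum_subtractf)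
  then have "(\<Sum>j<?r. b j) = (\<Sum>j<?r. a j) + 1"
    by linarith
  then have len: "length is = length js + 1"
    using js(2) "is"(2) by simp
  define w where "w = (\<Prod>j\<leftarrow>js. Var (y j)) * (\<Prod>i\<leftarrow>is. fs ! i)"
  have "w \<in> filt fs 1"
    unfolding w_def using filt.base[OF xops.ident js(1) "is"(1) len] by simp
  moreover have "to_bmod fs w = falling_s c * shifted_power fs c"
  proof -
    have p: "(\<Prod>i\<leftarrow>is. fs ! i) \<in> polys V"
      using "is"(1) fs(1) by (intro prod_fs_polys)
    have "fconst (to_fract (\<Prod>i\<leftarrow>is. fs ! i) * (\<Prod>j<?r. (1 / to_fract (fs ! j)) ^ a j)) = shifted_power fs c"
      using "is"(3) by (intro shifted_power_eq[of fs c b]) (auto simp: fs cj)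
    then show ?thesis
      using to_bmod_monomial[OF fs(1) p, of a] js(3)
      by (simp add: w_def falling_s_eq[OF c(1)] flip: a_def)
  qed
  ultimately show ?thesis by blast
qed

lemma filt_of_bernstein:
  assumes fs: "set fs \<subseteq> polys V" "0 \<notin> set fs" and b: "bernstein_relation V fs b"
  shows "op_poly (euler fs) b 1 \<in> filt fs 1"
proof -
  obtain C P where C: "finite C"
    "\<forall>c\<in>C. length c = length fs \<and> sum_list c = 1 \<and> P c \<in> diff_ops V fs"
    "(\<Sum>c\<in>C. P c (falling_s c * shifted_power fs c)) = poly (map_poly cconst b) (s_sum (length fs))"
    using b unfolding bernstein_relation_def by blast
  have "\<exists>w\<in>filt fs 1. to_bmod fs w = P c (falling_s c * shifted_power fs c)" if "c \<in> C" for c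
  proof -
    have c: "length c = length fs" "sum_list c = 1" "P c \<in> diff_ops V fs"
      using C(2) that by auto
    obtain u where "u \<in> filt fs 1" "to_bmod fs u = falling_s c * shifted_power fs c"
      using filt_of_shifted_power[OF fs c(1,2)] by blast
    then show ?thesis
      using filt_of_diff_ops[OF fs c(3), of u 1] by simp
  qed
  then obtain w where w: "\<And>c. c \<in> C \<Longrightarrow> w c \<in> filt fs 1"
    "\<And>c. c \<in> C \<Longrightarrow> to_bmod fs (w c) = P c (falling_s c * shifted_power fs c)"
    by metis
  define u where "u = (\<Sum>c\<in>C. w c)"
  have u: "u \<in> filt fs 1"
    unfolding u_def by (intro filt_sum w)
  have "to_bmod fs (u - op_poly (euler fs) b 1) = 0"
  proof -
    have "to_bmod fs u = to_bmod fs (op_poly (euler fs) b 1)"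
      unfolding u_def to_bmod_sum to_bmod_op_poly[OF fs] C(3)[symmetric] by (intro sum.cong) (auto simp: w)
    moreover have "to_bmod fs u = to_bmod fs (u - op_poly (euler fs) b 1) + to_bmod fs (op_poly (euler fs) b 1)"
      by (simp flip: to_bmod_add)
    ultimately show ?thesis by simp
  qed
  then have "u - op_poly (euler fs) b 1 = 0"
    using filt_polys[OF u fs(1)] op_poly_euler_polys[OF fs(1), of 1 b]
    by (intro to_bmod_eq_0[OF fs(2)]) auto
  then show ?thesis using u by simp
qed

text \<open>
  For $y^a\, T(f^b)$ the shift is $c = b - a$. The exponents \<open>a\<close> and \<open>b\<close> may overlap, and then
  the falling factorials of $y^a$ exceed those required for \<open>c\<close> by a polynomial in the $s_j$, which is
  absorbed into the operator.
\<close>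

lemma realizable_filt:
  assumes fs: "set fs \<subseteq> polys V" "0 \<notin> set fs" and "u \<in> filt fs 1"
  shows "realizable V fs (to_bmod fs u)"
  using assms(3)
proof (induction rule: filt.induct)
  case zero
  then show ?case by (simp add: to_bmod_0 realizable_0)
next
  case (add u w)
  then show ?case by (simp add: to_bmod_add realizable_add)
next
  case (base T js "is")
  let ?r = "length fs"
  let ?Y = "\<Prod>j\<leftarrow>js. Var (y j)" and ?F = "\<Prod>i\<leftarrow>is. fs ! i"
  have Y: "?Y \<in> polys (VY ?r)"
    using base by (intro polys_prod_list) (auto simp: y_VY subset_iff)
  have F: "?F \<in> polys V"
    using base fs by (intro prod_fs_polys)
  have ops: "\<exists>Q\<in>diff_ops V fs. \<forall>u\<in>polys (VY ?r). to_bmod fs (?Y * T u) = Q (to_bmod fs (?Y * u))"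
    using base(1)
  proof (induction rule: xops.induct)
    case ident
    then show ?case by (intro bexI[OF _ diff_ops_id]) auto
  next
    case (mul p T)
    then obtain Q where Q: "Q \<in> diff_ops V fs"
      "\<forall>u\<in>polys (VY ?r). to_bmod fs (?Y * T u) = Q (to_bmod fs (?Y * u))" by blast
    show ?case
      using Q mul(1)
      by (intro bexI[OF _ diff_ops.comp[OF diff_ops_poly[OF mul(1)] Q(1)]])
         (auto simp: mult.left_commute[of _ p] to_bmod_mult)
  next
    case (nab v T)
    then obtain Q where Q: "Q \<in> diff_ops V fs"
      "\<forall>u\<in>polys (VY ?r). to_bmod fs (?Y * T u) = Q (to_bmod fs (?Y * u))" by blast
    have *: "to_bmod fs (?Y * nabla (gen fs) v (T u)) = pd_act fs v (Q (to_bmod fs (?Y * u)))"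
      if u: "u \<in> polys (VY ?r)" for u
    proof -
      have "?Y * nabla (gen fs) v (T u) = nabla (gen fs) v (?Y * T u)"
        using nab(1) by (simp add: nabla_mult pd_y_prod)
      moreover have "?Y * T u \<in> polys (VY ?r)"
        using fs(1) by (intro polys_mult[OF Y] xops_polys[OF nab(2) V_VY gen_polys u])
      ultimately show ?thesis
        using Q(2) u nab(1) by (simp add: to_bmod_nabla fs)
    qed
    show ?case
      by (intro bexI[OF _ diff_ops.comp[OF diff_ops.deriv[OF nab(1)] Q(1)]]) (auto simp: *)
  qed
  then obtain Q where Q: "Q \<in> diff_ops V fs" "to_bmod fs (?Y * T ?F) = Q (to_bmod fs (?Y * ?F))"
    using polys_V_VY[OF F] by blast
  define a where "a = count_list js"
  define b where "b = count_list is"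
  define c where "c = map (\<lambda>j. int (b j) - int (a j)) [0..<?r]"
  have c: "length c = ?r" "\<And>j. j < ?r \<Longrightarrow> c ! j = int (b j) - int (a j)"
    by (auto simp: c_def)
  have "sum_list c = int (\<Sum>j<?r. b j) - int (\<Sum>j<?r. a j)"
    by (simp add: c_def interv_sum_list_conv_sum_set_nat atLeast0LessThan sum_subtractf)
  also have "\<dots> = int (length is) - int (length js)"
    unfolding a_def b_def length_count[OF base(2)] length_count[OF base(3)] ..
  finally have "sum_list c = int (length is) - int (length js)" .
  then have sum: "sum_list c = 1"
    using base by simp
  define S where "S = (\<Prod>j<?r. \<Prod>k\<in>{nat (int (a j) - int (b j))..<a j}. s_var j - of_nat k :: bmod)"
  have S: "(\<lambda>u. S * u) \<in> diff_ops V fs"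
    unfolding S_def by (intro diff_ops_prod diff_ops_s_shift) auto
  have "(\<Prod>j<?r. \<Prod>k<a j. s_var j - of_nat k :: bmod) = S * falling_s c"
    unfolding S_def falling_s_eq[OF c(1)] prod.distrib[symmetric]
  proof (rule prod.cong)
    fix j assume "j \<in> {..<?r}"
    then have n: "nat (- (c ! j)) = nat (int (a j) - int (b j))"
      by (simp add: c)
    have "nat (int (a j) - int (b j)) \<le> a j"
      by simp
    then show "(\<Prod>k<a j. s_var j - of_nat k :: bmod) =
       (\<Prod>k\<in>{nat (int (a j) - int (b j))..<a j}. s_var j - of_nat k) * (\<Prod>k<nat (- (c ! j)). s_var j - of_nat k)"
      unfolding n lessThan_atLeast0
      by (subst mult.commute, subst prod.atLeastLessThan_concat) auto
  qed simp
  moreover have "fconst (to_fract ?F * (\<Prod>j<?r. (1 / to_fract (fs ! j)) ^ a j)) = shifted_power fs c"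
    using base(3) by (intro shifted_power_eq[of fs c b]) (auto simp: fs c prod_list_count[of "is" ?r] b_def)
  ultimately have "to_bmod fs (?Y * ?F) = S * (falling_s c * shifted_power fs c)"
    using to_bmod_monomial[OF fs(1) F, of a] base(2)
    by (simp add: prod_list_count[of js ?r "\<lambda>j. Var (y j)"] a_def mult.assoc)
  then show ?case
    using realizable_base[OF c(1) sum diff_ops.comp[OF Q(1) S]] Q(2) by simp
qed

lemma bernstein_of_filt:
  assumes fs: "set fs \<subseteq> polys V" "0 \<notin> set fs" and "op_poly (euler fs) b 1 \<in> filt fs 1"
  shows "bernstein_relation V fs b"
  using realizable_filt[OF assms] unfolding realizable_def bernstein_relation_def to_bmod_op_poly[OF fs] .

end

section \<open>The Fischer functional and the Gram determinant\<close>

lemma derivation_power: "derivation d \<Longrightarrow> d (x ^ Suc k) = of_nat (Suc k) * x ^ k * d x"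
  by (induction k) (simp_all add: derivation_mult derivation_1 algebra_simps)

lemma lookup_add_single: "lookup (a + single v 1) w =
    lookup a w + (if w = v then 1 else (0::nat))"
  by (simp add: lookup_add lookup_single when_def)

lemma lookup_diff_single: "lookup (a - single v 1) w =
    lookup a w - (if w = v then 1 else (0::nat))"
  by (simp add: lookup_minus lookup_single when_def)

lemma fact_plus_1: "fact (k + 1) = (1 + of_nat k) * (fact k :: complex)"
  by simp

lemma Var_mult_single: "Var v * single a c = single (a + single v 1) c"
  by (simp add: Var_def mult_single add.commute)

locale generic_mat =
  fixes m n :: nat
begin

definition V :: "var set" where "V = {..<m} \<times> {..<n}"

text \<open>
  The variables dual to those in \<open>V\<close>. Row \<open>m\<close> of the index set is reserved for the variables $y_j$.
\<close>

definition xi :: "var \<Rightarrow> var" where "xi v = (Suc m + fst v, snd v)"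

definition X :: "var set" where "X = xi ` V"

lemma xi_eq [simp]: "xi v = xi w \<longleftrightarrow> v = w"
  by (auto simp: xi_def prod_eq_iff)

lemma xi_notin [simp]: "xi v \<notin> V"
  by (auto simp: xi_def V_def)

lemma xi_ne [simp]: "v \<in> V \<Longrightarrow> xi w \<noteq> v" "v \<in> V \<Longrightarrow> v \<noteq> xi w"
  by (auto simp: xi_def V_def)

lemma finite_V [simp]: "finite V"
  by (simp add: V_def)

lemma in_V [simp]: "(k, j) \<in> V \<longleftrightarrow> k < m \<and> j < n"
  by (simp add: V_def)

lemma xi_X [simp]: "xi v \<in> X \<longleftrightarrow> v \<in> V"
  by (auto simp: X_def)

lemma V_X_disjoint: "v \<in> V \<Longrightarrow> v \<notin> X"
  by (auto simp: X_def)

text \<open>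
  The value of \<open>L\<close> on $x^\alpha \xi^\beta$, which is $\alpha!$ if $\alpha = \beta$ and zero otherwise.
\<close>

definition pair_mon :: "(var \<Rightarrow>\<^sub>0 nat) \<Rightarrow> complex" where
  "pair_mon a = (if \<forall>v\<in>V. lookup a v = lookup a (xi v)
     then \<Prod>v\<in>V. fact (lookup a v) else 0)"

definition L :: "spoly \<Rightarrow> complex" where
  "L = lin_ext (\<lambda>a c. c * pair_mon a)"

lemma coeff_additive_L: "coeff_additive (\<lambda>a c. c * pair_mon a)"
  by (auto simp: coeff_additive_def algebra_simps)

lemma L_single: "L (single a c) = c * pair_mon a"
  unfolding L_def by (simp add: lin_ext_single coeff_additive_L)

lemma L_add: "L (p + q) = L p + L q"
  unfolding L_def by (simp add: lin_ext_add coeff_additive_L)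

lemma L_0: "L 0 = 0"
  by (simp add: L_def)

lemma L_sum: "L (sum f A) = (\<Sum>x\<in>A. L (f x))"
  unfolding L_def by (simp add: lin_ext_sum coeff_additive_L)

lemma L_Cst: "L (Cst c * p) = c * L p"
  by (induction p rule: pm_add_induct)
     (simp_all add: Cst_def mult_single L_single L_add distrib_left mult.assoc)

lemma L_diff: "L (p - q) = L p - L q"
  using L_add[of "p - q" q] by simp

lemma L_1: "L 1 = 1"
  using L_single[of 0 1] by (simp add: pair_mon_def)

lemma pair_mon_step:
  assumes v: "v \<in> V" and uw: "u = v \<and> w = xi v \<or> u = xi v \<and> w = v"
  shows "of_nat (lookup a u) * pair_mon (a - single u 1) =
    pair_mon (a + single w 1)"
proof (cases "lookup a u")
  case 0
  then have "\<exists>z\<in>V. lookup (a + single w 1) z \<noteq>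
      lookup (a + single w 1) (xi z)"
    using v uw by (intro bexI[of _ v]) (auto simp: lookup_add_single simp del: One_nat_def)
  then show ?thesis
    using 0 by (auto simp: pair_mon_def)
next
  case (Suc k)
  let ?a = "a - single u 1" and ?b = "a + single w 1"
  have eq: "(\<forall>z\<in>V. lookup ?a z = lookup ?a (xi z)) \<longleftrightarrow>
      (\<forall>z\<in>V. lookup ?b z = lookup ?b (xi z))"
  proof (rule ball_cong[OF refl])
    fix z assume "z \<in> V"
    then show "(lookup ?a z = lookup ?a (xi z)) =
        (lookup ?b z = lookup ?b (xi z))"
      using Suc v uw by (auto simp: lookup_add_single lookup_diff_single simp del: One_nat_def)
  qed
  show ?thesis
  proof (cases "\<forall>z\<in>V. lookup ?a z = lookup ?a (xi z)")
    case True
    then have av: "lookup ?a v = k" "lookup ?b v = Suc k"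
      using Suc v uw by (auto simp: lookup_add_single lookup_diff_single simp del: One_nat_def)
    have "(\<Prod>z\<in>V - {v}. fact (lookup ?a z)) =
        (\<Prod>z\<in>V - {v}. fact (lookup ?b z) :: complex)"
      using uw by (intro prod.cong) (auto simp: lookup_add_single lookup_diff_single simp del: One_nat_def)
    then have "of_nat (Suc k) * (\<Prod>z\<in>V. fact (lookup ?a z)) =
       (\<Prod>z\<in>V. fact (lookup ?b z) :: complex)"
      by (simp add: prod.remove[OF finite_V v] av mult.assoc del: One_nat_def)
    then show ?thesis
      unfolding pair_mon_def if_P[OF True] if_P[OF True[unfolded eq]] Suc .
  next
    case False
    then have "\<not> (\<forall>z\<in>V. lookup ?b z = lookup ?b (xi z))"
      unfolding eq .
    then show ?thesis
      unfolding pair_mon_def if_not_P[OF False] by (simp only: if_False mult_zero_right)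
  qed
qed

lemma L_pd:
  assumes "v \<in> V"
  shows "L (pd v w) = L (Var (xi v) * w)"
proof (induction w rule: pm_add_induct)
  case (single a c)
  show ?case
    using pair_mon_step[OF assms, of v "xi v" a] by (simp add: pd_single Var_mult_single L_single mult.assoc mult.left_commute del: One_nat_def)
qed (simp add: pd_add L_add distrib_left)

lemma L_pd_xi:
  assumes "v \<in> V"
  shows "L (pd (xi v) w) = L (Var v * w)"
proof (induction w rule: pm_add_induct)
  case (single a c)
  show ?case
    using pair_mon_step[OF assms, of "xi v" v a] by (simp add: pd_single Var_mult_single L_single mult.assoc mult.left_commute del: One_nat_def)
qed (simp add: pd_add L_add distrib_left)

subsection \<open>The Gram determinant\<close>

definition xmon :: "nat list \<Rightarrow> spoly" where
  "xmon ks = (\<Prod>a<length ks. Var (xi (ks ! a, a)))"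

text \<open>
  By the Leibniz expansion this is $\det(x^T \xi)$: it is the sum over \<open>ks\<close> of
  $\prod_a \xi_{k_a a} \det(x_{k_a b})$.
\<close>

definition gram :: spoly where
  "gram = (\<Sum>ks\<in>rows m n. xmon ks * minor ks)"

lemma xmon_snoc: "xmon (ks @ [k]) = xmon ks * Var (xi (k, length ks))"
  by (simp add: xmon_def nth_append)

lemma xmon_X: "ks \<in> rows m n \<Longrightarrow> xmon ks \<in> polys X"
  unfolding xmon_def by (intro polys_prod) (auto simp: rows_def nth_row)

lemma minor_V: "ks \<in> rows m n \<Longrightarrow> minor ks \<in> polys V"
  unfolding V_def by (intro minor_polys) (auto simp: rows_def)

lemma pd_V_X: "v \<in> V \<Longrightarrow> p \<in> polys X \<Longrightarrow> pd v p = 0"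
  using pd_notin V_X_disjoint by blast

lemma pd_X_V: "p \<in> polys V \<Longrightarrow> pd (xi v) p = 0"
  using pd_notin xi_notin by blast

lemma L_diag_op:
  assumes "set ks \<subseteq> {..<m}" "length ks \<le> n"
  shows "L (diag_op pd ks w) = L (xmon ks * w)"
  using assms
proof (induction ks arbitrary: w rule: rev_induct)
  case Nil
  then show ?case by (simp add: xmon_def)
next
  case (snoc k ks)
  let ?v = "(k, length ks)"
  have v: "?v \<in> V"
    using snoc.prems by simp
  have "pd ?v (xmon ks) = 0"
    unfolding xmon_def using v by (intro derivation_prod_zero[OF derivation_pd]) (simp add: pd_Var)
  then have "L (diag_op pd (ks @ [k]) w) = L (pd ?v (xmon ks * w))"
    using snoc by (simp add: diag_op_snoc pd_mult)
  also have "\<dots> = L (xmon (ks @ [k]) * w)"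
    unfolding L_pd[OF v] xmon_snoc by (simp add: mult_ac)
  finally show ?case .
qed

text \<open>
  Under \<open>L\<close> the factors $\xi_{k_a a}$ of the Gram determinant become derivatives, which gives the
  left hand side of the Capelli identity.
\<close>

lemma L_gram: "L (gram * w) = L (capelli m pd n w)"
proof -
  have "L (gram * w) = (\<Sum>ks\<in>rows m n. L (xmon ks * (minor ks * w)))"
    by (simp add: gram_def sum_distrib_right L_sum mult.assoc)
  also have "\<dots> = (\<Sum>ks\<in>rows m n. L (diag_op pd ks (minor ks * w)))"
    by (intro sum.cong) (auto simp: rows_def L_diag_op)
  finally show ?thesis
    by (simp add: capelli_def L_sum)
qed

lemma connection_pd: "connection pd"
  by (simp add: connection_def pd_add pd_mult)

lemma capelli_scalar:
  assumes "\<And>b j. b < j \<Longrightarrow> j < n \<Longrightarrow> polar m pd b j w = 0"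
    and "\<And>j. j < n \<Longrightarrow> polar m pd j j w = Cst (\<kappa> j) * w"
  shows "j \<le> n \<Longrightarrow> capelli m pd j w = Cst (\<Prod>i<j. \<kappa> i + of_nat m - of_nat i) * w"
proof (induction j)
  case 0
  then show ?case by (simp add: capelli_0 Cst_simps)
next
  case (Suc j)
  have "capelli m pd (Suc j) w = Cst (\<kappa> j) * capelli m pd j w + (of_nat m - of_nat j) * capelli m pd j w"
    using Suc.prems assms
    by (intro capelli_Suc[OF connection_pd, of j n]) (auto simp: distrib_left mult.left_commute pd_mult)
  also have "\<dots> = Cst (\<kappa> j + of_nat m - of_nat j) * capelli m pd j w"
    by (simp add: Cst_simps Cst_of_nat algebra_simps)
  finally show ?case
    using Suc by (simp add: Cst_simps mult_ac)
qed

lemma L_gram_scalar: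
  assumes "\<And>b j. b < j \<Longrightarrow> j < n \<Longrightarrow> polar m pd b j w = 0"
    and "\<And>j. j < n \<Longrightarrow> polar m pd j j w = Cst (\<kappa> j) * w"
  shows "L (gram * w) = (\<Prod>i<n. \<kappa> i + of_nat m - of_nat i) * L w"
  unfolding L_gram using capelli_scalar[OF assms, of n] by (simp add: L_Cst)

text \<open>
  The functions that transform by the \<open>B\<close>-th power of the determinant under the action of the general
  linear group on columns, in infinitesimal form.
\<close>

definition semi :: "nat \<Rightarrow> spoly \<Rightarrow> bool" where
  "semi B w \<longleftrightarrow> (\<forall>i<n. \<forall>j<n. polar m pd i j w = (if i = j then of_nat B * w else 0))"

lemma semiD: "semi B w \<Longrightarrow> i < n \<Longrightarrow> j < n \<Longrightarrow> polar m pd i j w = (if i = j then of_nat B * w else 0)"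
  by (simp add: semi_def)

lemma semi_mult: "semi A u \<Longrightarrow> semi B w \<Longrightarrow> semi (A + B) (u * w)"
  unfolding semi_def by (auto simp: derivation_mult[OF derivation_polar] algebra_simps)

lemma semi_1: "semi 0 1"
  by (simp add: semi_def derivation_1[OF derivation_polar])

lemma polar_X: "p \<in> polys X \<Longrightarrow> j < n \<Longrightarrow> polar m pd i j p = 0"
  unfolding polar_def by (intro sum.neutral) (auto simp: pd_V_X)

lemma semi_X: "p \<in> polys X \<Longrightarrow> semi 0 p"
  by (auto simp: semi_def polar_X)

lemma semi_minor: "ks \<in> rows m n \<Longrightarrow> semi 1 (minor ks)"
  by (auto simp: semi_def rows_def polar_minor)

lemma semi_prod_list: "(\<And>x. x \<in> set xs \<Longrightarrow> semi 1 x) \<Longrightarrow> semi (length xs) (prod_list xs)"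
  using semi_mult[of 1] by (induction xs) (auto simp: semi_1)

lemma semi_gram: "semi 1 gram"
proof -
  have "semi 1 (xmon ks * minor ks)" if "ks \<in> rows m n" for ks
    using semi_mult[OF semi_X[OF xmon_X] semi_minor, OF that that] by simp
  then show ?thesis
    unfolding semi_def gram_def
    by (auto simp: derivation_sum[OF derivation_polar] intro!: sum.cong)
qed

lemma semi_gram_power: "semi M (gram ^ M)"
proof (induction M)
  case (Suc M)
  then show ?case using semi_mult[OF semi_gram, of M] by simp
qed (simp add: semi_1)

text \<open>
  The assumptions on \<open>v\<close> say that it is a highest weight vector of weight \<open>\<mu>\<close>. All factors but \<open>v\<close> only
  shift the weight, so each further factor \<open>gram\<close> is evaluated by the Capelli identity.
\<close>

lemma L_gram_power:
  assumes hw: "\<And>b j. b < j \<Longrightarrow> j < n \<Longrightarrow> polar m pd b j v = 0"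
    and wt: "\<And>j. j < n \<Longrightarrow> polar m pd j j v = Cst (\<mu> j) * v"
    and h: "semi B h"
  shows "L (v * h * gram ^ M) = (\<Prod>t<M. \<Prod>j<n. \<mu> j + of_nat B + of_nat t + of_nat m - of_nat j) * L (v * h)"
proof (induction M)
  case (Suc M)
  let ?w = "v * h * gram ^ M"
  have s: "semi (B + M) (h * gram ^ M)"
    using semi_mult[OF h semi_gram_power] .
  have "polar m pd b j ?w = polar m pd b j v * (h * gram ^ M) + v * polar m pd b j (h * gram ^ M)" for b j
    by (simp add: derivation_mult[OF derivation_polar] algebra_simps)
  then have "polar m pd b j ?w = 0" if "b < j" "j < n" for b j
    using that hw semiD[OF s] by simp
  moreover have "polar m pd j j ?w = Cst (\<mu> j + of_nat (B + M)) * ?w" if "j < n" for j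
    using that wt[OF that] semiD[OF s that that]
    by (simp add: derivation_mult[OF derivation_polar] Cst_simps Cst_of_nat mult.assoc) (simp add: algebra_simps)
  ultimately have "L (gram * ?w) = (\<Prod>i<n. \<mu> i + of_nat (B + M) + of_nat m - of_nat i) * L ?w"
    by (intro L_gram_scalar)
  moreover have "L (v * h * gram ^ Suc M) = L (gram * ?w)"
    by (simp add: mult_ac)
  ultimately have "L (v * h * gram ^ Suc M) =
      (\<Prod>j<n. \<mu> j + of_nat B + of_nat M + of_nat m - of_nat j) * L ?w"
    by (simp add: add.assoc)
  then have "L (v * h * gram ^ Suc M) = (\<Prod>j<n. \<mu> j + of_nat B + of_nat M + of_nat m - of_nat j) *
      ((\<Prod>t<M. \<Prod>j<n. \<mu> j + of_nat B + of_nat t + of_nat m - of_nat j) * L (v * h))"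
    unfolding Suc.IH .
  then show ?case
    by (simp only: prod.lessThan_Suc mult_ac)
qed simp

definition gram_const :: "nat \<Rightarrow> complex" where
  "gram_const N = (\<Prod>t<N. \<Prod>j<n. of_nat t + of_nat m - of_nat j)"

lemma L_gram_power_1: "L (gram ^ N) = gram_const N"
  using L_gram_power[of 1 "\<lambda>_. 0" 0 1 N]
  by (simp add: derivation_1[OF derivation_polar] Cst_simps semi_1 gram_const_def L_1)

lemma gram_const_nonzero:
  assumes "n \<le> m"
  shows "gram_const N \<noteq> 0"
proof -
  have "of_nat t + of_nat m - of_nat j = (of_nat (t + m - j) :: complex)" "t + m - j \<noteq> 0" if "j < n" for t j
    using that assms by (auto simp: of_nat_diff)
  then show ?thesis
    by (simp add: gram_const_def)
qed

subsection \<open>Invariance of the Gram determinant\<close>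

definition xpolar :: "nat \<Rightarrow> nat \<Rightarrow> spoly \<Rightarrow> spoly" where
  "xpolar i j w = (\<Sum>k<m. Var (xi (k, i)) * pd (xi (k, j)) w)"

lemma derivation_xpolar: "derivation (xpolar i j)"
  by (auto simp: derivation_def xpolar_def pd_add pd_mult algebra_simps sum.distrib sum_distrib_left)

lemma xpolar_V: "p \<in> polys V \<Longrightarrow> xpolar i j p = 0"
  by (simp add: xpolar_def pd_X_V)

lemma xpolar_Var: "k < m \<Longrightarrow> xpolar i j (Var (xi (k, b))) = (if b = j then Var (xi (k, i)) else 0)"
proof -
  assume "k < m"
  have "xpolar i j (Var (xi (k, b))) = (\<Sum>k'<m. if k' = k then (if b = j then Var (xi (k, i)) else 0) else 0)"
    unfolding xpolar_def by (intro sum.cong) (auto simp: pd_Var)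
  then show ?thesis using \<open>k < m\<close> by simp
qed

lemma xpolar_polys_X: "r \<in> polys X \<Longrightarrow> i < n \<Longrightarrow> xpolar i j r \<in> polys X"
  unfolding xpolar_def by (intro polys_sum polys_mult pd_polys) auto

text \<open>
  The sum is antisymmetric under the exchange of the rows \<open>i\<close> and \<open>j\<close> in \<open>ks\<close>: after polarization both
  variables with these positions lie in the same column \<open>i\<close>, while the minor changes sign.
\<close>

lemma xpolar_gram:
  assumes "i < n" "j < n" "i \<noteq> j"
  shows "xpolar i j gram = 0"
proof -
  define G where "G ks = Var (xi (ks ! j, i)) * Var (xi (ks ! i, i)) * (\<Prod>a\<in>{..<n} - {j} - {i}. Var (xi (ks ! a, a)))" for ks
  define sw where "sw ks = ks[i := ks ! j, j := ks ! i]" for ks :: "nat list"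
  have "xpolar i j (xmon ks) = G ks" if ks: "ks \<in> rows m n" for ks
  proof -
    have len: "length ks = n" and lt: "\<And>a. a < n \<Longrightarrow> ks ! a < m"
      using ks nth_row by (auto simp: rows_def)
    have "xmon ks = Var (xi (ks ! j, j)) * (\<Prod>a\<in>{..<n} - {j}. Var (xi (ks ! a, a)))"
      using assms by (simp add: xmon_def len prod.remove[of _ j])
    moreover have "xpolar i j (\<Prod>a\<in>{..<n} - {j}. Var (xi (ks ! a, a))) = 0"
      by (rule derivation_prod_zero[OF derivation_xpolar]) (auto simp: xpolar_Var lt)
    ultimately have "xpolar i j (xmon ks) = Var (xi (ks ! j, i)) * (\<Prod>a\<in>{..<n} - {j}. Var (xi (ks ! a, a)))"
      using assms by (simp add: derivation_mult[OF derivation_xpolar] xpolar_Var lt)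
    also have "(\<Prod>a\<in>{..<n} - {j}. Var (xi (ks ! a, a))) =
        Var (xi (ks ! i, i)) * (\<Prod>a\<in>{..<n} - {j} - {i}. Var (xi (ks ! a, a)))"
      using assms by (intro prod.remove) auto
    finally show ?thesis by (simp add: G_def mult.assoc)
  qed
  then have S: "xpolar i j gram = (\<Sum>ks\<in>rows m n. G ks * minor ks)"
    unfolding gram_def derivation_sum[OF derivation_xpolar]
    by (intro sum.cong) (auto simp: derivation_mult[OF derivation_xpolar] xpolar_V minor_V)
  have sw_rows: "sw ks \<in> rows m n" if "ks \<in> rows m n" for ks
  proof -
    have "set (sw ks) \<subseteq> set ks"
      using that assms unfolding sw_def rows_def by (auto dest!: subsetD[OF set_update_subset_insert])
    then show ?thesis
      using that by (auto simp: rows_def sw_def)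
  qed
  have sw_sw: "sw (sw ks) = ks" if "ks \<in> rows m n" for ks
    using that assms by (intro nth_equalityI) (auto simp: sw_def rows_def nth_list_update)
  have sw_G: "G (sw ks) = G ks" if "ks \<in> rows m n" for ks
  proof -
    have "(\<Prod>a\<in>{..<n} - {j} - {i}. Var (xi (sw ks ! a, a))) = (\<Prod>a\<in>{..<n} - {j} - {i}. Var (xi (ks ! a, a)))"
      by (intro prod.cong) (auto simp: sw_def nth_list_update)
    moreover have "sw ks ! j = ks ! i" "sw ks ! i = ks ! j"
      using that assms by (auto simp: sw_def rows_def nth_list_update)
    ultimately show ?thesis
      unfolding G_def by (simp add: mult_ac)
  qed
  have sw_minor: "minor (sw ks) = - minor ks" if "ks \<in> rows m n" for ks
  proof -
    have len: "length ks = n"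
      using that by (simp add: rows_def)
    have "vmat (sw ks) = swaprows i j (vmat ks)"
      using assms len
      by (intro eq_matI) (auto simp: vmat_def sw_def nth_list_update)
    then show ?thesis
      unfolding minor_def using assms len vmat_carrier[of ks] by (simp add: det_swaprows)
  qed
  have "(\<Sum>ks\<in>rows m n. G ks * minor ks) = (\<Sum>ks\<in>rows m n. G (sw ks) * minor (sw ks))"
    by (rule sum.reindex_bij_witness[of _ sw sw]) (auto simp: sw_rows sw_sw)
  also have "\<dots> = - (\<Sum>ks\<in>rows m n. G ks * minor ks)"
    unfolding sum_negf[symmetric] by (intro sum.cong) (auto simp: sw_G sw_minor)
  finally have "2 * xpolar i j gram = 0"
    unfolding S by simp
  then show ?thesis by simp
qed

text \<open>
  $L(x_{ki} \partial_{kj} w) = L(\xi_{kj} x_{ki} w) = L(\xi_{kj} \partial_{\xi_{ki}} w)$, where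
  $i \neq j$ makes the factors commute.
\<close>

lemma L_polar_transfer:
  assumes "i < n" "j < n" "i \<noteq> j"
  shows "L (polar m pd i j w) = L (xpolar j i w)"
proof -
  have "L (Var (k, i) * pd (k, j) w) = L (Var (xi (k, j)) * pd (xi (k, i)) w)" if "k < m" for k
  proof -
    have v: "(k, i) \<in> V" "(k, j) \<in> V"
      using that assms by auto
    have "L (Var (k, i) * pd (k, j) w) = L (pd (k, j) (Var (k, i) * w))"
      using assms by (simp add: pd_mult pd_Var)
    also have "\<dots> = L (Var (k, i) * (Var (xi (k, j)) * w))"
      unfolding L_pd[OF v(2)] by (simp add: mult_ac)
    also have "\<dots> = L (pd (xi (k, i)) (Var (xi (k, j)) * w))"
      unfolding L_pd_xi[OF v(1)] ..
    also have "\<dots> = L (Var (xi (k, j)) * pd (xi (k, i)) w)"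
      using assms by (simp add: pd_mult pd_Var)
    finally show ?thesis .
  qed
  then show ?thesis
    by (simp add: polar_def xpolar_def L_sum)
qed

lemma L_polar_move:
  assumes ij: "i < n" "j < n" "i \<noteq> j" and F: "semi B F" "F \<in> polys V" and p: "p \<in> polys V" and r: "r \<in> polys X"
  shows "L (polar m pd i j p * r * F * gram ^ M) = L (p * xpolar j i r * F * gram ^ M)"
proof -
  let ?h = "r * F * gram ^ M"
  have "semi (0 + B + M) ?h"
    using r F by (intro semi_mult semi_X semi_gram_power)
  then have "polar m pd i j ?h = 0"
    using ij by (simp only: semiD if_False)
  then have "polar m pd i j (p * ?h) = polar m pd i j p * ?h"
    by (simp only: derivation_mult[OF derivation_polar, of _ _ _ p] mult_zero_right add_0_right)
  moreover have "xpolar j i (gram ^ M) = 0"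
  proof (cases M)
    case (Suc k)
    then show ?thesis
      using derivation_power[OF derivation_xpolar, of j i gram k] ij by (simp add: xpolar_gram)
  qed (simp add: derivation_1[OF derivation_xpolar])
  then have "xpolar j i (p * ?h) = p * (xpolar j i r * F * gram ^ M)"
    using F p by (simp add: derivation_mult[OF derivation_xpolar] xpolar_V)
  ultimately show ?thesis
    using L_polar_transfer[OF ij, of "p * ?h"] by (simp add: mult.assoc)
qed

end

section \<open>Highest weight vectors\<close>

definition fischer_weight :: "(var \<Rightarrow>\<^sub>0 nat) \<Rightarrow> complex" where
  "fischer_weight a = (\<Prod>v\<in>keys a. fact (lookup a v))"

lemma fischer_weight_Suc:
  "fischer_weight (a + single v 1) = of_nat (Suc (lookup a v)) * fischer_weight a"
proof -
  let ?K = "insert v (keys a)"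
  have superset: "fischer_weight b = (\<Prod>w\<in>?K. fact (lookup b w))"
    if "keys b \<subseteq> ?K" for b
    unfolding fischer_weight_def using that by (intro prod.mono_neutral_left) (auto simp: in_keys_iff)
  have "fischer_weight (a + single v 1) = (\<Prod>w\<in>?K. fact (lookup (a + single v 1) w))"
    using Poly_Mapping.keys_add[of a "single v (1::nat)"] by (intro superset) auto
  also have "\<dots> = (\<Prod>w\<in>?K. (if w = v then of_nat (Suc (lookup a v)) else 1) * fact (lookup a w))"
    by (intro prod.cong) (auto simp: lookup_add_single fact_plus_1 simp del: One_nat_def)
  also have "\<dots> = of_nat (Suc (lookup a v)) * fischer_weight a"
    unfolding superset[OF subset_insertI] prod.distrib by (subst prod.delta) auto
  finally show ?thesis .
qed

text \<open>
  The Hermitian Fischer inner product, with $\langle x^a, x^b \rangle = a!\, \delta_{ab}$. It is positive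
  definite, and the polarizations from column \<open>i\<close> to \<open>j\<close> and from \<open>j\<close> to \<open>i\<close> are adjoint.
\<close>

definition fischer :: "spoly \<Rightarrow> spoly \<Rightarrow> complex" where
  "fischer p q = lin_ext (\<lambda>a c. c * (fischer_weight a * cnj (lookup q a))) p"

lemma coeff_additive_fischer: "coeff_additive (\<lambda>a c. c * (fischer_weight a * cnj (lookup q a)))"
  by (auto simp: coeff_additive_def algebra_simps)

lemma fischer_single: "fischer (single a c) q = c * (fischer_weight a * cnj (lookup q a))"
  unfolding fischer_def by (simp add: lin_ext_single coeff_additive_fischer)

lemma fischer_add: "fischer (p + q) w = fischer p w + fischer q w"
  unfolding fischer_def by (simp add: lin_ext_add coeff_additive_fischer)

lemma fischer_zero [simp]: "fischer 0 w = 0"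
  by (simp add: fischer_def)

lemma fischer_sum: "fischer (sum f A) w = (\<Sum>x\<in>A. fischer (f x) w)"
  unfolding fischer_def by (simp add: lin_ext_sum coeff_additive_fischer)

lemma fischer_Cst: "fischer (Cst c * p) w = c * fischer p w"
  by (induction p rule: pm_add_induct)
     (simp_all add: Cst_def mult_single fischer_single fischer_add distrib_left mult.assoc)

lemma fischer_add_right: "fischer p (q + w) = fischer p q + fischer p w"
  by (simp add: fischer_def lin_ext_def lookup_add distrib_left sum.distrib)

lemma lookup_Cst_mult: "lookup (Cst c * q) a = c * lookup q a"
  by (induction q rule: pm_add_induct)
     (simp_all add: Cst_def mult_single lookup_add distrib_left lookup_single when_def)

lemma fischer_Cst_right: "fischer p (Cst c * q) = cnj c * fischer p q"
  by (simp add: fischer_def lin_ext_def lookup_Cst_mult sum_distrib_left mult.left_commute)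

lemma fischer_self_eq_0:
  assumes "fischer p p = 0"
  shows "p = 0"
proof -
  define w where "w a = (\<Prod>v\<in>keys a. fact (lookup a v)) * (cmod (lookup p a))\<^sup>2"
    for a :: "var \<Rightarrow>\<^sub>0 nat"
  have "fischer p p = (\<Sum>a\<in>keys p. of_real (w a))"
    unfolding fischer_def lin_ext_def
  proof (rule sum.cong)
    fix a
    have "c * (G * cnj c) = G * of_real ((cmod c)\<^sup>2)" for c G :: complex
      by (simp only: complex_norm_square mult_ac)
    then show "lookup p a * (fischer_weight a * cnj (lookup p a)) = of_real (w a)"
      by (simp only: w_def fischer_weight_def) simp
  qed simp
  then have "(\<Sum>a\<in>keys p. w a) = 0"
    using assms by (metis of_real_eq_0_iff of_real_sum)
  moreover have "w a \<ge> 0" for a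
    by (auto simp: w_def intro!: mult_nonneg_nonneg prod_nonneg)
  ultimately have "w a = 0" if "a \<in> keys p" for a
    using that by (simp add: sum_nonneg_eq_0_iff)
  note w0 = this
  have "lookup p a = 0" for a
  proof (rule ccontr)
    assume nz: "lookup p a \<noteq> 0"
    then have "w a = 0"
      by (intro w0) (simp add: in_keys_iff)
    then show False
      using nz by (simp add: w_def)
  qed
  then show ?thesis
    by (intro poly_mapping_eqI) (simp only: lookup_zero)
qed

lemma lookup_pd:
  "lookup (pd v q) a =
     of_nat (Suc (lookup a v)) * lookup q (a + single v 1)"
proof (induction q rule: pm_add_induct)
  case (single b d)
  show ?case
  proof (cases "lookup b v")
    case 0
    then have "b \<noteq> a + single v 1"
      using lookup_add_single[of a v v] by (auto simp del: One_nat_def)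
    then show ?thesis
      using 0 by (simp add: pd_single lookup_single when_def)
  next
    case (Suc k)
    have "b - single v 1 = a \<longleftrightarrow> b = a + single v 1"
    proof
      assume "b - single v 1 = a"
      then show "b = a + single v 1"
        using Suc by (intro poly_mapping_eqI)
          (auto simp: lookup_add_single lookup_diff_single simp del: One_nat_def)
    next
      assume "b = a + single v 1"
      then show "b - single v 1 = a"
        by simp
    qed
    then show ?thesis
      using Suc by (auto simp: pd_single lookup_single when_def lookup_add_single simp del: One_nat_def)
  qed
qed (simp add: pd_add lookup_add distrib_left)

lemma fischer_Var: "fischer (Var v * p) q = fischer p (pd v q)"
  by (induction p rule: pm_add_induct)
     (simp_all add: Var_mult_single fischer_single lookup_pd fischer_weight_Suc fischer_add distrib_left
        mult_ac del: One_nat_def of_nat_Suc)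

lemma lookup_Var_mult:
  "lookup (Var v * q) a =
     (if lookup a v = 0 then 0 else lookup q (a - single v 1))"
proof (induction q rule: pm_add_induct)
  case (single b d)
  show ?case
  proof (cases "lookup a v")
    case 0
    then have "b + single v 1 \<noteq> a"
      using lookup_add_single[of b v v] by (auto simp del: One_nat_def)
    then show ?thesis
      using 0 by (simp add: Var_mult_single lookup_single when_def)
  next
    case (Suc k)
    have "b + single v 1 = a \<longleftrightarrow> b = a - single v 1"
    proof
      assume "b = a - single v 1"
      then show "b + single v 1 = a"
        using Suc by (intro poly_mapping_eqI)
          (auto simp: lookup_add_single lookup_diff_single simp del: One_nat_def)
    qed auto
    then show ?thesis
      using Suc by (auto simp: Var_mult_single lookup_single when_def simp del: One_nat_def)
  qed
qed (simp add: lookup_add distrib_left)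

lemma fischer_pd: "fischer (pd v p) q = fischer p (Var v * q)"
proof (induction p rule: pm_add_induct)
  case (single a c)
  show ?case
  proof (cases "lookup a v")
    case 0
    then show ?thesis
      by (simp add: pd_single fischer_single lookup_Var_mult)
  next
    case (Suc k)
    define b where "b = a - single v 1"
    have a: "a = b + single v 1"
      unfolding b_def using Suc by (intro poly_mapping_eqI)
          (auto simp: lookup_add_single lookup_diff_single simp del: One_nat_def)
    have lv: "lookup a v = Suc (lookup b v)"
      unfolding a by (simp add: lookup_add_single del: One_nat_def)
    show ?thesis
      unfolding pd_single fischer_single lookup_Var_mult lv b_def[symmetric]
      using fischer_weight_Suc[of b v] by (simp add: a del: One_nat_def of_nat_Suc)
  qed
qed (simp add: pd_add fischer_add)

lemma fischer_polar: "fischer (polar m pd i j p) q = fischer p (polar m pd j i q)"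
proof -
  have "fischer (Var (k, i) * pd (k, j) p) q = fischer p (Var (k, j) * pd (k, i) q)" for k
    by (simp add: fischer_Var fischer_pd)
  moreover have "fischer p (sum f A) = (\<Sum>x\<in>A. fischer p (f x))" for f and A :: "nat set"
    by (induction A rule: infinite_finite_induct)
       (simp_all add: fischer_add_right, simp_all add: fischer_def lin_ext_def)
  ultimately show ?thesis
    by (simp add: polar_def fischer_sum)
qed

inductive_set cspan :: "spoly set \<Rightarrow> spoly set" for B where
  zero: "0 \<in> cspan B"
| base: "b \<in> B \<Longrightarrow> b \<in> cspan B"
| add: "u \<in> cspan B \<Longrightarrow> w \<in> cspan B \<Longrightarrow> u + w \<in> cspan B"
| scale: "u \<in> cspan B \<Longrightarrow> Cst c * u \<in> cspan B"

lemma cspan_mono: "u \<in> cspan B \<Longrightarrow> B \<subseteq> C \<Longrightarrow> u \<in> cspan C"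
  by (induction rule: cspan.induct) (auto intro: cspan.intros)

lemma cspan_orthogonal: "u \<in> cspan B \<Longrightarrow> (\<And>b. b \<in> B \<Longrightarrow> fischer b w = 0) \<Longrightarrow> fischer u w = 0"
  by (induction rule: cspan.induct) (auto simp: fischer_add fischer_Cst)

text \<open>
  The Gram--Schmidt process, one vector of \<open>B\<close> at a time.
\<close>

lemma orthogonal_projection:
  assumes "finite B"
  shows "\<exists>u\<in>cspan B. \<exists>w. x = u + w \<and> (\<forall>b\<in>B. fischer b w = 0)"
  using assms
proof (induction B arbitrary: x)
  case empty
  show ?case by (intro bexI[of _ 0] exI[of _ x]) (auto intro: cspan.zero)
next
  case (insert b B)
  obtain ub wb where b: "ub \<in> cspan B" "b = ub + wb" "\<forall>c\<in>B. fischer c wb = 0"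
    using insert.IH by blast
  obtain ux wx where x: "ux \<in> cspan B" "x = ux + wx" "\<forall>c\<in>B. fischer c wx = 0"
    using insert.IH by blast
  define t where "t = cnj (fischer wb wx / fischer wb wb)"
  define w where "w = wx + Cst (- t) * wb"
  have orth: "fischer c w = 0" if "c \<in> B" for c
    using that b x by (simp add: w_def fischer_add_right fischer_Cst_right)
  have "fischer wb w = 0"
  proof (cases "fischer wb wb = 0")
    case True
    then have "wb = 0" by (rule fischer_self_eq_0)
    then show ?thesis by simp
  next
    case False
    then show ?thesis by (simp add: w_def t_def fischer_add_right fischer_Cst_right)
  qed
  moreover have "fischer ub w = 0"
    using cspan_orthogonal[OF b(1)] orth by blast
  ultimately have bw: "fischer b w = 0"
    by (simp add: b(2) fischer_add)
  have "wb = b + Cst (- 1) * ub"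
    by (simp add: b(2) Cst_simps)
  then have wb: "wb \<in> cspan (insert b B)"
    using b(1) by (metis cspan.add cspan.base cspan.scale cspan_mono insertI1 subset_insertI)
  then have "ux + Cst t * wb \<in> cspan (insert b B)"
    using cspan_mono[OF x(1) subset_insertI] by (intro cspan.add cspan.scale)
  moreover have "x = (ux + Cst t * wb) + w"
    by (simp add: w_def x(2) Cst_simps)
  ultimately show ?case
    using orth bw by blast
qed

context generic_mat
begin

definition weight :: "(nat \<Rightarrow> nat) \<Rightarrow> spoly set" where
  "weight d = {p \<in> polys V. \<forall>a\<in>keys p. \<forall>j<n. (\<Sum>k<m. lookup a (k, j)) = d j}"

definition weight_mons :: "(nat \<Rightarrow> nat) \<Rightarrow> (var \<Rightarrow>\<^sub>0 nat) set" where
  "weight_mons d = {a. keys a \<subseteq> V \<and> (\<forall>j<n. (\<Sum>k<m. lookup a (k, j)) = d j)}"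

lemma weight_iff: "p \<in> weight d \<longleftrightarrow> keys p \<subseteq> weight_mons d"
  by (auto simp: weight_def weight_mons_def polys_def)

lemma weight_0 [simp]: "0 \<in> weight d"
  by (simp add: weight_iff)

lemma weight_add: "p \<in> weight d \<Longrightarrow> q \<in> weight d \<Longrightarrow> p + q \<in> weight d"
  using Poly_Mapping.keys_add[of p q] by (auto simp: weight_iff)

lemma weight_Cst: "p \<in> weight d \<Longrightarrow> Cst c * p \<in> weight d"
  by (auto simp: weight_iff in_keys_iff lookup_Cst_mult)

lemma weight_sum: "(\<And>x. x \<in> A \<Longrightarrow> f x \<in> weight d) \<Longrightarrow> sum f A \<in> weight d"
  by (induction A rule: infinite_finite_induct) (auto simp: weight_add)

lemma weight_single: "a \<in> weight_mons d \<Longrightarrow> single a c \<in> weight d"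
  by (simp add: weight_iff)

lemma weight_polys: "p \<in> weight d \<Longrightarrow> p \<in> polys V"
  by (simp add: weight_def)

lemma weight_induct [consumes 1, case_names single add]:
  assumes "p \<in> weight d" "\<And>a c. a \<in> weight_mons d \<Longrightarrow> P (single a c)"
    "\<And>p q. p \<in> weight d \<Longrightarrow> q \<in> weight d \<Longrightarrow> P p \<Longrightarrow> P q \<Longrightarrow> P (p + q)" "P 0"
  shows "P p"
proof -
  have "P (\<Sum>a\<in>K. single a (lookup p a)) \<and>
      (\<Sum>a\<in>K. single a (lookup p a)) \<in> weight d"
    if "finite K" "K \<subseteq> keys p" for K
    using that
  proof induction
    case (insert a K)
    then have "a \<in> weight_mons d"
      using assms(1) by (auto simp: weight_iff)
    then show ?case
      using insert by (auto intro!: assms(2,3) weight_add weight_single)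
  qed (simp add: assms(4))
  moreover note sum_singles[of p]
  ultimately show ?thesis
    by (metis finite_keys order_refl)
qed

lemma finite_weight_mons: "finite (weight_mons d)"
proof -
  let ?B = "\<Sum>j<n. d j"
  have "(\<lambda>a. restrict (lookup a) V) ` weight_mons d \<subseteq> V \<rightarrow>\<^sub>E {..?B}"
  proof (intro image_subsetI PiE_I)
    fix a v assume a: "a \<in> weight_mons d" and "v \<in> V"
    then obtain k j where v: "v = (k, j)" "k < m" "j < n"
      by (auto simp: V_def)
    have "lookup a (k, j) \<le> (\<Sum>k<m. lookup a (k, j))"
      using v by (intro member_le_sum) auto
    also have "\<dots> = d j"
      using a v by (auto simp: weight_mons_def)
    also have "\<dots> \<le> ?B"
      using v by (intro member_le_sum) auto
    finally show "restrict (lookup a) V v \<in> {..?B}"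
      using v by auto
  qed auto
  moreover have "finite (V \<rightarrow>\<^sub>E {..?B})"
    by (intro finite_PiE) auto
  moreover have "inj_on (\<lambda>a. restrict (lookup a) V) (weight_mons d)"
  proof (rule inj_onI)
    fix a b assume ab: "a \<in> weight_mons d" "b \<in> weight_mons d"
      "restrict (lookup a) V = restrict (lookup b) V"
    show "a = b"
    proof (rule poly_mapping_eqI)
      fix v
      show "lookup a v = lookup b v"
      proof (cases "v \<in> V")
        case True
        then show ?thesis using fun_cong[OF ab(3), of v] by simp
      next
        case False
        then have "v \<notin> keys a" "v \<notin> keys b"
          using ab by (auto simp: weight_mons_def)
        then show ?thesis by (simp add: in_keys_iff)
      qed
    qed
  qed
  ultimately show ?thesis
    using finite_subset inj_on_finite by blast
qed

lemma polar_diag: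
  assumes "p \<in> weight d" "j < n"
  shows "polar m pd j j p = Cst (of_nat (d j)) * p"
  using assms(1)
proof (induction rule: weight_induct)
  case (single a c)
  have "Var (k, j) * pd (k, j) (single a c) =
     single a (of_nat (lookup a (k, j)) * c)" for k
  proof (cases "lookup a (k, j)")
    case (Suc l)
    then have "a - single (k, j) 1 + single (k, j) 1 = a"
      by (intro poly_mapping_eqI) (auto simp: lookup_add_single lookup_diff_single simp del: One_nat_def)
    then show ?thesis
      by (simp add: pd_single Var_mult_single del: One_nat_def)
  qed (simp add: pd_single)
  then have "polar m pd j j (single a c) =
     (\<Sum>k<m. single a (of_nat (lookup a (k, j)) * c))"
    by (simp add: polar_def)
  also have "\<dots> = single a (of_nat (\<Sum>k<m. lookup a (k, j)) * c)"
  proof -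
    have "(\<Sum>k\<in>A. single a (of_nat (f k) * c)) = single a (of_nat (sum f A) * c)"
      if "finite A" for f and A :: "nat set"
      using that by induction (auto simp: algebra_simps simp flip: single_add)
    then show ?thesis by simp
  qed
  also have "(\<Sum>k<m. lookup a (k, j)) = d j"
    using single assms by (auto simp: weight_mons_def)
  finally show ?case
    by (simp only: Cst_def mult_single add_0_left)
qed (auto simp: derivation_add[OF derivation_polar] derivation_0[OF derivation_polar] algebra_simps)

lemma polar_weight:
  assumes "p \<in> weight d" "i < n" "j < n" "i \<noteq> j"
  shows "polar m pd i j p \<in> weight (d(i := Suc (d i), j := d j - 1))"
    and "d j = 0 \<Longrightarrow> polar m pd i j p = 0"
proof -
  let ?d = "d(i := Suc (d i), j := d j - 1)"
  have *: "polar m pd i j p \<in> weight ?d \<and> (d j = 0 \<longrightarrow> polar m pd i j p = 0)"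
    using assms(1)
  proof (induction rule: weight_induct)
    case (single a c)
    have "Var (k, i) * pd (k, j) (single a c) \<in> weight ?d \<and>
        (d j = 0 \<longrightarrow> Var (k, i) * pd (k, j) (single a c) = 0)" if k: "k < m" for k
    proof (cases "lookup a (k, j)")
      case 0
      then show ?thesis by (simp add: pd_single)
    next
      case (Suc l)
      let ?b = "a - single (k, j) 1 + single (k, i) 1"
      have sum: "(\<Sum>k<m. lookup a (k, j')) = d j'" if "j' < n" for j'
        using single that by (auto simp: weight_mons_def)
      have lb: "lookup ?b (k', j') = lookup a (k', j') -
          (if k' = k \<and> j' = j then 1 else 0) + (if k' = k \<and> j' = i then 1 else 0)" for k' j'
        by (simp add: lookup_add_single lookup_diff_single del: One_nat_def)
      have "(\<Sum>k'<m. lookup ?b (k', j')) = ?d j'" if "j' < n" for j'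
      proof -
        have "j' = j \<Longrightarrow> ?thesis"
        proof -
          assume j': "j' = j"
          have "(\<Sum>k'<m. lookup ?b (k', j')) + 1 = (\<Sum>k'<m. lookup ?b (k', j') + (if k' = k then 1 else 0))"
            using k by (simp add: sum.distrib)
          also have "\<dots> = (\<Sum>k'<m. lookup a (k', j))"
            unfolding lb j' using Suc assms by (intro sum.cong) auto
          finally show ?thesis
            using sum[OF assms(3)] j' by simp
        qed
        moreover have "j' = i \<Longrightarrow> ?thesis"
          unfolding lb using assms k sum[OF assms(2)] by (simp add: sum.distrib)
        moreover have "j' \<noteq> i \<Longrightarrow> j' \<noteq> j \<Longrightarrow> ?thesis"
          unfolding lb using sum[OF that] by simp
        ultimately show ?thesis by blast
      qed
      moreover have "keys ?b \<subseteq> V"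
      proof
        fix v assume "v \<in> keys ?b"
        then have "v \<in> keys a \<or> v = (k, i)"
          using lb[of "fst v" "snd v"] by (cases v) (auto simp: in_keys_iff split: if_splits simp del: One_nat_def)
        then show "v \<in> V"
          using single k assms by (auto simp: weight_mons_def)
      qed
      ultimately have "?b \<in> weight_mons ?d"
        by (simp add: weight_mons_def)
      moreover have "d j \<noteq> 0"
      proof -
        have "lookup a (k, j) \<le> d j"
          unfolding sum[OF assms(3), symmetric] using k by (intro member_le_sum) auto
        then show ?thesis using Suc by simp
      qed
      ultimately show ?thesis
        by (simp add: pd_single Var_mult_single weight_single del: One_nat_def)
    qed
    note terms = this
    have "polar m pd i j (single a c) \<in> weight ?d"
      unfolding polar_def by (intro weight_sum) (use terms in blast)
    moreover have "polar m pd i j (single a c) = 0" if "d j = 0"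
      unfolding polar_def by (intro sum.neutral) (use terms that in blast)
    ultimately show ?case by blast
  qed (auto simp: derivation_add[OF derivation_polar] derivation_0[OF derivation_polar] intro: weight_add)
  then show "polar m pd i j p \<in> weight ?d" and "d j = 0 \<Longrightarrow> polar m pd i j p = 0"
    by auto
qed

lemma cspan_weight: "u \<in> cspan B \<Longrightarrow> B \<subseteq> weight d \<Longrightarrow> u \<in> weight d"
  by (induction rule: cspan.induct) (auto intro: weight_add weight_Cst)

lemma fischer_weight_orthogonal:
  assumes "z \<in> weight d" "\<And>a. a \<in> weight_mons d \<Longrightarrow> fischer (single a 1) z = 0"
  shows "z = 0"
proof -
  have "fischer x z = 0" if "x \<in> weight d" for x
    using that
  proof (induction rule: weight_induct)
    case (single a c)
    then show ?case using assms(2)[of a] by (simp add: fischer_single)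
  qed (auto simp: fischer_add)
  then show ?thesis
    using fischer_self_eq_0 assms(1) by blast
qed

text \<open>
  Within the finite-dimensional space of a fixed weight, the orthogonal complement of the images of
  the lowering polarizations is the common kernel of their adjoints, the raising ones; hence it
  consists of highest weight vectors. The images come from spaces of higher weight. Induction is on
  $\sum_j j\, d_j$, which decreases when the weight rises.
\<close>

theorem highest_weight_induct [consumes 1, case_names hw add scale lower]:
  assumes p: "p \<in> polys V"
    and hw: "\<And>v d. v \<in> weight d \<Longrightarrow> (\<And>b j. b < j \<Longrightarrow> j < n \<Longrightarrow> polar m pd b j v = 0) \<Longrightarrow> P v"
    and add: "\<And>u w. u \<in> polys V \<Longrightarrow> w \<in> polys V \<Longrightarrow> P u \<Longrightarrow> P w \<Longrightarrow> P (u + w)"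
    and scale: "\<And>c u. u \<in> polys V \<Longrightarrow> P u \<Longrightarrow> P (Cst c * u)"
    and lower: "\<And>i j u. u \<in> polys V \<Longrightarrow> i < n \<Longrightarrow> j < n \<Longrightarrow> i \<noteq> j \<Longrightarrow> P u \<Longrightarrow> P (polar m pd i j u)"
  shows "P p"
proof -
  have P0: "P 0"
    using hw[of 0 "\<lambda>_. 0"] by (simp add: derivation_0[OF derivation_polar])
  have "P p" if "p \<in> weight d" for p d
    using that
  proof (induction "\<Sum>j<n. j * d j" arbitrary: d p rule: less_induct)
    case (less d p)
    define d' where "d' b j = d(j := d j - 1, b := Suc (d b))" for b j
    \<comment> \<open>If \<open>d j = 0\<close>, nothing can be moved out of column \<open>j\<close>, and truncated subtraction would give a wrong weight \<open>d' b j\<close>.\<close>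
    define I where "I = {(b, j). b < j \<and> j < n \<and> d j \<noteq> 0}"
    define B where "B = (\<Union>z\<in>I. (\<lambda>a. polar m pd (snd z) (fst z) (single a 1)) `
      weight_mons (d' (fst z) (snd z)))"
    have "finite I"
      by (rule finite_subset[of _ "{..<n} \<times> {..<n}"]) (auto simp: I_def)
    then have "finite B"
      unfolding B_def using finite_weight_mons by (auto intro!: finite_UN_I)
    have IH: "P u" if "u \<in> weight (d' b j)" "(b, j) \<in> I" for b j u
    proof (rule less.hyps[OF _ that(1)])
      have bj: "b < j" "j < n" "d j \<noteq> 0"
        using that by (auto simp: I_def)
      have "(\<Sum>i<n. i * d' b j i) + j = (\<Sum>i<n. i * d' b j i + (if i = j then j else 0))"
        using bj by (simp add: sum.distrib)
      also have "\<dots> = (\<Sum>i<n. i * d i + (if i = b then b else 0))"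
        using bj by (intro sum.cong) (auto simp: d'_def algebra_simps)
      also have "\<dots> = (\<Sum>i<n. i * d i) + b"
        using bj by (simp add: sum.distrib)
      finally show "(\<Sum>i<n. i * d' b j i) < (\<Sum>i<n. i * d i)"
        using bj by simp
    qed
    have B: "x \<in> weight d \<and> P x" if xB: "x \<in> B" for x
    proof -
      obtain z a where "z \<in> I" "a \<in> weight_mons (d' (fst z) (snd z))"
        "x = polar m pd (snd z) (fst z) (single a 1)"
        using xB unfolding B_def by blast
      then obtain b j where x: "(b, j) \<in> I" "a \<in> weight_mons (d' b j)" "x = polar m pd j b (single a 1)"
        by (cases z) simp
      then have bj: "b < j" "j < n" "d j \<noteq> 0"
        by (auto simp: I_def)
      have s: "single a 1 \<in> weight (d' b j)"
        using x by (intro weight_single)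
      have "(d' b j)(j := Suc (d' b j j), b := d' b j b - 1) = d"
        using bj by (auto simp: d'_def)
      then have "x \<in> weight d"
        using polar_weight(1)[OF s, of j b] bj by (simp add: x)
      moreover have "P x"
        unfolding x(3) using bj x(1) s by (intro lower IH[OF s] weight_polys[OF s]) auto
      ultimately show ?thesis ..
    qed
    obtain u w where uw: "u \<in> cspan B" "p = u + w" "\<forall>b\<in>B. fischer b w = 0"
      using orthogonal_projection[OF \<open>finite B\<close>] by blast
    have u: "u \<in> weight d"
      using cspan_weight[OF uw(1)] B by blast
    have Pu: "P u \<and> u \<in> weight d"
      using uw(1) by (induction rule: cspan.induct)
        (use B P0 in \<open>auto intro!: add scale weight_add weight_Cst weight_polys\<close>)
    have w: "w \<in> weight d"
    proof -
      have "w = p + Cst (- 1) * u"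
        by (simp add: uw(2) Cst_simps)
      then show ?thesis
        using less.prems u by (simp add: weight_add weight_Cst)
    qed
    have "polar m pd b j w = 0" if bj: "b < j" "j < n" for b j
    proof (cases "d j = 0")
      case True
      then show ?thesis
        using polar_weight(2)[OF w, of b j] bj by auto
    next
      case False
      then have I: "(b, j) \<in> I"
        using bj by (simp add: I_def)
      have "polar m pd b j w \<in> weight (d' b j)"
        using polar_weight(1)[OF w, of b j] bj by (simp add: d'_def fun_upd_twist)
      moreover have "fischer (single a 1) (polar m pd b j w) = 0" if "a \<in> weight_mons (d' b j)" for a
      proof -
        have "polar m pd j b (single a 1) \<in> B"
          unfolding B_def by (rule UN_I[OF I], rule image_eqI[of _ _ a]) (simp_all add: that)
        then show ?thesis
          using uw(3) by (simp flip: fischer_polar)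
      qed
      ultimately show ?thesis
        by (rule fischer_weight_orthogonal)
    qed
    then have "P w"
      using hw[OF w] by blast
    then show ?case
      unfolding uw(2) using Pu w by (intro add) (auto intro: weight_polys)
  qed
  then have single: "P (single a c)" if "keys a \<subseteq> V" for a c
    using that weight_single[of a "\<lambda>j. \<Sum>k<m. lookup a (k, j)" c]
    by (auto simp: weight_mons_def)
  show ?thesis
    using p by (rule polys_single_induct) (auto intro: single add)
qed

end

section \<open>A relation from the Capelli identity\<close>

lemma xops_comp: "S \<in> xops V g \<Longrightarrow> T \<in> xops V g \<Longrightarrow> (\<lambda>u. S (T u)) \<in> xops V g"
  by (induction rule: xops.induct) (auto intro: xops.intros)

lemma connection_nabla: "connection (nabla g)"
  by (simp add: connection_def nabla_add nabla_mult)

context generic_mat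
begin

definition yv :: "nat \<Rightarrow> var" where "yv j = (m, j)"

sublocale tw: twisted V yv
  by unfold_locales (auto simp: yv_def inj_def)

definition row_list :: "nat list list" where
  "row_list = List.n_lists n [0..<m]"

definition gens :: "spoly list" where
  "gens = map minor row_list"

text \<open>
  The polynomial of the theorem; by \<open>target_eq\<close> it equals $\prod_{j<n} (s + m - j)$ if $n \leq m$.
\<close>

definition target :: "complex poly" where
  "target = (\<Prod>i = m - n + 1..m. [:of_nat i, 1:])"

lemma set_row_list: "set row_list = rows m n"
  by (auto simp: row_list_def set_n_lists rows_def)

lemma row_list_nth: "i < length gens \<Longrightarrow> row_list ! i \<in> rows m n"
  using nth_mem[of i row_list] by (simp add: gens_def set_row_list)

lemma gens_nth: "i < length gens \<Longrightarrow> gens ! i = minor (row_list ! i)"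
  by (simp add: gens_def)

lemma gens_polys: "set gens \<subseteq> polys V"
  by (auto simp: gens_def set_row_list minor_V)

lemma sum_gens: "(\<Sum>i<length gens. h (row_list ! i)) = (\<Sum>ks\<in>rows m n. h ks)"
proof -
  have "bij_betw ((!) row_list) {..<length gens} (rows m n)"
    by (rule bij_betw_nth) (auto simp: row_list_def distinct_n_lists gens_def set_row_list[unfolded row_list_def])
  then show ?thesis by (rule sum.reindex_bij_betw)
qed

lemma target_eq:
  assumes "n \<le> m"
  shows "target = (\<Prod>j<n. [:of_nat m - of_nat j, 1:])"
  unfolding target_def
  by (rule prod.reindex_bij_witness[of _ "\<lambda>j. m - j" "\<lambda>i. m - i"])
     (use assms in \<open>auto simp: of_nat_diff\<close>)

lemma nabla_1: "nabla g v 1 = pd v g"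
  by (simp add: nabla_def pd_one)

lemma polar_gen:
  assumes "i < n" "j < n"
  shows "polar m pd i j (tw.gen gens) = (if i = j then tw.gen gens else 0)"
proof -
  have "polar m pd i j (Var (yv l)) = 0" for l
    using assms by (simp add: polar_def pd_Var yv_def)
  moreover have "polar m pd i j (gens ! l) = (if i = j then gens ! l else 0)" if "l < length gens" for l
    using row_list_nth[OF that] assms by (simp add: gens_nth[OF that] polar_minor rows_def)
  ultimately show ?thesis
    unfolding tw.gen_def derivation_sum[OF derivation_polar]
    by (auto simp: derivation_mult[OF derivation_polar] intro!: sum.cong sum.neutral)
qed

lemma euler_1: "tw.euler gens 1 = tw.gen gens"
  unfolding tw.euler_def tw.gen_def nabla_1
  by (intro sum.cong) (auto simp: tw.pd_y_gen[OF gens_polys, unfolded tw.gen_def])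

lemma capelli_nabla:
  assumes "j \<le> n"
  shows "capelli m (nabla (tw.gen gens)) j 1 =
    op_poly (tw.euler gens) (\<Prod>i<j. [:of_nat m - of_nat i, 1:]) 1"
  using assms
proof (induction j)
  case 0
  have "op_poly (tw.euler gens) [:1:] 1 = 1"
    by (simp add: op_poly_pCons tw.euler_linear linear_op_0 Cst_simps)
  then show ?case
    by (simp add: capelli_0 flip: one_pCons)
next
  case (Suc j)
  let ?q = "\<Prod>i<j. [:of_nat m - of_nat i, 1:] :: complex poly"
  have "capelli m (nabla (tw.gen gens)) (Suc j) 1 =
      tw.euler gens (capelli m (nabla (tw.gen gens)) j 1) +
      (of_nat m - of_nat j) * capelli m (nabla (tw.gen gens)) j 1"
  proof (rule capelli_Suc[OF connection_nabla])
    show "j < n" using Suc.prems by simp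
    have "polar m (nabla (tw.gen gens)) b j 1 = polar m pd b j (tw.gen gens)" for b
      by (simp add: polar_def nabla_1)
    then show "polar m (nabla (tw.gen gens)) b j 1 = 0" if "b < j" for b
      using that Suc.prems by (simp add: polar_gen)
    show "polar m (nabla (tw.gen gens)) j j 1 = tw.euler gens 1"
      using \<open>\<And>b. polar m (nabla (tw.gen gens)) b j 1 = polar m pd b j (tw.gen gens)\<close> Suc.prems
      by (simp add: polar_gen euler_1)
    show "tw.euler gens (u + w) = tw.euler gens u + tw.euler gens w" for u w
      using tw.euler_linear by (simp add: linear_op_def)
    show "tw.euler gens (p * u) = p * tw.euler gens u" if "p \<in> polys ({..<m} \<times> {..<n})" for p u
      using that by (simp add: tw.euler_mult V_def)
    show "tw.euler gens (nabla (tw.gen gens) v u) = nabla (tw.gen gens) v (tw.euler gens u)"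
      if "v \<in> {..<m} \<times> {..<n}" for v u
      using that by (simp add: tw.euler_nabla V_def)
  qed
  also have "\<dots> = op_poly (tw.euler gens) ([:of_nat m - of_nat j, 1:] * ?q) 1"
    using Suc by (simp add: op_poly_linear_factor[OF tw.euler_linear] Cst_simps Cst_of_nat del: mult_pCons_left)
  finally show ?case
    by (simp add: mult.commute del: mult_pCons_left mult_pCons_right)
qed

text \<open>
  Each summand of the Capelli operator applied to $e^g$ is a word of derivatives applied to one
  generator times $e^g$, so it lies in $V^1$.
\<close>

theorem target_in_filt:
  assumes "n \<le> m"
  shows "op_poly (tw.euler gens) target 1 \<in> tw.filt gens 1"
proof -
  let ?g = "tw.gen gens"
  have diag: "diag_op (nabla ?g) ks \<in> xops V ?g" if "set ks \<subseteq> {..<m}" "length ks \<le> n" for ks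
    using that
  proof (induction ks rule: rev_induct)
    case Nil
    have "diag_op (nabla ?g) [] = (\<lambda>u. u)"
      by (simp add: fun_eq_iff)
    then show ?case by (simp add: xops.ident)
  next
    case (snoc k ks)
    have "diag_op (nabla ?g) (ks @ [k]) = (\<lambda>u. diag_op (nabla ?g) ks (nabla ?g (k, length ks) u))"
      by (simp add: fun_eq_iff diag_op_snoc)
    moreover have "(\<lambda>u. nabla ?g (k, length ks) u) \<in> xops V ?g"
      using snoc.prems by (intro xops.nab xops.ident) auto
    ultimately show ?case
      using snoc xops_comp[of "diag_op (nabla ?g) ks" V ?g "nabla ?g (k, length ks)"] by simp
  qed
  have "diag_op (nabla ?g) ks (minor ks * 1) \<in> tw.filt gens 1" if ks: "ks \<in> rows m n" for ks
  proof -
    obtain i where i: "i < length gens" "row_list ! i = ks"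
      using ks unfolding set_row_list[symmetric] in_set_conv_nth by (auto simp: gens_def)
    have "(\<Prod>j\<leftarrow>[]. Var (yv j)) * diag_op (nabla ?g) ks (\<Prod>i\<leftarrow>[i]. gens ! i) \<in> tw.filt gens 1"
      using ks i(1) by (intro tw.filt.base diag) (auto simp: rows_def)
    then show ?thesis
      using i by (simp add: gens_nth)
  qed
  then have "capelli m (nabla ?g) n 1 \<in> tw.filt gens 1"
    unfolding capelli_def by (intro tw.filt_sum)
  then show ?thesis
    using capelli_nabla[of n] by (simp add: target_eq[OF assms])
qed

section \<open>Minimality\<close>

subsection \<open>Divisibility of the values of the functional\<close>

text \<open>
  Since $c_N \prod_{i=m-n+1}^m (N + i) = c_{N+1}$ for $c_N$ = \<open>gram_const N\<close>, this says that the
  value is $c_{N+1}$ times a polynomial in $N = M + d$. The shift by \<open>d\<close> comes from the degree in \<open>y\<close>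
  of the element of $V^1$ under consideration.
\<close>

definition divisible_growth :: "nat \<Rightarrow> (nat \<Rightarrow> complex) \<Rightarrow> bool" where
  "divisible_growth d \<phi> \<longleftrightarrow> (\<exists>\<rho>. \<forall>M. \<phi> M =
     gram_const (M + d) * poly target (of_nat (M + d)) * poly \<rho> (of_nat (M + d)))"

lemma divisible_growth_add: "divisible_growth d \<phi> \<Longrightarrow> divisible_growth d \<psi> \<Longrightarrow> divisible_growth d (\<lambda>M. \<phi> M + \<psi> M)"
proof -
  assume "divisible_growth d \<phi>" "divisible_growth d \<psi>"
  then obtain \<rho> \<rho>' where "\<forall>M. \<phi> M = gram_const (M + d) * poly target (of_nat (M + d)) * poly \<rho> (of_nat (M + d))"
    "\<forall>M. \<psi> M = gram_const (M + d) * poly target (of_nat (M + d)) * poly \<rho>' (of_nat (M + d))"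
    unfolding divisible_growth_def by blast
  then show ?thesis
    unfolding divisible_growth_def by (intro exI[of _ "\<rho> + \<rho>'"]) (simp add: distrib_left)
qed

lemma divisible_growth_scale: "divisible_growth d \<phi> \<Longrightarrow> divisible_growth d (\<lambda>M. c * \<phi> M)"
proof -
  assume "divisible_growth d \<phi>"
  then obtain \<rho> where "\<forall>M. \<phi> M = gram_const (M + d) * poly target (of_nat (M + d)) * poly \<rho> (of_nat (M + d))"
    unfolding divisible_growth_def by blast
  then show ?thesis
    unfolding divisible_growth_def by (intro exI[of _ "smult c \<rho>"]) (simp add: mult_ac)
qed

text \<open>
  Both sides are products of consecutive integers. The one on the left ends at $M + d + \mu + A$ and the
  one on the right at $M + d + A$, so their quotient is a polynomial in $M + d$ of degree $\mu$.
\<close>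

lemma ratio_poly:
  fixes A d \<mu> :: nat
  assumes "A > 0"
  shows "\<exists>\<rho> :: complex poly. \<forall>M. (\<Prod>t<M. of_nat (\<mu> + d + 1 + t + A)) =
    (\<Prod>t<M + d. of_nat (t + A)) * of_nat (M + d + A) * poly \<rho> (of_nat (M + d))"
proof (induction \<mu>)
  case 0
  define C where "C = (\<Prod>t<Suc d. of_nat (t + A) :: complex)"
  have C: "C \<noteq> 0"
    unfolding C_def using assms by (auto simp del: of_nat_add)
  have "C * (\<Prod>t<M. of_nat (d + 1 + t + A)) = (\<Prod>t<Suc (M + d). of_nat (t + A))" for M
  proof (induction M)
    case (Suc M)
    have "(\<Prod>t<Suc (Suc M + d). of_nat (t + A) :: complex) = (\<Prod>t<Suc (M + d). of_nat (t + A)) * of_nat (d + 1 + M + A)"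
      by (simp add: add_ac)
    then show ?case
      using Suc.IH by (simp only: prod.lessThan_Suc[of _ M] mult.assoc[symmetric])
  qed (simp add: C_def)
  then have "(\<Prod>t<M. of_nat (0 + d + 1 + t + A)) =
      (\<Prod>t<M + d. of_nat (t + A)) * of_nat (M + d + A) * poly [:1 / C:] (of_nat (M + d))" for M
    using C by (simp add: field_simps del: of_nat_add of_nat_Suc)
  then show ?case by blast
next
  case (Suc \<mu>)
  then obtain \<rho> where \<rho>: "\<And>M. (\<Prod>t<M. of_nat (\<mu> + d + 1 + t + A)) =
    (\<Prod>t<M + d. of_nat (t + A)) * of_nat (M + d + A) * poly \<rho> (of_nat (M + d) :: complex)" by blast
  have tele: "of_nat (\<mu> + d + 1 + A) * (\<Prod>t<M. of_nat (Suc \<mu> + d + 1 + t + A) :: complex) =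
     (\<Prod>t<M. of_nat (\<mu> + d + 1 + t + A)) * of_nat (\<mu> + d + 1 + M + A)" for M
  proof (induction M)
    case (Suc M)
    have "of_nat (\<mu> + d + 1 + A) * (\<Prod>t<Suc M. of_nat (Suc \<mu> + d + 1 + t + A) :: complex) =
       (of_nat (\<mu> + d + 1 + A) * (\<Prod>t<M. of_nat (Suc \<mu> + d + 1 + t + A))) * of_nat (\<mu> + d + 1 + Suc M + A)"
      by (simp add: add_ac mult_ac)
    then show ?case
      unfolding Suc.IH by simp
  qed simp
  have nz: "(of_nat (\<mu> + d + 1 + A) :: complex) \<noteq> 0"
    by (simp del: of_nat_add of_nat_Suc)
  let ?\<rho> = "smult (1 / of_nat (\<mu> + d + 1 + A)) (\<rho> * [:of_nat (\<mu> + 1 + A), 1:])"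
  have "(\<Prod>t<M. of_nat (Suc \<mu> + d + 1 + t + A)) =
      (\<Prod>t<M + d. of_nat (t + A)) * of_nat (M + d + A) * poly ?\<rho> (of_nat (M + d))" for M
  proof -
    have "poly ?\<rho> (of_nat (M + d)) = 1 / of_nat (\<mu> + d + 1 + A) * (poly \<rho> (of_nat (M + d)) * of_nat (\<mu> + d + 1 + M + A))"
      by (simp add: algebra_simps)
    moreover have "(\<Prod>t<M. of_nat (Suc \<mu> + d + 1 + t + A) :: complex) =
       (\<Prod>t<M. of_nat (\<mu> + d + 1 + t + A)) * of_nat (\<mu> + d + 1 + M + A) / of_nat (\<mu> + d + 1 + A)"
      using tele[of M] nz by (simp only: nonzero_eq_divide_eq[OF nz] mult.commute)
    ultimately show ?thesis
      unfolding \<rho> by (simp only: mult_ac times_divide_eq_right times_divide_eq_left mult_1_left)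
  qed
  then show ?case by blast
qed

lemma divisible_growth_ratio:
  assumes "n \<le> m"
  shows "divisible_growth d (\<lambda>M. \<Prod>t<M. \<Prod>j<n. of_nat (\<mu> j) + of_nat (Suc d) + of_nat t + of_nat m - of_nat j)"
proof -
  have "\<exists>\<rho> :: complex poly. \<forall>M. (\<Prod>t<M. of_nat (\<mu> j + d + 1 + t + (m - j))) =
    (\<Prod>t<M + d. of_nat (t + (m - j))) * of_nat (M + d + (m - j)) * poly \<rho> (of_nat (M + d))" if "j < n" for j
    by (rule ratio_poly) (use that assms in simp)
  then obtain \<rho> :: "nat \<Rightarrow> complex poly" where \<rho>: "\<And>j M. j < n \<Longrightarrow> (\<Prod>t<M. of_nat (\<mu> j + d + 1 + t + (m - j))) =
    (\<Prod>t<M + d. of_nat (t + (m - j))) * of_nat (M + d + (m - j)) * poly (\<rho> j) (of_nat (M + d))"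
    by metis
  have diff: "x + of_nat m - of_nat j = x + of_nat (m - j)" if "j < n" for x :: complex and j
    using that assms by (simp add: of_nat_diff)
  have "(\<Prod>t<M. \<Prod>j<n. of_nat (\<mu> j) + of_nat (Suc d) + of_nat t + of_nat m - of_nat j) =
     gram_const (M + d) * poly target (of_nat (M + d)) * poly (\<Prod>j<n. \<rho> j) (of_nat (M + d))" for M
  proof -
    have "(\<Prod>t<M. \<Prod>j<n. of_nat (\<mu> j) + of_nat (Suc d) + of_nat t + of_nat m - of_nat j :: complex) =
       (\<Prod>j<n. \<Prod>t<M. of_nat (\<mu> j + d + 1 + t + (m - j)))"
      by (subst prod.swap, intro prod.cong refl) (simp add: diff)
    also have "\<dots> = (\<Prod>j<n. (\<Prod>t<M + d. of_nat (t + (m - j))) * of_nat (M + d + (m - j)) * poly (\<rho> j) (of_nat (M + d)))"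
      by (intro prod.cong refl) (simp only: \<rho> lessThan_iff)
    also have "\<dots> = (\<Prod>j<n. \<Prod>t<M + d. of_nat (t + (m - j))) * (\<Prod>j<n. of_nat (M + d + (m - j))) *
        poly (\<Prod>j<n. \<rho> j) (of_nat (M + d))"
      by (simp only: prod.distrib poly_prod)
    also have "(\<Prod>j<n. \<Prod>t<M + d. of_nat (t + (m - j))) = gram_const (M + d)"
      unfolding gram_const_def
      by (subst prod.swap, intro prod.cong refl) (simp add: diff)
    also have "(\<Prod>j<n. of_nat (M + d + (m - j))) = poly target (of_nat (M + d) :: complex)"
    proof -
      have "poly target x = (\<Prod>j<n. of_nat m - of_nat j + x)" for x
        by (simp add: target_eq[OF assms] poly_prod)
      also have "(\<Prod>j<n. of_nat m - of_nat j + x) = (\<Prod>j<n. x + of_nat (m - j))" for x :: complex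
        using assms by (intro prod.cong refl) (simp add: of_nat_diff)
      finally show ?thesis by simp
    qed
    finally show ?thesis .
  qed
  then show ?thesis
    unfolding divisible_growth_def by blast
qed

text \<open>
  For highest weight vectors this is the explicit evaluation \<open>L_gram_power\<close>. A polarization of \<open>p\<close> is
  moved to \<open>r\<close>, which is why \<open>r\<close> is arbitrary in the induction.
\<close>

lemma divisible_growth_V:
  assumes "n \<le> m" and F: "semi (Suc d) F" "F \<in> polys V" and "p \<in> polys V" "r \<in> polys X"
  shows "divisible_growth d (\<lambda>M. L (p * r * F * gram ^ M))"
  using assms(4,5)
proof (induction arbitrary: r rule: highest_weight_induct)
  case (hw v \<mu>)
  have "semi (Suc d) (r * F)"
    using semi_mult[OF semi_X[OF hw(3)] F(1)] by simp
  then have "L (v * (r * F) * gram ^ M) =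
      (\<Prod>t<M. \<Prod>j<n. of_nat (\<mu> j) + of_nat (Suc d) + of_nat t + of_nat m - of_nat j) * L (v * (r * F))" for M
    using hw(1,2) by (intro L_gram_power polar_diag) auto
  then show ?case
    using divisible_growth_scale[OF divisible_growth_ratio[OF assms(1), of d \<mu>], of "L (v * (r * F))"]
    by (simp add: mult_ac)
next
  case (add u w)
  then show ?case
    using divisible_growth_add[OF add.IH(1)[of r] add.IH(2)[of r]] by (simp add: distrib_right L_add)
next
  case (scale c u)
  then show ?case
    using divisible_growth_scale[OF scale.IH[of r], of c] by (simp add: L_Cst mult.assoc)
next
  case (lower i j u)
  then show ?case
    using lower.IH[of "xpolar j i r"] by (simp add: L_polar_move[OF _ _ _ F] xpolar_polys_X)
qed

lemma divisible_growth_VX: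
  assumes "n \<le> m" and F: "semi (Suc d) F" "F \<in> polys V" and "q \<in> polys (V \<union> X)"
  shows "divisible_growth d (\<lambda>M. L (q * F * gram ^ M))"
proof -
  have "divisible_growth d (\<lambda>M. L (q * p * r * F * gram ^ M))" if "p \<in> polys V" "r \<in> polys X" for p r
    using assms(4) that
  proof (induction arbitrary: p r rule: polys_induct)
    case (const c)
    then show ?case
      by (intro divisible_growth_V[OF assms(1) F] polys_mult[OF polys_Cst])
  next
    case (var v q)
    show ?case
    proof (cases "v \<in> V")
      case True
      then have "Var v * p \<in> polys V"
        using var.prems by (intro polys_mult) auto
      then show ?thesis
        using var.IH[of "Var v * p" r] var.prems by (simp add: mult_ac)
    next
      case False
      then have "Var v * r \<in> polys X"
        using var.hyps var.prems by (intro polys_mult) auto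
      then show ?thesis
        using var.IH[of p "Var v * r"] var.prems by (simp add: mult_ac)
    qed
  next
    case (add q q')
    then show ?case
      using divisible_growth_add[OF add.IH(1)[of p r] add.IH(2)[of p r]] by (simp add: distrib_right L_add)
  qed
  from this[of 1 1] show ?thesis by simp
qed

subsection \<open>The generating series\<close>

text \<open>
  The substitution that turns the exponent \<open>g\<close> into $D$ times the power series variable. That variable
  records the degree in \<open>y\<close>, so \<open>series u\<close> is the image of $u\,e^g$ as a power series, and its \<open>N\<close>-th
  coefficient is the part of degree \<open>N\<close>.
\<close>

definition series_var :: "var \<Rightarrow> spoly fps" where
  "series_var w = (if w \<in> V then fps_const (Var w) else fps_X * fps_const (xmon (row_list ! snd w)))"

definition series_subst :: "spoly \<Rightarrow> spoly fps" where
  "series_subst = eval_hom (\<lambda>c. fps_const (Cst c)) series_var"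

definition gram_exp :: "spoly fps" where
  "gram_exp = Abs_fps (\<lambda>N. Cst (1 / fact N) * gram ^ N)"

definition series :: "spoly \<Rightarrow> spoly fps" where
  "series u = series_subst u * gram_exp"

definition fps_pd :: "var \<Rightarrow> spoly fps \<Rightarrow> spoly fps" where
  "fps_pd v A = Abs_fps (\<lambda>N. pd v (fps_nth A N))"

lemma fps_pd_nth [simp]: "fps_nth (fps_pd v A) N = pd v (fps_nth A N)"
  by (simp add: fps_pd_def)

lemma derivation_fps_pd: "derivation (fps_pd v)"
  by (auto simp: derivation_def fps_eq_iff pd_add fps_mult_nth pd_sum pd_mult sum.distrib)

lemma fps_pd_const: "fps_pd v (fps_const c) = fps_const (pd v c)"
  by (auto simp: fps_eq_iff pd_zero)

lemma fps_pd_X: "fps_pd v fps_X = 0"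
  by (auto simp: fps_eq_iff fps_X_def pd_zero pd_one)

lemma derivation_fps_deriv: "derivation (fps_deriv :: spoly fps \<Rightarrow> spoly fps)"
  by (simp add: derivation_def add.commute)

lemma ring_map_fps_Cst: "ring_map (\<lambda>c. fps_const (Cst c))"
  by (simp add: ring_map_def Cst_simps)

lemma ring_map_series_subst: "ring_map series_subst"
  unfolding series_subst_def by (rule ring_map_eval_hom[OF ring_map_fps_Cst])

lemma series_subst_V: "p \<in> polys V \<Longrightarrow> series_subst p = fps_const p"
  by (rule ring_map_polys_eqI[OF _ ring_map_series_subst])
     (auto simp: series_subst_def eval_hom_Cst eval_hom_Var ring_map_fps_Cst series_var_def ring_map_def)

lemma series_subst_y: "series_subst (Var (yv i)) = fps_X * fps_const (xmon (row_list ! i))"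
  using tw.y_notin[of i] by (simp add: series_subst_def eval_hom_Var ring_map_fps_Cst series_var_def yv_def)

lemma series_subst_gen: "series_subst (tw.gen gens) = fps_X * fps_const gram"
proof -
  have const_sum: "fps_const (sum f A) = (\<Sum>x\<in>A. fps_const (f x))" for f :: "nat \<Rightarrow> spoly" and A
    by (induction A rule: infinite_finite_induct) (auto simp flip: fps_const_add)
  have "gram = (\<Sum>i<length gens. xmon (row_list ! i) * gens ! i)"
    unfolding gram_def sum_gens[symmetric] by (intro sum.cong) (auto simp: gens_nth)
  moreover have "series_subst (tw.gen gens) = (\<Sum>i<length gens. fps_X * fps_const (xmon (row_list ! i) * gens ! i))"
    unfolding tw.gen_def ring_map_sum[OF ring_map_series_subst]
    by (intro sum.cong) (auto simp: ring_map_mult[OF ring_map_series_subst] series_subst_y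
        series_subst_V tw.nth_polys gens_polys mult.assoc simp flip: fps_const_mult)
  ultimately show ?thesis
    by (simp add: const_sum sum_distrib_left)
qed

lemma fps_pd_gram_exp: "fps_pd v gram_exp = fps_X * fps_const (pd v gram) * gram_exp"
proof (rule fps_ext)
  fix N
  show "fps_nth (fps_pd v gram_exp) N = fps_nth (fps_X * fps_const (pd v gram) * gram_exp) N"
  proof (cases N)
    case 0
    then show ?thesis by (simp add: gram_exp_def pd_mult pd_one mult.assoc)
  next
    case (Suc k)
    have "Cst (1 / fact (Suc k)) * of_nat (Suc k) = Cst (1 / fact k)"
      by (simp flip: Cst_of_nat Cst_simps(4) del: of_nat_Suc)
    then have "pd v (Cst (1 / fact (Suc k)) * gram ^ Suc k) = Cst (1 / fact k) * gram ^ k * pd v gram"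
      unfolding pd_mult derivation_power[OF derivation_pd] by (simp only: pd_Cst mult_zero_left add_0_left mult.assoc[symmetric])
    then show ?thesis
      using Suc by (simp add: gram_exp_def mult.assoc del: fact_Suc power_Suc)
  qed
qed

lemma fps_deriv_gram_exp: "fps_deriv gram_exp = fps_const gram * gram_exp"
proof (rule fps_ext)
  fix N
  have "of_nat (Suc N) * Cst (1 / fact (Suc N)) = Cst (1 / fact N)"
    by (simp flip: Cst_of_nat Cst_simps(4) del: of_nat_Suc)
  then have "of_nat (Suc N) * (Cst (1 / fact (Suc N)) * gram ^ Suc N) = gram * (Cst (1 / fact N) * gram ^ N)"
    by (simp only: mult.assoc[symmetric]) (simp add: mult_ac)
  then show "fps_nth (fps_deriv gram_exp) N = fps_nth (fps_const gram * gram_exp) N"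
    by (simp add: gram_exp_def del: of_nat_Suc fact_Suc power_Suc)
qed

lemma series_mult_V: "p \<in> polys V \<Longrightarrow> series (p * u) = fps_const p * series u"
  by (simp add: series_def ring_map_mult[OF ring_map_series_subst] series_subst_V mult.assoc)

lemma series_mult_y: "series (Var (yv i) * u) = fps_X * (fps_const (xmon (row_list ! i)) * series u)"
  by (simp add: series_def ring_map_mult[OF ring_map_series_subst] series_subst_y mult.assoc)

lemma series_add: "series (u + w) = series u + series w"
  by (simp add: series_def ring_map_add[OF ring_map_series_subst] distrib_right)

lemma series_0: "series 0 = 0"
  by (simp add: series_def ring_map_0[OF ring_map_series_subst])

lemma series_nabla:
  assumes u: "u \<in> polys (tw.VY (length gens))" and v: "v \<in> V"
  shows "series (nabla (tw.gen gens) v u) = fps_pd v (series u)"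
proof -
  have chain: "fps_pd v (series_subst p) = series_subst (pd v p)" if p: "p \<in> polys (tw.VY (length gens))" for p
  proof -
    have "fps_pd v (series_subst p) = (\<Sum>w\<in>tw.VY (length gens). fps_pd v (series_var w) * series_subst (pd w p))"
      unfolding series_subst_def
      by (rule chain_rule[OF p tw.finite_VY ring_map_fps_Cst derivation_fps_pd]) (simp add: fps_pd_const)
    also have "\<dots> = (\<Sum>w\<in>V. fps_pd v (series_var w) * series_subst (pd w p))"
    proof -
      have "fps_pd v (series_var (yv i)) = 0" if "i < length gens" for i
        using tw.y_notin[of i] row_list_nth[OF that] v
        by (simp add: series_var_def derivation_mult[OF derivation_fps_pd] fps_pd_X fps_pd_const)
           (simp add: yv_def pd_V_X xmon_X)
      then show ?thesis
        unfolding tw.sum_VY by simp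
    qed
    also have "\<dots> = (\<Sum>w\<in>V. if v = w then series_subst (pd v p) else 0)"
      by (intro sum.cong) (auto simp: series_var_def fps_pd_const pd_Var)
    finally show ?thesis using v by simp
  qed
  have "series_subst (pd v (tw.gen gens)) = fps_X * fps_const (pd v gram)"
    using chain[OF tw.gen_polys[OF gens_polys]]
    by (simp add: series_subst_gen derivation_mult[OF derivation_fps_pd] fps_pd_X fps_pd_const)
  then show ?thesis
    by (simp add: series_def nabla_def ring_map_add[OF ring_map_series_subst]
        ring_map_mult[OF ring_map_series_subst] derivation_mult[OF derivation_fps_pd]
        fps_pd_gram_exp chain[OF u] algebra_simps)
qed

lemma series_euler:
  assumes u: "u \<in> polys (tw.VY (length gens))"
  shows "series (tw.euler gens u) = fps_X * fps_deriv (series u)"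
proof -
  let ?\<eta> = "\<lambda>i. fps_const (xmon (row_list ! i))"
  have chain: "fps_deriv (series_subst p) = (\<Sum>i<length gens. ?\<eta> i * series_subst (pd (yv i) p))"
    if p: "p \<in> polys (tw.VY (length gens))" for p
  proof -
    have "fps_deriv (series_subst p) = (\<Sum>w\<in>tw.VY (length gens). fps_deriv (series_var w) * series_subst (pd w p))"
      unfolding series_subst_def
      by (rule chain_rule[OF p tw.finite_VY ring_map_fps_Cst derivation_fps_deriv]) simp
    also have "\<dots> = (\<Sum>i<length gens. fps_deriv (series_var (yv i)) * series_subst (pd (yv i) p))"
      unfolding tw.sum_VY by (simp add: series_var_def)
    also have "\<dots> = (\<Sum>i<length gens. ?\<eta> i * series_subst (pd (yv i) p))"
      using tw.y_notin by (intro sum.cong) (auto simp: series_var_def, auto simp: yv_def)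
    finally show ?thesis .
  qed
  have "fps_deriv (series_subst (tw.gen gens)) = fps_const gram"
    by (simp add: series_subst_gen)
  then have gram: "fps_const gram = (\<Sum>i<length gens. ?\<eta> i * series_subst (pd (yv i) (tw.gen gens)))"
    using chain[OF tw.gen_polys[OF gens_polys]] by simp
  have "series_subst (tw.euler gens u) = fps_X * (fps_deriv (series_subst u) + series_subst u * fps_const gram)"
    unfolding tw.euler_def chain[OF u] gram nabla_def
    by (simp add: ring_map_sum[OF ring_map_series_subst] ring_map_mult[OF ring_map_series_subst]
        ring_map_add[OF ring_map_series_subst] series_subst_y sum_distrib_left sum.distrib distrib_left mult_ac)
  then show ?thesis
    by (simp add: series_def fps_deriv_gram_exp algebra_simps)
qed

lemma series_op_poly:
  "fps_nth (series (op_poly (tw.euler gens) b 1)) N = Cst (poly b (of_nat N) / fact N) * gram ^ N"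
proof (induction b)
  case (pCons a b)
  let ?u = "op_poly (tw.euler gens) b 1"
  have "series (Cst a) = fps_const (Cst a) * gram_exp"
    by (simp add: series_def series_subst_V)
  moreover have "fps_nth (series (tw.euler gens ?u)) N = of_nat N * fps_nth (series ?u) N"
    unfolding series_euler[OF tw.op_poly_euler_polys[OF gens_polys polys_1]]
    by (cases N) (auto simp: algebra_simps)
  ultimately have "fps_nth (series (op_poly (tw.euler gens) (pCons a b) 1)) N =
     (Cst a * Cst (1 / fact N) + of_nat N * Cst (poly b (of_nat N) / fact N)) * gram ^ N"
    using pCons by (simp add: op_poly_pCons tw.euler_linear series_add gram_exp_def algebra_simps)
  also have "Cst a * Cst (1 / fact N) + of_nat N * Cst (poly b (of_nat N) / fact N) =
      Cst (poly (pCons a b) (of_nat N) / fact N)"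
    by (simp add: add_divide_distrib flip: Cst_of_nat Cst_simps(3,4))
  finally show ?case .
qed (simp add: series_0 Cst_simps)

text \<open>
  The operator is moved to the other side of the pairing; what matters is that \<open>q'\<close> does not depend on
  \<open>N\<close>.
\<close>

lemma series_xops:
  assumes "T \<in> xops V (tw.gen gens)"
  shows "q \<in> polys (V \<union> X) \<Longrightarrow> \<exists>q'\<in>polys (V \<union> X). \<forall>F\<in>polys V. \<forall>N.
    L (q * fps_nth (series (T F)) N) = L (q' * fps_nth (series F) N)"
  using assms
proof (induction arbitrary: q rule: xops.induct)
  case ident
  then show ?case by blast
next
  case (mul p T)
  have "q * p \<in> polys (V \<union> X)"
    using mul by (auto intro: polys_mono[of V])
  then obtain q' where q': "q' \<in> polys (V \<union> X)"
    "\<forall>F\<in>polys V. \<forall>N. L (q * p * fps_nth (series (T F)) N) = L (q' * fps_nth (series F) N)"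
    using mul.IH by blast
  then show ?case
    using mul.hyps by (intro bexI[of _ q']) (auto simp: series_mult_V mult.assoc)
next
  case (nab v T)
  have "Var (xi v) * q - pd v q \<in> polys (V \<union> X)"
    using nab by (intro polys_diff polys_mult pd_polys) auto
  then obtain q' where q': "q' \<in> polys (V \<union> X)"
    "\<forall>F\<in>polys V. \<forall>N. L ((Var (xi v) * q - pd v q) * fps_nth (series (T F)) N) = L (q' * fps_nth (series F) N)"
    using nab.IH by blast
  have "L (q * fps_nth (series (nabla (tw.gen gens) v (T F))) N) = L (q' * fps_nth (series F) N)"
    if F: "F \<in> polys V" for F N
  proof -
    let ?A = "fps_nth (series (T F)) N"
    have "T F \<in> polys (tw.VY (length gens))"
      using tw.polys_V_VY[OF F] by (rule xops_polys[OF nab(2) tw.V_VY tw.gen_polys[OF gens_polys]])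
    then have "L (q * fps_nth (series (nabla (tw.gen gens) v (T F))) N) = L (q * pd v ?A)"
      using nab(1) by (simp add: series_nabla)
    also have "\<dots> = L (pd v (q * ?A)) - L (pd v q * ?A)"
      by (simp add: pd_mult L_add)
    also have "\<dots> = L ((Var (xi v) * q - pd v q) * ?A)"
      unfolding L_pd[OF nab(1)] by (simp add: left_diff_distrib L_diff mult.assoc)
    finally show ?thesis using q'(2) F by simp
  qed
  then show ?case using q'(1) by blast
qed

lemma fact_descending: "fact (M + d) = fact M * (\<Prod>i<d. of_nat (M + d - i) :: complex)"
proof (induction d)
  case (Suc d)
  have "(\<Prod>i<Suc d. of_nat (M + Suc d - i) :: complex) = of_nat (M + Suc d) * (\<Prod>i<d. of_nat (M + d - i))"
    by (subst prod.lessThan_Suc_shift) simp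
  then show ?case
    using Suc by (simp add: mult_ac)
qed simp

lemma series_filt:
  assumes "n \<le> m" "u \<in> tw.filt gens 1"
  shows "\<exists>\<rho> N0. \<forall>N\<ge>N0. fact N * L (fps_nth (series u) N) =
    gram_const N * poly target (of_nat N) * poly \<rho> (of_nat N)"
  using assms(2)
proof (induction rule: tw.filt.induct)
  case zero
  then show ?case
    by (intro exI[of _ 0]) (simp add: series_0 L_0)
next
  case (add u w)
  then obtain \<rho> N0 \<rho>' N0' where
    "\<forall>N\<ge>N0. fact N * L (fps_nth (series u) N) = gram_const N * poly target (of_nat N) * poly \<rho> (of_nat N)"
    "\<forall>N\<ge>N0'. fact N * L (fps_nth (series w) N) = gram_const N * poly target (of_nat N) * poly \<rho>' (of_nat N)"
    by blast
  then show ?case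
    by (intro exI[of _ "\<rho> + \<rho>'"] exI[of _ "max N0 N0'"]) (simp add: series_add L_add distrib_left)
next
  case (base T js "is")
  define d where "d = length js"
  define \<eta> where "\<eta> = (\<Prod>j\<leftarrow>js. xmon (row_list ! j))"
  define F where "F = (\<Prod>i\<leftarrow>is. gens ! i)"
  have \<eta>: "\<eta> \<in> polys (V \<union> X)"
    unfolding \<eta>_def
  proof (intro polys_prod_list)
    fix p assume "p \<in> set (map (\<lambda>j. xmon (row_list ! j)) js)"
    then obtain j where "p = xmon (row_list ! j)" "j < length gens"
      using base by auto
    then show "p \<in> polys (V \<union> X)"
      using xmon_X[OF row_list_nth] polys_mono[of X "V \<union> X"] by blast
  qed
  have F: "F \<in> polys V"
    unfolding F_def using base gens_polys by (intro tw.prod_fs_polys)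
  have semi: "semi (Suc d) F"
  proof -
    have "semi 1 x" if "x \<in> set (map ((!) gens) is)" for x
    proof -
      obtain i where "i < length gens" "x = gens ! i"
        using \<open>x \<in> set (map ((!) gens) is)\<close> base by auto
      then show ?thesis by (simp only: gens_nth semi_minor[OF row_list_nth])
    qed
    then have "semi (length (map ((!) gens) is)) F"
      unfolding F_def by (rule semi_prod_list)
    then show ?thesis using base by (simp add: d_def)
  qed
  obtain q where q: "q \<in> polys (V \<union> X)"
    "\<forall>F\<in>polys V. \<forall>N. L (\<eta> * fps_nth (series (T F)) N) = L (q * fps_nth (series F) N)"
    using series_xops[OF base(1) \<eta>] by blast
  obtain \<rho> where \<rho>: "\<And>M. L (q * F * gram ^ M) =
     gram_const (M + d) * poly target (of_nat (M + d)) * poly \<rho> (of_nat (M + d))"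
    using divisible_growth_VX[OF assms(1) semi F q(1)] unfolding divisible_growth_def by blast
  have "series ((\<Prod>j\<leftarrow>js. Var (yv j)) * T F) = fps_X ^ d * (fps_const \<eta> * series (T F))"
    unfolding \<eta>_def d_def
    by (induction js) (simp_all add: series_mult_y mult.assoc mult.left_commute flip: fps_const_mult)
  then have nth: "fps_nth (series ((\<Prod>j\<leftarrow>js. Var (yv j)) * T F)) (M + d) = \<eta> * fps_nth (series (T F)) M" for M
    by (simp add: fps_X_power_mult_nth)
  have val: "L (fps_nth (series ((\<Prod>j\<leftarrow>js. Var (yv j)) * T F)) (M + d)) = 1 / fact M * L (q * F * gram ^ M)" for M
  proof -
    have "fps_nth (series F) M = Cst (1 / fact M) * (F * gram ^ M)"
      using F by (simp add: series_def series_subst_V gram_exp_def mult_ac)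
    then have "L (\<eta> * fps_nth (series (T F)) M) = L (Cst (1 / fact M) * (q * F * gram ^ M))"
      using q(2) F by (simp add: mult_ac)
    then show ?thesis
      unfolding nth by (simp only: L_Cst)
  qed
  \<comment> \<open>The quotient of \<open>fact N\<close> by \<open>fact (N - d)\<close> as a polynomial in \<open>N\<close>.\<close>
  define \<beta> :: "complex poly" where "\<beta> = (\<Prod>i<d. [:- of_nat i, 1:])"
  have \<beta>: "fact (M + d) = fact M * poly \<beta> (of_nat (M + d))" for M
  proof -
    have "poly \<beta> (of_nat (M + d)) = (\<Prod>i<d. of_nat (M + d) - of_nat i :: complex)"
      by (simp add: \<beta>_def poly_prod)
    also have "\<dots> = (\<Prod>i<d. of_nat (M + d - i))"
      by (intro prod.cong) (auto simp: of_nat_diff)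
    finally show ?thesis
      by (simp add: fact_descending)
  qed
  have "fact N * L (fps_nth (series ((\<Prod>j\<leftarrow>js. Var (yv j)) * T F)) N) =
      gram_const N * poly target (of_nat N) * poly (\<beta> * \<rho>) (of_nat N)" if "N \<ge> d" for N
  proof -
    define M where "M = N - d"
    have N: "N = M + d"
      using that by (simp add: M_def)
    show ?thesis
      unfolding N val \<rho> by (simp add: \<beta> del: of_nat_add)
  qed
  then show ?case
    unfolding F_def by blast
qed

text \<open>
  Comparison of the two evaluations shows that \<open>b\<close> and a multiple of \<open>target\<close> agree at all large
  integers.
\<close>

theorem degree_bound:
  assumes "n \<le> m" "op_poly (tw.euler gens) b 1 \<in> tw.filt gens 1" "b \<noteq> 0"
  shows "degree target \<le> degree b"
proof -
  obtain \<rho> N0 where \<rho>: "\<And>N. N \<ge> N0 \<Longrightarrow> fact N * L (fps_nth (series (op_poly (tw.euler gens) b 1)) N) =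
    gram_const N * poly target (of_nat N) * poly \<rho> (of_nat N)"
    using series_filt[OF assms(1,2)] by blast
  have root: "poly (b - target * \<rho>) (of_nat N) = 0" if "N \<ge> N0" for N
  proof -
    have "gram_const N * poly b (of_nat N) = gram_const N * (poly target (of_nat N) * poly \<rho> (of_nat N))"
      using \<rho>[OF that] unfolding series_op_poly L_Cst L_gram_power_1 by (simp add: mult_ac)
    then show ?thesis
      using gram_const_nonzero[OF assms(1), of N] by simp
  qed
  have "b - target * \<rho> = 0"
  proof (rule ccontr)
    assume "b - target * \<rho> \<noteq> 0"
    then have "finite {x. poly (b - target * \<rho>) x = 0}"
      by (rule poly_roots_finite)
    moreover have "(of_nat :: nat \<Rightarrow> complex) ` {N0..} \<subseteq> {x. poly (b - target * \<rho>) x = 0}"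
      using root by auto
    ultimately have "finite ((of_nat :: nat \<Rightarrow> complex) ` {N0..})"
      by (rule finite_subset[rotated])
    then show False
      using infinite_Ici[of N0] by (subst (asm) finite_image_iff) (auto intro: inj_onI)
  qed
  then have "b = target * \<rho>" by simp
  then show ?thesis
    using assms(3) by (auto simp: degree_mult_eq)
qed

end

section \<open>The ideal of maximal minors\<close>

lemma ideal_gen_mult:
  assumes "a \<in> A" "c \<in> polys V"
  shows "c * a \<in> ideal_gen V A"
  unfolding ideal_gen_def using assms by (intro CollectI exI[of _ "{a}"] exI[of _ "\<lambda>_. c"]) auto

lemma ideal_gen_mono: "A \<subseteq> B \<Longrightarrow> ideal_gen V A \<subseteq> ideal_gen V B"
  unfolding ideal_gen_def by blast

text \<open>
  The combination in \<open>ideal_gen\<close> runs over elements of a set, while the list may contain repetitions;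
  each element is assigned to one of its positions.
\<close>

lemma ideal_gen_list:
  assumes "f \<in> ideal_gen V (set fs)"
  shows "\<exists>c. (\<forall>i. c i \<in> polys V) \<and> f = (\<Sum>i<length fs. c i * fs ! i)"
proof -
  obtain F q where F: "finite F" "F \<subseteq> set fs" "\<forall>a\<in>F. q a \<in> polys V" "f = (\<Sum>a\<in>F. q a * a)"
    using assms unfolding ideal_gen_def by blast
  have "\<forall>a\<in>F. \<exists>i<length fs. fs ! i = a"
    using F(2) by (auto simp: in_set_conv_nth)
  then obtain idx where idx: "\<And>a. a \<in> F \<Longrightarrow> idx a < length fs \<and> fs ! idx a = a"
    by metis
  define c where "c i = (\<Sum>a\<in>F. if idx a = i then q a else 0)" for i
  have "(\<Sum>i<length fs. c i * fs ! i) = (\<Sum>i<length fs. \<Sum>a\<in>F. if idx a = i then q a * fs ! i else 0)"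
    unfolding c_def sum_distrib_right by (intro sum.cong refl) simp
  also have "\<dots> = (\<Sum>a\<in>F. \<Sum>i<length fs. if idx a = i then q a * fs ! i else 0)"
    by (rule sum.swap)
  also have "\<dots> = f"
    unfolding F(4) using idx by (intro sum.cong) auto
  finally show ?thesis
    using F(3) by (intro exI[of _ c]) (auto simp: c_def)
qed

lemma ideal_gen_lists:
  assumes "\<forall>f\<in>set fs'. f \<in> ideal_gen V (set fs)"
  shows "\<exists>A. (\<forall>j i. A j i \<in> polys V) \<and> (\<forall>j<length fs'. fs' ! j = (\<Sum>i<length fs. A j i * fs ! i))"
proof -
  have "\<forall>j. \<exists>c. (\<forall>i. c i \<in> polys V) \<and> (j < length fs' \<longrightarrow> fs' ! j = (\<Sum>i<length fs. c i * fs ! i))"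
  proof
    fix j
    show "\<exists>c. (\<forall>i. c i \<in> polys V) \<and> (j < length fs' \<longrightarrow> fs' ! j = (\<Sum>i<length fs. c i * fs ! i))"
    proof (cases "j < length fs'")
      case True
      then show ?thesis
        using assms ideal_gen_list[of "fs' ! j" V fs] by simp
    next
      case False
      then show ?thesis
        by (intro exI[of _ "\<lambda>_. 0"]) simp
    qed
  qed
  from choice[OF this] show ?thesis by blast
qed

context generic_mat
begin

lemma generic_vars_V: "generic_vars m n = V"
  by (simp add: generic_vars_def V_def)

definition sorted_rows :: "nat set \<Rightarrow> nat list" where
  "sorted_rows R = map (pick R) [0..<n]"

lemma sorted_rows:
  assumes "R \<subseteq> {..<m}" "card R = n"
  shows "sorted_rows R \<in> rows m n" "set (sorted_rows R) = R" "distinct (sorted_rows R)"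
proof -
  have sub: "set (sorted_rows R) \<subseteq> R"
    using assms by (auto simp: sorted_rows_def pick_in_set_le)
  then show "sorted_rows R \<in> rows m n"
    using assms by (auto simp: rows_def sorted_rows_def)
  have "inj_on (pick R) {0..<n}"
  proof (rule inj_onI)
    fix i j assume "i \<in> {0..<n}" "j \<in> {0..<n}" "pick R i = pick R j"
    then show "i = j"
      using assms pick_mono_le[of j R i] pick_mono_le[of i R j] by (cases i j rule: linorder_cases) auto
  qed
  then show "distinct (sorted_rows R)"
    by (simp add: sorted_rows_def distinct_map)
  then have "card (set (sorted_rows R)) = n"
    by (simp add: distinct_card) (simp add: sorted_rows_def)
  then show "set (sorted_rows R) = R"
    using sub assms finite_subset[OF assms(1)] by (intro card_subset_eq) auto
qed

lemma maximal_minors_eq: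
  "maximal_minors m n = (\<lambda>R. minor (sorted_rows R)) ` {R. R \<subseteq> {..<m} \<and> card R = n}"
proof -
  have pick_n: "pick {..<n} j = j" if "j < n" for j
  proof -
    have "{a \<in> {..<n}. a < j} = {..<j}"
      using that by auto
    then show ?thesis
      using pick_card_in_set[of j "{..<n}"] that by simp
  qed
  have "submatrix (generic_matrix m n) R {..<n} = vmat (sorted_rows R)" if R: "R \<subseteq> {..<m}" "card R = n" for R
  proof -
    have "{i. i < m \<and> i \<in> R} = R" "{j. j < n \<and> j \<in> {..<n}} = {..<n}"
      using R by auto
    moreover have "pick R i < m" if "i < n" for i
      using pick_in_set_le[of i R] that R by auto
    ultimately show ?thesis
      using R by (intro eq_matI) (auto simp: submatrix_def generic_matrix_def vmat_def sorted_rows_def pick_n)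
  qed
  then show ?thesis
    unfolding maximal_minors_def minor_def setcompr_eq_image
    by (intro image_cong refl) (simp only: mem_Collect_eq)
qed

lemma minor_in_ideal:
  assumes ks: "ks \<in> rows m n"
  shows "minor ks \<in> ideal_gen V (maximal_minors m n)"
proof (cases "distinct ks")
  case False
  then obtain a b where ab: "a < length ks" "b < length ks" "a \<noteq> b" "ks ! a = ks ! b"
    by (auto simp: distinct_conv_nth)
  then have "row (vmat ks) a = row (vmat ks) b"
    by (intro eq_vecI) (auto simp: vmat_def)
  then have "minor ks = 0"
    unfolding minor_def using det_identical_rows[OF vmat_carrier ab(3,1,2)] by simp
  then show ?thesis
    unfolding ideal_gen_def by (intro CollectI exI[of _ "{}"]) auto
next
  case True
  define R where "R = set ks"
  define ls where "ls = sorted_rows R"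
  have R: "R \<subseteq> {..<m}" "card R = n"
    using ks True by (auto simp: R_def rows_def distinct_card)
  have len: "length ks = n" "length ls = n"
    using ks by (auto simp: rows_def ls_def sorted_rows_def)
  have "mset ks = mset ls"
    using True sorted_rows[OF R] by (intro set_eq_iff_mset_eq_distinct[THEN iffD1]) (auto simp: ls_def R_def)
  then obtain p where p: "p permutes {..<length ls}" "permute_list p ls = ks"
    by (rule mset_eq_permutation)
  have "vmat ks = mat n n (\<lambda>(i, j). vmat ls $$ (p i, j))"
  proof (rule eq_matI)
    fix i j assume "i < dim_row (mat n n (\<lambda>(i, j). vmat ls $$ (p i, j)))"
      "j < dim_col (mat n n (\<lambda>(i, j). vmat ls $$ (p i, j)))"
    then have ij: "i < n" "j < n" by auto
    then have "p i < n"
      using permutes_in_image[OF p(1), of i] len by simp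
    moreover have "ks ! i = ls ! p i"
      using p ij len by (metis permute_list_nth)
    ultimately show "vmat ks $$ (i, j) = mat n n (\<lambda>(i, j). vmat ls $$ (p i, j)) $$ (i, j)"
      using ij len by (simp add: vmat_def)
  qed (auto simp: vmat_def len)
  then have "minor ks = signof p * minor ls"
    unfolding minor_def using det_permute_rows[of "vmat ls" n p] vmat_carrier[of ls] p(1) len
    by (simp add: lessThan_atLeast0)
  moreover have "(signof p :: spoly) \<in> polys V"
    by (auto simp: sign_def intro: polys_uminus)
  moreover have "minor ls \<in> maximal_minors m n"
    using R by (auto simp: maximal_minors_eq ls_def)
  ultimately show ?thesis
    by (simp only: ideal_gen_mult)
qed

text \<open>
  Specialize the rows \<open>ks\<close> to those of the identity matrix.
\<close>

lemma minor_nonzero: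
  assumes "distinct ks"
  shows "minor ks \<noteq> 0"
proof
  assume "minor ks = 0"
  define ev where "ev = eval_hom (\<lambda>c::complex. c) (\<lambda>(k, b). if b < length ks \<and> ks ! b = k then 1 else 0)"
  have ev: "ring_map ev"
    unfolding ev_def by (rule ring_map_eval_hom[OF ring_map_id])
  interpret h: comm_ring_hom ev
    by unfold_locales (simp_all add: ring_map_0[OF ev] ring_map_1[OF ev] ring_map_add[OF ev] ring_map_mult[OF ev])
  have "map_mat ev (vmat ks) = 1\<^sub>m (length ks)"
    using assms
    by (intro eq_matI) (auto simp: vmat_def ev_def eval_hom_Var ring_map_id nth_eq_iff_index_eq)
  then have "ev (minor ks) = 1"
    unfolding minor_def by (simp flip: h.hom_det)
  then show False
    using \<open>minor ks = 0\<close> by simp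
qed

lemma lead_coeff_target: "lead_coeff target = 1"
  unfolding target_def by (simp add: lead_coeff_prod)

lemma maximal_minors_polys: "maximal_minors m n \<subseteq> polys V"
  using sorted_rows minor_V by (auto simp: maximal_minors_eq)

lemma generating_tuple_exists:
  "\<exists>fs. generating_tuple V (ideal_gen V (maximal_minors m n)) fs"
proof -
  have "finite {R. R \<subseteq> {..<m} \<and> card R = n}"
    by (rule finite_subset[of _ "Pow {..<m}"]) auto
  then have "finite (maximal_minors m n)"
    by (simp add: maximal_minors_eq)
  then obtain fs where fs: "set fs = maximal_minors m n"
    using finite_list by blast
  have "0 \<notin> maximal_minors m n"
    using minor_nonzero sorted_rows(3) unfolding maximal_minors_eq by force
  then have "generating_tuple V (ideal_gen V (maximal_minors m n)) fs"
    unfolding generating_tuple_def fs using maximal_minors_polys by (intro conjI refl)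
  then show ?thesis ..
qed

lemma bernstein_relation_iff:
  assumes "generating_tuple V (ideal_gen V (maximal_minors m n)) fs"
  shows "bernstein_relation V fs b \<longleftrightarrow> op_poly (tw.euler gens) b 1 \<in> tw.filt gens 1"
proof -
  have fs: "set fs \<subseteq> polys V" "0 \<notin> set fs" "ideal_gen V (set fs) = ideal_gen V (maximal_minors m n)"
    using assms by (auto simp: generating_tuple_def)
  have "maximal_minors m n \<subseteq> set gens"
    using sorted_rows(1) by (auto simp: maximal_minors_eq gens_def set_row_list)
  then have "ideal_gen V (set fs) \<subseteq> ideal_gen V (set gens)"
    unfolding fs(3) by (rule ideal_gen_mono)
  moreover have "f \<in> ideal_gen V (set fs)" if "f \<in> set fs" for f
    using ideal_gen_mult[OF that, of 1 V] by simp
  ultimately have "\<forall>f\<in>set fs. f \<in> ideal_gen V (set gens)"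
    by blast
  from ideal_gen_lists[OF this]
  obtain A where A: "\<And>j i. A j i \<in> polys V" "\<And>j. j < length fs \<Longrightarrow> fs ! j = (\<Sum>i<length gens. A j i * gens ! i)"
    by blast
  have "\<forall>f\<in>set gens. f \<in> ideal_gen V (set fs)"
    unfolding fs(3) using minor_in_ideal by (auto simp: gens_def set_row_list)
  from ideal_gen_lists[OF this]
  obtain B where B: "\<And>j i. B j i \<in> polys V" "\<And>j. j < length gens \<Longrightarrow> gens ! j = (\<Sum>i<length fs. B j i * fs ! i)"
    by blast
  have "op_poly (tw.euler fs) b 1 \<in> tw.filt fs 1 \<longleftrightarrow> op_poly (tw.euler gens) b 1 \<in> tw.filt gens 1"
    using tw.change_generators[OF gens_polys fs(1) A(2,1) B(2,1)]
      tw.change_generators[OF fs(1) gens_polys B(2,1) A(2,1)] by blast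
  then show ?thesis
    using tw.filt_of_bernstein[OF fs(1,2)] tw.bernstein_of_filt[OF fs(1,2)] by blast
qed

end

theorem mainTheorem1:
  fixes m n :: nat
  assumes "1 \<le> n" and "n \<le> m"
  shows "is_b_function_of_ideal (generic_vars m n)
           (ideal_gen (generic_vars m n) (maximal_minors m n))
           (\<Prod>i = m - n + 1..m. [:of_nat i, 1:])"
proof -
  interpret generic_mat m n .
  have "is_b_function V fs target"
    if fs: "generating_tuple V (ideal_gen V (maximal_minors m n)) fs" for fs
    unfolding is_b_function_def bernstein_relation_iff[OF fs]
  proof (intro conjI allI impI)
    show "lead_coeff target = 1"
      by (rule lead_coeff_target)
    show "op_poly (tw.euler gens) target 1 \<in> tw.filt gens 1"
      by (rule target_in_filt[OF assms(2)])
    fix b' :: "complex poly"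
    assume "lead_coeff b' = 1 \<and> op_poly (tw.euler gens) b' 1 \<in> tw.filt gens 1"
    moreover from this have "b' \<noteq> 0"
      by auto
    ultimately show "degree target \<le> degree b'"
      using degree_bound[OF assms(2)] by blast
  qed
  then show ?thesis
    unfolding is_b_function_of_ideal_def generic_vars_V target_def[symmetric]
    using generating_tuple_exists by blast
qed

end
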